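(* Let $d\ge 2$ and $\varphi\in\mathcal{O}(2/(d+2))$. Then the space $\overline{\mathcal{N}_\varphi}$ is convex in Wasserstein geometry if and only if there exist $\alpha>0$ and $q\in Q_d:=(0,(d+4)/(d+2))$ such that $\alpha\varphi(s)=s^q$ for all $s>0$.
   Context: For a (strictly) increasing, positive, continuous function $\varphi$ on $(0,\infty)$, let $\ln_\varphi(t):=\int_1^t \frac{1}{\varphi(s)}ds$ for $t>0$, $l_\varphi:=\inf_{t>0}\ln_\varphi(t)\in[-\infty,0)$, $L_\varphi:=\sup_{t>0}\ln_\varphi(t)\in(0,+\infty]$. The $\varphi$-exponential function is $\exp_\varphi(\tau):=0$ for $\tau\le l_\varphi$, $\exp_\varphi(\tau):=\ln_\varphi^{-1}(\tau)$ for $\tau\in(l_\varphi,L_\varphi)$, and $\exp_\varphi(\tau):=\infty$ for $\tau\ge L_\varphi$. Set $\delta_\varphi:=\inf\{\delta\in\mathbb{R} : \lim_{s\downarrow 0} s^{1+\delta}/\varphi(s) \text{ exists (as a finite limit)}\}$ and $\delta^\varphi:=\inf\{\delta\in\mathbb{R} : \lim_{s\uparrow\infty} s^{1+\delta}/\varphi(s)=\infty\}$. For $a\in\mathbb{R}$, $\mathcal{O}(a)$ is the set of all increasing, positive, continuous functions $\varphi$ on $(0,\infty)$ with $\max\{\delta_\varphi,\delta^\varphi\}<a$. Let $\mathrm{S}(d,\mathbb{R})_+$ be the set of symmetric positive definite $d\times d$ real matrices, $\mathcal{L}^d$ Lebesgue measure on $\mathbb{R}^d$, and for $V\in \mathrm{S}(d,\mathbb{R})_+$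 let $|x|_V^2:=\langle x,V^{-1}x\rangle$. For $d\ge2$ and $\varphi\in\mathcal{O}(2/(d+2))$ there exist continuous functions $\lambda_\varphi:\mathrm{S}(d,\mathbb{R})_+\to(l_\varphi,L_\varphi)$ and $c_\varphi:\mathrm{S}(d,\mathbb{R})_+\to(0,\infty)$ such that, for all $(v,V)\in\mathbb{R}^d\times \mathrm{S}(d,\mathbb{R})_+$, both $$n_\varphi(v,V)(x):=\exp_\varphi\big(\lambda_\varphi(V)-c_\varphi(V)|x-v|_V^2\big)\quad\text{and}\quad g_\varphi(v,V)(x):=\exp_\varphi\big(\lambda_\varphi(I_d)-c_\varphi(I_d)|x-v|_V^2\big)(\det V)^{-1/2}$$ are probability densities on $(\mathbb{R}^d,\mathcal{L}^d)$ with mean $v$ and covariance matrix $V$ ($I_d$ is the identity matrix). These functions are fixed; $N_\varphi(v,V):=n_\varphi(v,V)\mathcal{L}^d$ and $\mathcal{N}_\varphi:=\{N_\varphi(v,V) : (v,V)\in\mathbb{R}^d\times \mathrm{S}(d,\mathbb{R})_+\}$. $\mathcal{P}_2$ is the set of Borel probability measures on $\mathbb{R}^d$ with finite second moment, and $W_2(\mu,\nu):=\inf_\pi\big(\int_{\mathbb{R}^d\times\mathbb{R}^d}|x-y|^2d\pi(x,y)\big)^{1/2}$, the infimum being over all couplings $\pi$ of $\mu$ and $\nu$. $\overline{\mathcal{N}_\varphi}$ is the completion of $\mathcal{N}_\varphi$ with respect to $W_2$, i.e. its closure in the complete metric space $(\mathcal{P}_2,W_2)$. A Wasserstein geodesic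 is a distance-minimizing curve of constant speed in $(\mathcal{P}_2,W_2)$. A subset of $\mathcal{P}_2$ is convex in Wasserstein geometry if any two of its points can be joined by a Wasserstein geodesic contained in the subset. *)

theory Defs
  imports "HOL-Probability.Probability"
begin

section \<open>Deformed logarithms and exponentials\<close>

text \<open>
  Only the restriction of \<open>\<phi>\<close> to \<open>{0<..}\<close> is ever used.  The interval integral is
  oriented, so \<open>ln_phi \<phi> t\<close> is negative for \<open>0 < t < 1\<close>.
\<close>

definition ln_phi :: "(real \<Rightarrow> real) \<Rightarrow> real \<Rightarrow> real" where
  "ln_phi \<phi> t = (LBINT s=ereal 1..ereal t. 1 / \<phi> s)"

definition l_phi :: "(real \<Rightarrow> real) \<Rightarrow> ereal" where
  "l_phi \<phi> = (INF t\<in>{0<..}. ereal (ln_phi \<phi> t))"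

definition L_phi :: "(real \<Rightarrow> real) \<Rightarrow> ereal" where
  "L_phi \<phi> = (SUP t\<in>{0<..}. ereal (ln_phi \<phi> t))"

definition exp_phi :: "(real \<Rightarrow> real) \<Rightarrow> real \<Rightarrow> ennreal" where
  "exp_phi \<phi> \<tau> =
     (if ereal \<tau> \<le> l_phi \<phi> then 0
      else if ereal \<tau> < L_phi \<phi> then ennreal (the_inv_into {0<..} (ln_phi \<phi>) \<tau>)
      else \<infinity>)"

text \<open>The infima are taken in the extended reals, so that \<open>Inf {} = \<infinity>\<close>.\<close>

definition delta_lower :: "(real \<Rightarrow> real) \<Rightarrow> ereal" where
  "delta_lower \<phi> =
     Inf (ereal ` {\<delta>. \<exists>l::real. ((\<lambda>s. s powr (1 + \<delta>) / \<phi> s) \<longlongrightarrow> l) (at_right 0)})"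

definition delta_upper :: "(real \<Rightarrow> real) \<Rightarrow> ereal" where
  "delta_upper \<phi> =
     Inf (ereal ` {\<delta>. filterlim (\<lambda>s. s powr (1 + \<delta>) / \<phi> s) at_top at_top})"

definition O_class :: "real \<Rightarrow> (real \<Rightarrow> real) set" where
  "O_class a = {\<phi>. strict_mono_on {0<..} \<phi> \<and> (\<forall>s>0. 0 < \<phi> s) \<and> continuous_on {0<..} \<phi> \<and>
                   max (delta_lower \<phi>) (delta_upper \<phi>) < ereal a}"

section \<open>The family of densities\<close>

definition spd :: "(real^'n^'n) set" where
  "spd = {V. transpose V = V \<and> (\<forall>x. x \<noteq> 0 \<longrightarrow> 0 < x \<bullet> (V *v x))}"

definition sqnorm_wrt :: "real^'n^'n \<Rightarrow> real^'n \<Rightarrow> real" where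
  "sqnorm_wrt V x = x \<bullet> (matrix_inv V *v x)"

definition n_phi ::
  "(real \<Rightarrow> real) \<Rightarrow> (real^'n^'n \<Rightarrow> real) \<Rightarrow> (real^'n^'n \<Rightarrow> real) \<Rightarrow>
   real^'n \<Rightarrow> real^'n^'n \<Rightarrow> real^'n \<Rightarrow> ennreal" where
  "n_phi \<phi> lam c v V x = exp_phi \<phi> (lam V - c V * sqnorm_wrt V (x - v))"

definition g_phi ::
  "(real \<Rightarrow> real) \<Rightarrow> (real^'n^'n \<Rightarrow> real) \<Rightarrow> (real^'n^'n \<Rightarrow> real) \<Rightarrow>
   real^'n \<Rightarrow> real^'n^'n \<Rightarrow> real^'n \<Rightarrow> ennreal" where
  "g_phi \<phi> lam c v V x =
     exp_phi \<phi> (lam (mat 1) - c (mat 1) * sqnorm_wrt V (x - v)) * ennreal (det V powr (- 1 / 2))"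

definition has_mean :: "(real^'n) measure \<Rightarrow> real^'n \<Rightarrow> bool" where
  "has_mean M v \<longleftrightarrow> integrable M (\<lambda>x. x) \<and> (\<integral>x. x \<partial>M) = v"

text \<open>To be used only together with \<open>has_mean M v\<close>.\<close>

definition has_covariance :: "(real^'n) measure \<Rightarrow> real^'n \<Rightarrow> real^'n^'n \<Rightarrow> bool" where
  "has_covariance M v V \<longleftrightarrow>
     (\<forall>i j. integrable M (\<lambda>x. (x $ i - v $ i) * (x $ j - v $ j)) \<and>
            (\<integral>x. (x $ i - v $ i) * (x $ j - v $ j) \<partial>M) = V $ i $ j)"

definition prob_density_mean_cov :: "(real^'n \<Rightarrow> ennreal) \<Rightarrow> real^'n \<Rightarrow> real^'n^'n \<Rightarrow> bool" where
  "prob_density_mean_cov f v V \<longleftrightarrow>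
     f \<in> borel_measurable lborel \<and> prob_space (density lborel f) \<and>
     has_mean (density lborel f) v \<and> has_covariance (density lborel f) v V"

definition normalizing_functions ::
  "(real \<Rightarrow> real) \<Rightarrow> (real^'n^'n \<Rightarrow> real) \<Rightarrow> (real^'n^'n \<Rightarrow> real) \<Rightarrow> bool" where
  "normalizing_functions \<phi> lam c \<longleftrightarrow>
     continuous_on spd lam \<and> continuous_on spd c \<and>
     (\<forall>V\<in>spd. l_phi \<phi> < ereal (lam V) \<and> ereal (lam V) < L_phi \<phi> \<and> 0 < c V) \<and>
     (\<forall>v. \<forall>V\<in>spd. prob_density_mean_cov (n_phi \<phi> lam c v V) v V \<and>
                   prob_density_mean_cov (g_phi \<phi> lam c v V) v V)"

definition N_phi ::
  "(real \<Rightarrow> real) \<Rightarrow> (real^'n^'n \<Rightarrow> real) \<Rightarrow> (real^'n^'n \<Rightarrow> real) \<Rightarrow>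
   real^'n \<Rightarrow> real^'n^'n \<Rightarrow> (real^'n) measure" where
  "N_phi \<phi> lam c v V = density lborel (n_phi \<phi> lam c v V)"

definition N_space ::
  "(real \<Rightarrow> real) \<Rightarrow> (real^'n^'n \<Rightarrow> real) \<Rightarrow> (real^'n^'n \<Rightarrow> real) \<Rightarrow> (real^'n) measure set" where
  "N_space \<phi> lam c = {N_phi \<phi> lam c v V | v V. V \<in> spd}"

section \<open>Wasserstein geometry\<close>

definition P2 :: "('a::euclidean_space) measure set" where
  "P2 = {M. sets M = sets borel \<and> prob_space M \<and> integrable M (\<lambda>x. (norm x)\<^sup>2)}"

definition couplings :: "('a::euclidean_space) measure \<Rightarrow> 'a measure \<Rightarrow> ('a \<times> 'a) measure set" where
  "couplings \<mu> \<nu> = {\<pi>. sets \<pi> = sets borel \<and> prob_space \<pi> \<and>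
                        distr \<pi> borel fst = \<mu> \<and> distr \<pi> borel snd = \<nu>}"

text \<open>
  For \<open>\<mu>\<close>, \<open>\<nu>\<close> in \<open>P2\<close> the set of couplings is nonempty and the cost is integrable with
  respect to each of them, so the real-valued integral and infimum have their intended meaning.
  \<open>W2\<close> is not meaningful outside \<open>P2\<close>.
\<close>

definition W2 :: "('a::euclidean_space) measure \<Rightarrow> 'a measure \<Rightarrow> real" where
  "W2 \<mu> \<nu> = (INF \<pi>\<in>couplings \<mu> \<nu>. sqrt (\<integral>z. (norm (fst z - snd z))\<^sup>2 \<partial>\<pi>))"

definition W2_closure :: "('a::euclidean_space) measure set \<Rightarrow> 'a measure set" where
  "W2_closure A = {\<mu>\<in>P2. \<forall>\<epsilon>>0. \<exists>\<nu>\<in>A. W2 \<mu> \<nu> < \<epsilon>}"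

definition W2_geodesic :: "(real \<Rightarrow> ('a::euclidean_space) measure) \<Rightarrow> bool" where
  "W2_geodesic \<gamma> \<longleftrightarrow>
     (\<forall>t\<in>{0..1}. \<gamma> t \<in> P2) \<and>
     (\<forall>s\<in>{0..1}. \<forall>t\<in>{0..1}. W2 (\<gamma> s) (\<gamma> t) = \<bar>s - t\<bar> * W2 (\<gamma> 0) (\<gamma> 1))"

definition W2_convex :: "('a::euclidean_space) measure set \<Rightarrow> bool" where
  "W2_convex A \<longleftrightarrow>
     (\<forall>\<mu>\<in>A. \<forall>\<nu>\<in>A. \<exists>\<gamma>. W2_geodesic \<gamma> \<and> \<gamma> 0 = \<mu> \<and> \<gamma> 1 = \<nu> \<and> (\<forall>t\<in>{0..1}. \<gamma> t \<in> A))"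

end

theory Submission
  imports Defs
begin

text \<open>
  For a power \<open>\<phi>\<close>, rescaling \<open>exp_phi \<phi>\<close> by a constant amounts to an affine change of its argument.
  Since a density \<open>exp_phi \<phi> (l - b * |x - v|\<^sub>V\<^sup>2)\<close> is determined by its mass, mean and covariance, every
  invertible affine image of \<open>Z = N\<^sub>\<phi>(0, I)\<close> is a member of the family, and the closure consists of the
  laws of \<open>v + A Z\<close> with arbitrary, possibly singular, \<open>A\<close>. If \<open>B\<^sup>T A\<close> is positive semidefinite, then
  the law of \<open>v + A Z\<close> has distance \<open>(|v - w|\<^sup>2 + |A - B|\<^sup>2)\<^sup>1\<^sup>/\<^sup>2\<close> from that of \<open>w + B Z\<close>, by duality with quadratic
  potentials, and interpolating linearly between \<open>(v, A)\<close> and \<open>(w, B)\<close> gives a geodesic. The condition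
  can always be achieved by replacing \<open>B\<close> with \<open>B O\<close> for an orthogonal \<open>O\<close>, which does not change the law.

  Conversely, let the closure be convex. For \<open>\<kappa> \<ge> 1\<close> there is a positive diagonal \<open>T\<close> with \<open>det T = 1\<close> such that
  \<open>S = (I + T) / 2\<close> has determinant \<open>\<kappa>\<close>. With \<open>V = S\<^sup>-\<^sup>2\<close>, the measures \<open>N\<^sub>\<phi>(0, V)\<close> and \<open>N\<^sub>\<phi>(0, T V T)\<close> are related by
  the map \<open>T\<close>, the only possible midpoint is the image of \<open>N\<^sub>\<phi>(0, V)\<close> under \<open>S\<close>, and the only member of
  the closure with its mean and covariance is \<open>N\<^sub>\<phi>(0, I)\<close>. Comparing densities gives an affine relation
  between \<open>ln_phi \<phi> (\<kappa> * y)\<close> and \<open>ln_phi \<phi> y\<close> for small \<open>y\<close>; differentiating, \<open>\<phi> (\<kappa> * y)\<close> is a multiple of \<open>\<phi> y\<close>,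
  so \<open>\<phi>\<close> is a power.
\<close>

section \<open>Deformed exponentials\<close>

text \<open>The determinants carry the argument. Since \<open>det T = 1\<close>, pushing forward by
  \<open>T\<close> keeps density values, so both endpoints belong to the family whatever \<phi> is,
  while the midpoint map divides the values by \<kappa>. The choice of \<open>V\<close> puts every
  midpoint at identity covariance, so one fixed profile serves all \<kappa> and the range of small
  \<open>y\<close> does not depend on \<kappa>. This uniformity makes the multiplier of
  \<open>\<phi> y\<close> multiplicative in \<kappa>, and monotonicity of \<phi> excludes irregular
  solutions. The obstacle is that convexity offers some geodesic, about which nothing else is known.
  Its midpoint is pinned down by quadratic potentials whose slack measures the distance from the
  image under \<open>S\<close>; near-optimal couplings make that slack small. Convergence in
  \<open>W2\<close> then forces the parameters of approximating members to converge, and their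
  densities follow by continuity of \<open>lam\<close> and \<open>c\<close>. As \<open>lam\<close>
  and \<open>c\<close> are implicit, affine images are recognized as members by uniqueness of the
  elliptic density with given moments.\<close>

lemma ennreal_eqI_less:
  fixes a b :: ennreal
  assumes "\<And>y. 0 < y \<Longrightarrow> ennreal y < a \<longleftrightarrow> ennreal y < b"
  shows "a = b"
proof -
  have "a \<le> b" if *: "\<And>y. 0 < y \<Longrightarrow> ennreal y < a \<Longrightarrow> ennreal y < b" for a b :: ennreal
  proof (rule ccontr)
    assume "\<not> a \<le> b"
    then have "b < a" by simp
    then obtain z where z: "b < z" "z < a" using dense by blast
    then obtain y where y: "z = ennreal y" "0 \<le> y" by (cases z) auto
    have "0 < y" using z y by (cases "y = 0") auto
    with *[of y] y z show False by auto
  qed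
  then show ?thesis using assms by (intro antisym) auto
qed

locale deformation =
  fixes \<phi> :: "real \<Rightarrow> real"
  assumes pos: "0 < s \<Longrightarrow> 0 < \<phi> s"
    and cont: "continuous_on {0<..} \<phi>"
begin

lemma ln_phi_1 [simp]: "ln_phi \<phi> 1 = 0"
  by (simp add: ln_phi_def one_ereal_def)

lemma DERIV_ln_phi:
  assumes "0 < t"
  shows "(ln_phi \<phi> has_real_derivative 1 / \<phi> t) (at t)"
proof -
  \<comment> \<open>An interval with both the base point 1 and \<open>t\<close> in its interior, so
    that the derivative at \<open>t\<close> is two-sided on either side of 1.\<close>
  define a b where "a = min 1 t / 2" and "b = max 1 t + 1"
  have ab: "0 < a" "a < 1" "a < t" "1 < b" "t < b"
    using assms by (auto simp: a_def b_def min_def)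
  have "continuous_on {a..b} (\<lambda>s. 1 / \<phi> s)"
  proof (intro continuous_on_divide continuous_on_const continuous_on_subset[OF cont] ballI)
    fix s assume "s \<in> {a..b}"
    then show "\<phi> s \<noteq> 0" using pos[of s] ab by simp
  qed (use ab in auto)
  then have "((\<lambda>u. LBINT y=1..u. 1 / \<phi> y) has_vector_derivative 1 / \<phi> t) (at t within {a..b})"
    using ab interval_integral_FTC2[of a 1 b "\<lambda>s. 1 / \<phi> s" t] by (auto simp: one_ereal_def)
  moreover have "at t within {a..b} = at t"
    using ab by (intro at_within_interior) auto
  ultimately show ?thesis
    by (simp add: has_real_derivative_iff_has_vector_derivative ln_phi_def[abs_def] one_ereal_def)
qed

lemma ln_phi_less: "0 < s \<Longrightarrow> s < t \<Longrightarrow> ln_phi \<phi> s < ln_phi \<phi> t"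
  by (rule DERIV_pos_imp_increasing[of s t "ln_phi \<phi>"])
    (auto intro!: exI[of _ "1 / \<phi> _"] DERIV_ln_phi pos simp: zero_less_divide_iff)

lemma ln_phi_less_iff [simp]:
  "0 < s \<Longrightarrow> 0 < t \<Longrightarrow> ln_phi \<phi> s < ln_phi \<phi> t \<longleftrightarrow> s < t"
  by (metis ln_phi_less not_less_iff_gr_or_eq)

lemma ln_phi_eq_iff [simp]:
  "0 < s \<Longrightarrow> 0 < t \<Longrightarrow> ln_phi \<phi> s = ln_phi \<phi> t \<longleftrightarrow> s = t"
  by (metis ln_phi_less not_less_iff_gr_or_eq)

lemma l_phi_less_ln: "0 < t \<Longrightarrow> l_phi \<phi> < ereal (ln_phi \<phi> t)"
  unfolding l_phi_def INF_less_iff by (rule bexI[of _ "t / 2"]) auto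

lemma ln_less_L_phi: "0 < t \<Longrightarrow> ereal (ln_phi \<phi> t) < L_phi \<phi>"
  unfolding L_phi_def less_SUP_iff by (rule bexI[of _ "2 * t"]) auto

lemma ln_phi_surj:
  assumes "l_phi \<phi> < ereal \<tau>" "ereal \<tau> < L_phi \<phi>"
  obtains y where "0 < y" "ln_phi \<phi> y = \<tau>"
proof -
  obtain s t where st: "0 < s" "ln_phi \<phi> s < \<tau>" "0 < t" "\<tau> < ln_phi \<phi> t"
    using assms unfolding l_phi_def L_phi_def INF_less_iff less_SUP_iff by auto
  then have "s < t" by (metis ln_phi_less_iff order_less_trans)
  have "\<exists>y\<ge>s. y \<le> t \<and> ln_phi \<phi> y = \<tau>"
    using st \<open>s < t\<close> DERIV_isCont[OF DERIV_ln_phi] by (intro IVT) auto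
  with st that show ?thesis by force
qed

lemma exp_phi_ln: "0 < y \<Longrightarrow> exp_phi \<phi> (ln_phi \<phi> y) = ennreal y"
proof -
  assume y: "0 < y"
  have "inj_on (ln_phi \<phi>) {0<..}" by (auto simp: inj_on_def)
  then have "the_inv_into {0<..} (ln_phi \<phi>) (ln_phi \<phi> y) = y"
    using y by (intro the_inv_into_f_f) auto
  then show ?thesis
    using l_phi_less_ln[OF y] ln_less_L_phi[OF y] by (simp add: exp_phi_def not_le)
qed

lemma exp_phi_cases:
  obtains "exp_phi \<phi> \<tau> = 0" "ereal \<tau> \<le> l_phi \<phi>"
  | y where "0 < y" "\<tau> = ln_phi \<phi> y" "exp_phi \<phi> \<tau> = ennreal y"
  | "exp_phi \<phi> \<tau> = \<infinity>" "L_phi \<phi> \<le> ereal \<tau>"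
proof (cases "ereal \<tau> \<le> l_phi \<phi>")
  case True
  with that(1) show ?thesis by (simp add: exp_phi_def)
next
  case False
  show ?thesis
  proof (cases "ereal \<tau> < L_phi \<phi>")
    case True
    with False obtain y where "0 < y" "ln_phi \<phi> y = \<tau>" using ln_phi_surj[of \<tau>] by (metis not_le)
    with that(2)[of y] show ?thesis by (auto simp: exp_phi_ln)
  next
    case False': False
    with False that(3) show ?thesis by (simp add: exp_phi_def)
  qed
qed

text \<open>The truncated values 0 and infinity are dealt with here and in the dual rule;
  monotonicity, continuity and scaling of \<open>exp_phi\<close> are then read off from its level
  sets.\<close>

lemma less_exp_phi_iff:
  assumes "0 < y"
  shows "ennreal y < exp_phi \<phi> \<tau> \<longleftrightarrow> ln_phi \<phi> y < \<tau>"
proof (cases \<tau> rule: exp_phi_cases)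
  case 1
  then have "\<tau> < ln_phi \<phi> y"
    using l_phi_less_ln[OF assms] by (metis order.strict_trans1 less_ereal.simps(1))
  with 1 show ?thesis by simp
next
  case (2 z)
  then show ?thesis using assms by (simp add: ennreal_less_iff)
next
  case 3
  then have "ln_phi \<phi> y < \<tau>"
    using ln_less_L_phi[OF assms] by (metis order.strict_trans2 less_ereal.simps(1))
  with 3 show ?thesis by simp
qed

lemma exp_phi_less_iff:
  assumes "0 < y"
  shows "exp_phi \<phi> \<tau> < ennreal y \<longleftrightarrow> \<tau> < ln_phi \<phi> y"
proof (cases \<tau> rule: exp_phi_cases)
  case 1
  then have "\<tau> < ln_phi \<phi> y"
    using l_phi_less_ln[OF assms] by (metis order.strict_trans1 less_ereal.simps(1))
  with 1 assms show ?thesis by simp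
next
  case (2 z)
  then show ?thesis using assms by (simp add: ennreal_less_iff)
next
  case 3
  then have "ln_phi \<phi> y < \<tau>"
    using ln_less_L_phi[OF assms] by (metis order.strict_trans2 less_ereal.simps(1))
  with 3 show ?thesis by simp
qed

lemma exp_phi_eq_ennreal_iff: "0 < y \<Longrightarrow> exp_phi \<phi> \<tau> = ennreal y \<longleftrightarrow> \<tau> = ln_phi \<phi> y"
  by (metis exp_phi_less_iff exp_phi_ln less_exp_phi_iff linorder_less_linear order_less_irrefl)

lemma exp_phi_finite: "ereal \<tau> < L_phi \<phi> \<Longrightarrow> exp_phi \<phi> \<tau> < \<infinity>"
  by (auto simp: exp_phi_def)

lemma mono_exp_phi: "\<sigma> \<le> \<tau> \<Longrightarrow> exp_phi \<phi> \<sigma> \<le> exp_phi \<phi> \<tau>"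
proof (rule ccontr)
  assume *: "\<sigma> \<le> \<tau>" "\<not> exp_phi \<phi> \<sigma> \<le> exp_phi \<phi> \<tau>"
  then have "exp_phi \<phi> \<tau> < exp_phi \<phi> \<sigma>" by simp
  then obtain z where z: "exp_phi \<phi> \<tau> < z" "z < exp_phi \<phi> \<sigma>" using dense by blast
  then obtain y where y: "z = ennreal y" "0 \<le> y" by (cases z) auto
  have "0 < y" using z y by (cases "y = 0") auto
  with z y * show False by (auto simp: less_exp_phi_iff exp_phi_less_iff)
qed

text \<open>Comparing \<open>exp_phi\<close> with a level \<open>y > 0\<close> is comparing its
  argument with \<open>ln_phi \<phi> y\<close>. This gives continuity into \<open>ennreal\<close>
  also where the argument leaves the range of \<open>ln_phi\<close>.\<close>

lemma exp_phi_tendsto: "(exp_phi \<phi> \<longlongrightarrow> exp_phi \<phi> \<tau>) (at \<tau>)"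
proof (rule order_tendstoI)
  fix a assume "a < exp_phi \<phi> \<tau>"
  then obtain z where z: "a < z" "z < exp_phi \<phi> \<tau>" using dense by blast
  then obtain y where y: "z = ennreal y" "0 \<le> y" by (cases z) auto
  have y0: "0 < y" using z y by (cases "y = 0") auto
  have "eventually (\<lambda>\<sigma>. ln_phi \<phi> y < \<sigma>) (at \<tau>)"
    using z y y0 by (intro order_tendstoD(1)[OF tendsto_ident_at]) (auto simp: less_exp_phi_iff)
  then show "eventually (\<lambda>\<sigma>. a < exp_phi \<phi> \<sigma>) (at \<tau>)"
    by eventually_elim (use y0 y z in \<open>metis less_exp_phi_iff order_less_trans\<close>)
next
  fix a assume "exp_phi \<phi> \<tau> < a"
  then obtain z where z: "exp_phi \<phi> \<tau> < z" "z < a" using dense by blast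
  then obtain y where y: "z = ennreal y" "0 \<le> y" by (cases z) auto
  have y0: "0 < y" using z y by (cases "y = 0") auto
  have "eventually (\<lambda>\<sigma>. \<sigma> < ln_phi \<phi> y) (at \<tau>)"
    using z y y0 by (intro order_tendstoD(2)[OF tendsto_ident_at]) (auto simp: exp_phi_less_iff)
  then show "eventually (\<lambda>\<sigma>. exp_phi \<phi> \<sigma> < a) (at \<tau>)"
    by eventually_elim (use y0 y z in \<open>metis exp_phi_less_iff order_less_trans\<close>)
qed

lemma continuous_on_exp_phi: "continuous_on UNIV (exp_phi \<phi>)"
  using exp_phi_tendsto by (simp add: continuous_on_def)

lemma measurable_exp_phi [measurable]: "exp_phi \<phi> \<in> borel_measurable borel"
  using continuous_on_exp_phi by (rule borel_measurable_continuous_onI)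

end

lemma O_class_deformation: "\<phi> \<in> O_class a \<Longrightarrow> deformation \<phi>"
  by (auto simp: O_class_def deformation_def)

lemma power_deformation:
  assumes "0 < \<alpha>" "\<And>s. 0 < s \<Longrightarrow> \<alpha> * \<phi> s = s powr q"
  shows "deformation \<phi>"
proof
  have eq: "\<phi> s = s powr q / \<alpha>" if "0 < s" for s
    using assms(1) assms(2)[OF that] by (simp add: field_simps)
  show "0 < \<phi> s" if "0 < s" for s using eq[OF that] that assms(1) by simp
  have "continuous_on {0<..} (\<lambda>s. s powr q / \<alpha>)"
    using assms(1) by (intro continuous_intros) auto
  then show "continuous_on {0<..} \<phi>" 
    by (rule continuous_on_eq) (simp add: eq)
qed

text \<open>For a power, \<open>ln_phi \<phi> (k * t)\<close> is an affine function of
  \<open>ln_phi \<phi> t\<close>. Comparing superlevel sets transfers this to the inverse, including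
  the values 0 and infinity.\<close>

lemma exp_phi_power_scale:
  assumes \<alpha>: "0 < \<alpha>" "\<And>s. 0 < s \<Longrightarrow> \<alpha> * \<phi> s = s powr q" and k: "0 < k"
  shows "exp_phi \<phi> (ln_phi \<phi> k + k powr (1 - q) * \<tau>) = ennreal k * exp_phi \<phi> \<tau>"
proof -
  interpret deformation \<phi> using \<alpha> by (rule power_deformation)
  have eq: "\<phi> s = s powr q / \<alpha>" if "0 < s" for s
    using \<alpha>(1) \<alpha>(2)[OF that] by (simp add: field_simps)
  have ln: "ln_phi \<phi> (k * t) = ln_phi \<phi> k + k powr (1 - q) * ln_phi \<phi> t" if t: "0 < t" for t
  proof -
    \<comment> \<open>Both terms have derivative
      \<open>\<alpha> * k powr (1 - q) * u powr (- q)\<close> at \<open>u\<close>, so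
      \<open>?f\<close> is constant; its value is read off at 1.\<close>
    let ?f = "\<lambda>t. ln_phi \<phi> (k * t) - k powr (1 - q) * ln_phi \<phi> t"
    have D: "(?f has_real_derivative 0) (at u within {0<..})" if u: "u \<in> {0<..}" for u
    proof -
      have "(?f has_real_derivative (1 / \<phi> (k * u)) * k - k powr (1 - q) * (1 / \<phi> u)) (at u)"
        using k u by (auto intro!: derivative_eq_intros DERIV_chain2[OF DERIV_ln_phi] DERIV_ln_phi)
      also have "(1 / \<phi> (k * u)) * k - k powr (1 - q) * (1 / \<phi> u) = 0"
        using k u \<alpha>(1) by (simp add: eq powr_mult powr_diff field_simps)
      finally show ?thesis
        by (rule has_field_derivative_at_within)
    qed
    then obtain c where "\<forall>u\<in>{0<..}. ?f u = c"
      using has_field_derivative_zero_constant[of "{0<..}" ?f] by auto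
    then have "?f t = ?f 1" using t bspec[of "{0<..}" _ t] bspec[of "{0<..}" _ "1::real"]
      by (metis greaterThan_iff zero_less_one)
    then show ?thesis by simp
  qed
  show ?thesis
  proof (rule ennreal_eqI_less)
    fix y :: real assume y: "0 < y"
    have "ennreal y < exp_phi \<phi> (ln_phi \<phi> k + k powr (1 - q) * \<tau>) \<longleftrightarrow> ln_phi \<phi> (y / k) < \<tau>"
      using ln[of "y / k"] y k by (simp add: less_exp_phi_iff)
    also have "\<dots> \<longleftrightarrow> ennreal (y / k) < exp_phi \<phi> \<tau>" using y k by (simp add: less_exp_phi_iff)
    also have "\<dots> \<longleftrightarrow> ennreal k * ennreal (y / k) < ennreal k * exp_phi \<phi> \<tau>"
      using k y by (cases "exp_phi \<phi> \<tau>") (auto simp: field_simps ennreal_less_iff ennreal_mult_less_top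
          ennreal_mult_top simp flip: ennreal_mult)
    also have "ennreal k * ennreal (y / k) = ennreal y"
      using k y by (simp flip: ennreal_mult)
    finally show "ennreal y < exp_phi \<phi> (ln_phi \<phi> k + k powr (1 - q) * \<tau>) \<longleftrightarrow>
      ennreal y < ennreal k * exp_phi \<phi> \<tau>" .
  qed
qed

section \<open>Matrices\<close>

declare transpose_matrix_vector [simp del]

section \<open>The Frobenius inner product and orthogonal matrices\<close>

lemma inner_matrix: "(A::real^'n^'m) \<bullet> B = (\<Sum>i\<in>UNIV. \<Sum>j\<in>UNIV. A $ i $ j * B $ i $ j)"
  by (simp add: inner_vec_def)

lemma inner_transpose [simp]: "transpose (A::real^'n^'m) \<bullet> transpose B = A \<bullet> B"
  unfolding inner_matrix transpose_def by (subst sum.swap) simp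

text \<open>With its mirror image below, this replaces manipulation of traces:
  \<open>mat 1 \<bullet> X\<close> is the trace of \<open>X\<close>.\<close>

lemma inner_matrix_mul_left:
  "((A::real^'n^'m) ** (B::real^'k^'n)) \<bullet> C = B \<bullet> (transpose A ** C)"
proof -
  have "(A ** B) \<bullet> C = (\<Sum>i\<in>UNIV. \<Sum>j\<in>UNIV. \<Sum>l\<in>UNIV. A $ i $ l * B $ l $ j * C $ i $ j)"
    by (simp add: inner_matrix matrix_matrix_mult_def sum_distrib_right)
  also have "\<dots> = (\<Sum>i\<in>UNIV. \<Sum>l\<in>UNIV. \<Sum>j\<in>UNIV. A $ i $ l * B $ l $ j * C $ i $ j)"
    by (rule sum.cong[OF refl]) (rule sum.swap)
  also have "\<dots> = (\<Sum>l\<in>UNIV. \<Sum>i\<in>UNIV. \<Sum>j\<in>UNIV. A $ i $ l * B $ l $ j * C $ i $ j)"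
    by (rule sum.swap)
  also have "\<dots> = (\<Sum>l\<in>UNIV. \<Sum>j\<in>UNIV. \<Sum>i\<in>UNIV. A $ i $ l * B $ l $ j * C $ i $ j)"
    by (rule sum.cong[OF refl]) (rule sum.swap)
  also have "\<dots> = B \<bullet> (transpose A ** C)"
    by (simp add: inner_matrix matrix_matrix_mult_def transpose_def sum_distrib_left mult_ac)
  finally show ?thesis .
qed

lemma inner_matrix_mul_right:
  "((A::real^'n^'m) ** (B::real^'k^'n)) \<bullet> C = A \<bullet> (C ** transpose B)"
  using inner_matrix_mul_left[of "transpose B" "transpose A" "transpose C"]
  by (simp flip: matrix_transpose_mul)
   (metis inner_transpose matrix_transpose_mul transpose_transpose)

lemma dot_matrix_transpose: "(x::real^'m) \<bullet> ((A::real^'n^'m) *v y) = (transpose A *v x) \<bullet> y"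
  by (simp add: transpose_matrix_vector dot_lmul_matrix)

lemma matrix_mul_orthogonal_cancel:
  fixes O1 :: "real^'n^'n"
  assumes "orthogonal_matrix O1"
  shows "A ** O1 ** transpose O1 = A" "A ** transpose O1 ** O1 = A"
    "O1 ** (transpose O1 ** B) = B" "transpose O1 ** (O1 ** B) = B"
proof -
  show "A ** O1 ** transpose O1 = A"
    unfolding matrix_mul_assoc[symmetric] using assms by (simp add: orthogonal_matrix_def)
  show "A ** transpose O1 ** O1 = A"
    unfolding matrix_mul_assoc[symmetric] using assms by (simp add: orthogonal_matrix_def)
  show "O1 ** (transpose O1 ** B) = B"
    unfolding matrix_mul_assoc using assms by (simp add: orthogonal_matrix_def)
  show "transpose O1 ** (O1 ** B) = B"
    unfolding matrix_mul_assoc using assms by (simp add: orthogonal_matrix_def)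
qed

lemma norm_orthogonal_mul_left:
  assumes "orthogonal_matrix O1"
  shows "norm (O1 ** (A::real^'n^'m)) = norm A"
  by (simp add: norm_eq_sqrt_inner inner_matrix_mul_left matrix_mul_orthogonal_cancel[OF assms])

lemma norm_orthogonal_mul_right:
  assumes "orthogonal_matrix O1"
  shows "norm ((A::real^'m^'n) ** O1) = norm A"
  by (simp add: norm_eq_sqrt_inner inner_matrix_mul_right matrix_mul_orthogonal_cancel[OF assms])

lemma transpose_diff: "transpose ((A::real^'n^'m) - B) = transpose A - transpose B"
  by (simp add: transpose_def vec_eq_iff)

lemma transpose_add: "transpose ((A::real^'n^'m) + B) = transpose A + transpose B"
  by (simp add: transpose_def vec_eq_iff)

lemma transpose_scaleR: "transpose (c *\<^sub>R (A::real^'n^'m)) = c *\<^sub>R transpose A"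
  by (simp add: transpose_def vec_eq_iff)

section \<open>Positive semidefinite and positive definite matrices\<close>

definition psd :: "real^'n^'n \<Rightarrow> bool" where
  "psd M \<longleftrightarrow> transpose M = M \<and> (\<forall>x. 0 \<le> x \<bullet> (M *v x))"

lemma spd_imp_psd: "M \<in> spd \<Longrightarrow> psd M"
  unfolding spd_def psd_def by (auto simp: less_imp_le) (metis inner_zero_left less_imp_le order_refl)

lemma spd_symmetric: "V \<in> spd \<Longrightarrow> transpose V = V"
  by (simp add: spd_def)

text \<open>A first-order condition: a quadratic vanishing at 0 and nonnegative on both sides has
  slope 0 there.\<close>

lemma linear_part_zero:
  fixes a b :: real
  assumes "\<And>\<epsilon>. 0 \<le> \<epsilon> * a + \<epsilon>\<^sup>2 * b"
  shows "a = 0"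
proof (rule ccontr)
  assume "a \<noteq> 0"
  \<comment> \<open>Makes the linear term \<open>- \<epsilon>\<^sup>2 * (\<bar>b\<bar> + 1)\<close>,
    which outweighs the quadratic one.\<close>
  define \<epsilon> where "\<epsilon> = - a / (\<bar>b\<bar> + 1)"
  have "\<epsilon> * (\<bar>b\<bar> + 1) = - a" by (simp add: \<epsilon>_def)
  then have a: "a = - (\<epsilon> * (\<bar>b\<bar> + 1))" by simp
  have "\<epsilon> * a + \<epsilon>\<^sup>2 * b = \<epsilon>\<^sup>2 * (b - (\<bar>b\<bar> + 1))"
    by (subst a) (simp add: algebra_simps power2_eq_square)
  also have "\<dots> < 0" using \<open>a \<noteq> 0\<close> by (intro mult_pos_neg) (use a in auto)
  finally show False using assms[of \<epsilon>] by simp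
qed

lemma matrix_inv_cancel:
  fixes A :: "real^'n^'n"
  assumes "invertible A"
  shows "A ** matrix_inv A = mat 1" "matrix_inv A ** A = mat 1"
  using someI_ex[of "\<lambda>A'. A ** A' = mat 1 \<and> A' ** A = mat 1"] assms
  unfolding invertible_def matrix_inv_def by auto

lemma matrix_inv_unique:
  fixes A :: "real^'n^'n"
  assumes "A ** B = mat 1"
  shows "matrix_inv A = B"
proof -
  have "invertible A" using assms invertible_right_inverse by blast
  then have "matrix_inv A ** A ** B = B" using matrix_inv_cancel[of A] by simp
  then show ?thesis using assms by (simp add: matrix_mul_assoc[symmetric])
qed

lemma invertible_matrix_inv: "invertible (A::real^'n^'n) \<Longrightarrow> invertible (matrix_inv A)"
  using matrix_inv_cancel[of A] unfolding invertible_def by blast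

lemma matrix_inv_transpose:
  "invertible (A::real^'n^'n) \<Longrightarrow> matrix_inv (transpose A) = transpose (matrix_inv A)"
  by (rule matrix_inv_unique) (simp flip: matrix_transpose_mul add: matrix_inv_cancel)

lemma matrix_inv_vector_cancel:
  assumes "invertible (A::real^'n^'n)"
  shows "A *v (matrix_inv A *v x) = x" "matrix_inv A *v (A *v x) = x"
  using assms by (simp_all add: matrix_vector_mul_assoc matrix_inv_cancel)

text \<open>A null vector \<open>x\<close> of a semidefinite form lies in the kernel of
  \<open>M\<close>: otherwise moving from \<open>x\<close> in some direction \<open>y\<close> would
  make the form negative to first order.\<close>

lemma psd_invertible_imp_spd:
  assumes M: "psd M" and inv: "invertible M"
  shows "M \<in> spd"
proof -
  have sym: "transpose M = M" using M by (simp add: psd_def)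
  have "x = 0" if x: "x \<bullet> (M *v x) = 0" for x
  proof -
    have "y \<bullet> (M *v x) = 0" for y
    proof -
      have "2 * (y \<bullet> (M *v x)) = 0"
      proof (rule linear_part_zero)
        fix \<epsilon>
        have "0 \<le> (x + \<epsilon> *\<^sub>R y) \<bullet> (M *v (x + \<epsilon> *\<^sub>R y))" using M by (simp add: psd_def)
        also have "x \<bullet> (M *v y) = y \<bullet> (M *v x)"
          using dot_matrix_transpose[of x M y] sym by (simp add: inner_commute)
        then have "(x + \<epsilon> *\<^sub>R y) \<bullet> (M *v (x + \<epsilon> *\<^sub>R y)) =
            \<epsilon> * (2 * (y \<bullet> (M *v x))) + \<epsilon>\<^sup>2 * (y \<bullet> (M *v y))"
          using x by (simp add: matrix_vector_right_distrib matrix_vector_mult_scaleR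
              inner_add_left inner_add_right power2_eq_square algebra_simps)
        finally show "0 \<le> \<epsilon> * (2 * (y \<bullet> (M *v x))) + \<epsilon>\<^sup>2 * (y \<bullet> (M *v y))" .
      qed
      then show ?thesis by simp
    qed
    then have "M *v x = 0" by (metis inner_eq_zero_iff)
    then show "x = 0" using matrix_inv_vector_cancel(2)[OF inv, of x] by simp
  qed
  then show ?thesis using M unfolding spd_def psd_def by (auto simp: less_le)
qed

lemma spd_invertible: "V \<in> spd \<Longrightarrow> invertible V"
  unfolding invertible_left_inverse matrix_left_invertible_ker spd_def
  by auto

lemma spd_matrix_inv:
  assumes V: "V \<in> spd"
  shows "matrix_inv V \<in> spd"
proof -
  have inv: "invertible V" using V by (rule spd_invertible)
  have sym: "transpose (matrix_inv V) = matrix_inv V"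
    using matrix_inv_transpose[OF inv] V by (simp add: spd_def)
  have "0 < x \<bullet> (matrix_inv V *v x)" if "x \<noteq> 0" for x
  proof -
    have "matrix_inv V *v x \<noteq> 0" using that matrix_inv_vector_cancel(1)[OF inv, of x] by auto
    then have "0 < (matrix_inv V *v x) \<bullet> (V *v (matrix_inv V *v x))" using V by (simp add: spd_def)
    then show ?thesis by (simp add: matrix_inv_vector_cancel[OF inv] inner_commute)
  qed
  with sym show ?thesis by (simp add: spd_def)
qed

lemma spd_congruence:
  fixes A V :: "real^'n^'n"
  assumes V: "V \<in> spd" and A: "invertible A"
  shows "A ** V ** transpose A \<in> spd"
proof -
  have "0 < x \<bullet> ((A ** V ** transpose A) *v x)" if "x \<noteq> 0" for x
  proof -
    have "transpose A *v x \<noteq> 0"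
      using that matrix_inv_vector_cancel(2)[OF transpose_invertible[OF A], of x] by auto
    then have "0 < (transpose A *v x) \<bullet> (V *v (transpose A *v x))" using V by (simp add: spd_def)
    then show ?thesis
      by (simp add: dot_matrix_transpose flip: matrix_vector_mul_assoc)
  qed
  then show ?thesis using V by (simp add: spd_def matrix_transpose_mul matrix_mul_assoc)
qed

lemma spd_mat_1: "mat 1 \<in> spd"
  by (simp add: spd_def)

lemma sqnorm_congruence:
  fixes A V :: "real^'n^'n"
  assumes V: "V \<in> spd" and A: "invertible A"
  shows "sqnorm_wrt (A ** V ** transpose A) x = sqnorm_wrt V (matrix_inv A *v x)"
proof -
  have V': "invertible V" using V by (rule spd_invertible)
  have "matrix_inv (A ** V ** transpose A) = transpose (matrix_inv A) ** matrix_inv V ** matrix_inv A"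
  proof (rule matrix_inv_unique)
    have "A ** V ** transpose A ** (transpose (matrix_inv A) ** matrix_inv V ** matrix_inv A) =
      A ** V ** (transpose A ** transpose (matrix_inv A)) ** matrix_inv V ** matrix_inv A"
      by (simp add: matrix_mul_assoc)
    also have "\<dots> = A ** (V ** matrix_inv V) ** matrix_inv A"
      by (simp flip: matrix_transpose_mul add: matrix_inv_cancel[OF A]) (simp add: matrix_mul_assoc)
    also have "\<dots> = mat 1" by (simp add: matrix_inv_cancel[OF A] matrix_inv_cancel[OF V'])
    finally show "A ** V ** transpose A ** (transpose (matrix_inv A) ** matrix_inv V ** matrix_inv A) = mat 1" .
  qed
  then show ?thesis
    by (simp add: sqnorm_wrt_def dot_matrix_transpose flip: matrix_vector_mul_assoc)
qed

lemma sqnorm_nonneg: "V \<in> spd \<Longrightarrow> 0 \<le> sqnorm_wrt V x"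
  using spd_imp_psd[OF spd_matrix_inv] by (auto simp: sqnorm_wrt_def psd_def)

text \<open>Lets equality of two functions of \<open>sqnorm_wrt V x\<close> be read as equality of
  profiles at every nonnegative argument.\<close>

lemma sqnorm_surj:
  fixes V :: "real^'n^'n"
  assumes V: "V \<in> spd" and "0 \<le> r"
  obtains x where "sqnorm_wrt V x = r"
proof -
  define e :: "real^'n" where "e = axis undefined 1"
  have "e \<noteq> 0" by (simp add: e_def)
  then have p: "0 < sqnorm_wrt V e" using spd_matrix_inv[OF V] by (simp add: sqnorm_wrt_def spd_def)
  have "sqnorm_wrt V (sqrt (r / sqnorm_wrt V e) *\<^sub>R e) = (sqrt (r / sqnorm_wrt V e))\<^sup>2 * sqnorm_wrt V e"
    unfolding sqnorm_wrt_def by (simp add: matrix_vector_mult_scaleR power2_eq_square mult.assoc del: real_sqrt_mult_self)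
  also have "\<dots> = r" using p assms by (simp add: real_sqrt_pow2)
  finally show ?thesis using that by blast
qed

lemma continuous_on_sqnorm [continuous_intros]:
  "continuous_on S f \<Longrightarrow> continuous_on S (\<lambda>x. sqnorm_wrt V (f x))"
  unfolding sqnorm_wrt_def
  by (intro continuous_on_inner bounded_linear.continuous_on[OF matrix_vector_mul_bounded_linear])

text \<open>Gram--Schmidt with respect to the inner product given by \<open>V\<close>.\<close>

lemma spd_diagonalizing_family:
  assumes V: "V \<in> spd" and "finite I"
  shows "\<exists>a :: 'n \<Rightarrow> real^'n. \<forall>i\<in>I. \<forall>j\<in>I. a i \<bullet> (V *v a j) = (if i = j then 1 else 0)"
  using \<open>finite I\<close>
proof induction
  case (insert k I)
  then obtain a :: "'n \<Rightarrow> real^'n" where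
    a: "\<forall>i\<in>I. \<forall>j\<in>I. a i \<bullet> (V *v a j) = (if i = j then 1 else 0)" by blast
  have sym: "x \<bullet> (V *v y) = y \<bullet> (V *v x)" for x y
    using V dot_matrix_transpose[of x V y] by (simp add: spd_def inner_commute)
  let ?S = "(\<lambda>i. V *v a i) ` I"
  have "card I < CARD('n)"
    using insert by (intro psubset_card_mono) auto
  then have "dim ?S < DIM(real^'n)"
    using dim_le_card'[of ?S] card_image_le[OF insert(1), of "\<lambda>i. V *v a i"] insert(1)
    by simp
  then have "span ?S \<noteq> UNIV" by (metis dim_UNIV dim_span less_irrefl)
  then obtain b where b: "b \<noteq> 0" "\<And>i. i \<in> I \<Longrightarrow> b \<bullet> (V *v a i) = 0"
    using span_not_UNIV_orthogonal[of ?S] by (metis image_eqI span_base)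
  have p: "0 < b \<bullet> (V *v b)" using V b by (simp add: spd_def)
  define b' where "b' = (1 / sqrt (b \<bullet> (V *v b))) *\<^sub>R b"
  have "b' \<bullet> (V *v b') = 1"
    using p by (simp add: b'_def matrix_vector_mult_scaleR real_sqrt_mult_self field_simps flip: power2_eq_square)
  moreover have "b' \<bullet> (V *v a i) = 0" "a i \<bullet> (V *v b') = 0" if "i \<in> I" for i
    using b(2)[OF that] sym[of b "a i"] by (simp_all add: b'_def matrix_vector_mult_scaleR)
  ultimately show ?case
    using a insert(2) by (intro exI[of _ "a(k := b')"]) auto
qed auto

text \<open>A basis orthonormal for the form of \<open>V\<close>, taken as the columns of
  \<open>A\<close>, turns \<open>V\<close> into the identity by congruence. Undoing this congruence
  gives \<open>R\<close> as the transposed inverse of \<open>A\<close>.\<close>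

lemma spd_factorization:
  fixes V :: "real^'n^'n"
  assumes V: "V \<in> spd"
  obtains R :: "real^'n^'n" where "invertible R" "V = R ** transpose R"
proof -
  obtain a :: "'n \<Rightarrow> real^'n" where a: "\<And>i j. a i \<bullet> (V *v a j) = (if i = j then 1 else 0)"
    using spd_diagonalizing_family[OF V, of UNIV] by auto
  define A :: "real^'n^'n" where "A = (\<chi> i j. a j $ i)"
  have col: "A *v axis j 1 = a j" for j
    by (simp add: A_def vec_eq_iff matrix_vector_mult_basis column_def)
  have "(transpose A ** V ** A) $ i $ j = (mat 1 :: real^'n^'n) $ i $ j" for i j
  proof -
    have "(transpose A ** V ** A) $ i $ j = axis i 1 \<bullet> ((transpose A ** V ** A) *v axis j 1)"
      by (simp add: inner_axis' matrix_vector_mult_basis column_def)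
    also have "\<dots> = a i \<bullet> (V *v a j)"
      by (simp add: dot_matrix_transpose col flip: matrix_vector_mul_assoc)
    finally show ?thesis by (simp add: a mat_def)
  qed
  then have AVA: "transpose A ** V ** A = mat 1" by (simp add: vec_eq_iff)
  then have invA: "invertible A" using invertible_left_inverse by blast
  let ?R = "transpose (matrix_inv A)"
  have "?R ** transpose ?R = ?R ** (transpose A ** V ** A) ** matrix_inv A"
    by (simp add: AVA)
  also have "\<dots> = (?R ** transpose A) ** V ** (A ** matrix_inv A)"
    by (simp add: matrix_mul_assoc)
  also have "\<dots> = V"
    using invA by (simp flip: matrix_transpose_mul add: matrix_inv_cancel)
  finally have "V = ?R ** transpose ?R" ..
  moreover have "invertible ?R" using invA by (simp add: invertible_matrix_inv transpose_invertible)
  ultimately show ?thesis using that by blast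
qed

lemma matrix_diff_ldistrib: "(A::real^'n^'m) ** (B - C) = A ** B - A ** (C::real^'k^'n)"
  by (simp add: vec_eq_iff matrix_matrix_mult_def sum_subtractf algebra_simps)

lemma matrix_diff_rdistrib: "((A::real^'n^'m) - B) ** C = A ** C - B ** (C::real^'k^'n)"
  by (simp add: vec_eq_iff matrix_matrix_mult_def sum_subtractf algebra_simps)

lemma matrix_add_rdistrib: "((A::real^'n^'m) + B) ** C = A ** C + B ** (C::real^'k^'n)"
  by (simp add: vec_eq_iff matrix_matrix_mult_def sum.distrib algebra_simps)

lemma matrix_scaleR_left: "(c *\<^sub>R (A::real^'n^'m)) ** (B::real^'k^'n) = c *\<^sub>R (A ** B)"
  by (simp add: vec_eq_iff matrix_matrix_mult_def sum_distrib_left mult_ac)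

lemma matrix_scaleR_right: "(A::real^'n^'m) ** (c *\<^sub>R (B::real^'k^'n)) = c *\<^sub>R (A ** B)"
  by (simp add: vec_eq_iff matrix_matrix_mult_def sum_distrib_left mult_ac)

section \<open>Reflections and polar decomposition\<close>

definition outer :: "real^'n \<Rightarrow> real^'n \<Rightarrow> real^'n^'n" where
  "outer u v = (\<chi> i j. u $ i * v $ j)"

lemma outer_mul_outer: "outer u v ** outer w z = (v \<bullet> w) *\<^sub>R outer u z"
  by (simp add: outer_def vec_eq_iff matrix_matrix_mult_def inner_vec_def
      sum_distrib_left mult_ac)

lemma transpose_outer: "transpose (outer u v) = outer v u"
  by (simp add: outer_def transpose_def vec_eq_iff mult.commute)

lemma inner_outer: "outer u v \<bullet> N = u \<bullet> (N *v v)"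
  by (simp add: outer_def inner_matrix inner_vec_def matrix_vector_mult_def sum_distrib_left mult_ac)

text \<open>The Householder matrix, orthogonal for unit \<open>u\<close>. Testing a matrix against
  single ones sees its quadratic form, against products of two also its antisymmetric part.\<close>

definition reflection :: "real^'n \<Rightarrow> real^'n^'n" where
  "reflection u = mat 1 - 2 *\<^sub>R outer u u"

lemma reflection_mul_reflection:
  "reflection u ** reflection v =
     mat 1 - 2 *\<^sub>R outer u u - 2 *\<^sub>R outer v v + (4 * (u \<bullet> v)) *\<^sub>R outer u v"
  by (simp add: reflection_def matrix_diff_ldistrib matrix_diff_rdistrib matrix_scaleR_left
      matrix_scaleR_right outer_mul_outer algebra_simps)

lemma orthogonal_reflection:
  assumes "norm u = 1"
  shows "orthogonal_matrix (reflection u)"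
proof -
  have "2 *\<^sub>R outer u u + 2 *\<^sub>R outer u u = (4 :: real) *\<^sub>R outer u u"
    unfolding scaleR_left_distrib[symmetric] by simp
  moreover have "u \<bullet> u = 1" using assms by (simp add: norm_eq_1)
  ultimately have "reflection u ** reflection u = mat 1"
    unfolding reflection_mul_reflection by (simp add: diff_diff_eq)
  moreover have "transpose (reflection u) = reflection u"
    by (simp add: reflection_def transpose_diff transpose_scaleR transpose_outer)
  ultimately show ?thesis by (simp add: orthogonal_matrix)
qed

text \<open>Competing with a reflection gives nonnegativity of the form. Competing with a product of
  two reflections in nearly equal directions, a small rotation, gives symmetry as a first-order
  condition.\<close>

lemma psd_of_orthogonal_maximal:
  fixes N :: "real^'n^'n"
  assumes max: "\<And>R. orthogonal_matrix R \<Longrightarrow> R \<bullet> N \<le> mat 1 \<bullet> N"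
  shows "psd N"
proof -
  have nonneg: "0 \<le> x \<bullet> (N *v x)" for x
  proof (cases "x = 0")
    case False
    let ?u = "x /\<^sub>R norm x"
    have "norm ?u = 1" using False by simp
    from max[OF orthogonal_reflection[OF this]] have "0 \<le> ?u \<bullet> (N *v ?u)"
      by (simp add: reflection_def inner_diff_left inner_outer)
    then show ?thesis
      using False by (simp add: matrix_vector_mult_scaleR zero_le_mult_iff)
  qed simp
  \<comment> \<open>Maximality against the product of the reflections along \<open>u\<close> and
    \<open>v / norm v\<close>, multiplied by \<open>(norm v)\<^sup>2\<close> so that the result is
    polynomial in \<open>v\<close>.\<close>
  have pair: "2 * (u \<bullet> v) * (u \<bullet> (N *v v)) \<le> (u \<bullet> (N *v u)) * (norm v)\<^sup>2 + v \<bullet> (N *v v)"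
    if u: "norm u = 1" and v: "v \<noteq> 0" for u v
  proof -
    let ?w = "v /\<^sub>R norm v"
    have w: "norm ?w = 1" using v by simp
    from max[OF orthogonal_matrix_mul[OF orthogonal_reflection[OF u] orthogonal_reflection[OF w]]]
    have "2 * (u \<bullet> ?w) * (u \<bullet> (N *v ?w)) \<le> u \<bullet> (N *v u) + ?w \<bullet> (N *v ?w)"
      unfolding reflection_mul_reflection inner_diff_left inner_add_left inner_scaleR_left inner_outer
      by linarith
    moreover have "(norm v)\<^sup>2 * (2 * (u \<bullet> ?w) * (u \<bullet> (N *v ?w))) = 2 * (u \<bullet> v) * (u \<bullet> (N *v v))"
      "(norm v)\<^sup>2 * (?w \<bullet> (N *v ?w)) = v \<bullet> (N *v v)"
      using v by (simp_all add: matrix_vector_mult_scaleR power2_eq_square divide_inverse[symmetric] field_simps)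
    moreover have "(norm v)\<^sup>2 * (2 * (u \<bullet> ?w) * (u \<bullet> (N *v ?w))) \<le>
        (norm v)\<^sup>2 * (u \<bullet> (N *v u) + ?w \<bullet> (N *v ?w))"
      using \<open>2 * (u \<bullet> ?w) * (u \<bullet> (N *v ?w)) \<le> u \<bullet> (N *v u) + ?w \<bullet> (N *v ?w)\<close>
      by (intro mult_left_mono) auto
    ultimately show ?thesis unfolding distrib_left by (simp only: mult.commute)
  qed
  have "N $ j $ i = N $ i $ j" for i j
  proof (cases "i = j")
    case False
    \<comment> \<open>For \<open>v\<close> the sum of the \<open>i\<close>-th unit vector and
      \<epsilon> times the \<open>j\<close>-th one, the terms of order zero in \<open>pair\<close>
      cancel and the linear coefficient is the asymmetry of \<open>N\<close>.\<close>
    have "N $ j $ i - N $ i $ j = 0"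
    proof (rule linear_part_zero)
      fix \<epsilon> :: real
      let ?u = "axis i 1 :: real^'n" and ?w = "axis j 1 :: real^'n"
      let ?v = "?u + \<epsilon> *\<^sub>R ?w"
      have comp: "axis k 1 \<bullet> (N *v axis l 1) = N $ k $ l" for k l
        by (simp add: inner_axis' matrix_vector_mult_basis column_def)
      have uw: "?u \<bullet> ?w = 0" "?w \<bullet> ?u = 0" "?u \<bullet> ?u = 1" "?w \<bullet> ?w = 1"
        using False by (auto simp: inner_axis_axis)
      have uv: "?u \<bullet> ?v = 1" by (simp add: inner_add_right uw)
      have nv: "(norm ?v)\<^sup>2 = 1 + \<epsilon>\<^sup>2"
        unfolding power2_norm_eq_inner by (simp add: inner_add_left inner_add_right uw power2_eq_square)
      have "?v \<noteq> 0"
      proof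
        assume "?v = 0"
        with nv have "0 = 1 + \<epsilon>\<^sup>2" by (simp only: norm_zero power_zero_numeral)
        then show False using zero_le_power2[of \<epsilon>] by linarith
      qed
      from pair[of ?u ?v, OF _ this]
      show "0 \<le> \<epsilon> * (N $ j $ i - N $ i $ j) + \<epsilon>\<^sup>2 * (N $ i $ i + N $ j $ j)"
        unfolding uv nv
        by (simp add: matrix_vector_right_distrib matrix_vector_mult_scaleR inner_add_left
            inner_add_right comp algebra_simps power2_eq_square)
    qed
    then show ?thesis by simp
  qed simp
  then have "transpose N = N" by (simp add: transpose_def vec_eq_iff)
  with nonneg show ?thesis by (simp add: psd_def)
qed

lemma compact_orthogonal_matrices: "compact {R :: real^'n^'n. orthogonal_matrix R}"
proof -
  have "norm R = norm (mat 1 :: real^'n^'n)" if "orthogonal_matrix R" for R :: "real^'n^'n"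
    using norm_orthogonal_mul_left[OF that, of "mat 1 :: real^'n^'n"] by simp
  then have "bounded {R :: real^'n^'n. orthogonal_matrix R}"
    by (intro boundedI[of _ "norm (mat 1 :: real^'n^'n)"]) simp
  moreover have "closed {R :: real^'n^'n. orthogonal_matrix R}"
    unfolding orthogonal_matrix matrix_matrix_mult_def transpose_def
    by (intro closed_Collect_eq continuous_intros)
  ultimately show ?thesis by (simp add: compact_eq_bounded_closed)
qed

text \<open>By compactness some orthogonal \<open>R\<close> maximizes the trace of
  \<open>A ** R\<close>. As \<open>R ** Q\<close> competes with \<open>R\<close> for every
  orthogonal \<open>Q\<close>, the product satisfies the maximality criterion. Singular
  \<open>A\<close> is covered.\<close>

lemma polar_decomposition:
  fixes A :: "real^'n^'n"
  obtains R where "orthogonal_matrix R" "psd (A ** R)"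
proof -
  obtain R :: "real^'n^'n" where R: "orthogonal_matrix R"
    and max: "\<And>R'. orthogonal_matrix R' \<Longrightarrow> R' \<bullet> transpose A \<le> R \<bullet> transpose A"
  proof -
    have "\<exists>R\<in>{R. orthogonal_matrix R}. \<forall>R'\<in>{R. orthogonal_matrix R}. R' \<bullet> transpose A \<le> R \<bullet> transpose A"
      by (intro continuous_attains_sup compact_orthogonal_matrices continuous_intros)
        (use orthogonal_matrix_id in auto)
    then show ?thesis using that by auto
  qed
  have "psd (transpose (A ** R))"
  proof (rule psd_of_orthogonal_maximal)
    fix Q :: "real^'n^'n" assume Q: "orthogonal_matrix Q"
    have "Q \<bullet> transpose (A ** R) = (R ** Q) \<bullet> transpose A"
      by (simp add: inner_matrix_mul_left matrix_transpose_mul)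
    also have "\<dots> \<le> R \<bullet> transpose A" using R Q by (intro max orthogonal_matrix_mul)
    also have "\<dots> = mat 1 \<bullet> transpose (A ** R)"
      using inner_matrix_mul_left[of R "mat 1" "transpose A"] by (simp add: matrix_transpose_mul)
    finally show "Q \<bullet> transpose (A ** R) \<le> mat 1 \<bullet> transpose (A ** R)" .
  qed
  then have "psd (A ** R)" by (metis psd_def transpose_transpose)
  with R that show ?thesis by blast
qed

section \<open>Matrix estimates and the potentials for a pair of linear maps\<close>

lemma column_mul: "column j ((A::real^'n^'m) ** (B::real^'k^'n)) = A *v column j B"
  by (simp add: column_def matrix_matrix_mult_def matrix_vector_mult_def vec_eq_iff)

lemma inner_columns: "(A::real^'n^'m) \<bullet> B = (\<Sum>j\<in>UNIV. column j A \<bullet> column j B)"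
  unfolding inner_matrix by (subst sum.swap) (simp add: column_def inner_vec_def)

lemma norm_mul_contraction:
  fixes A :: "real^'n^'m" and X :: "real^'k^'n"
  assumes "\<And>x. norm (A *v x) \<le> norm x"
  shows "norm (A ** X) \<le> norm X"
proof -
  have "(A ** X) \<bullet> (A ** X) \<le> X \<bullet> X"
    unfolding inner_columns column_mul
    by (intro sum_mono) (rule norm_le[THEN iffD1, OF assms])
  then show ?thesis by (simp add: norm_le)
qed

text \<open>The trace of \<open>transpose (mat 1 - R) ** M ** (mat 1 - R)\<close> is nonnegative and
  equals twice the difference of the two sides.\<close>

lemma inner_orthogonal_psd_le:
  assumes M: "psd M" and R: "orthogonal_matrix R"
  shows "R \<bullet> M \<le> mat 1 \<bullet> M"
proof -
  let ?D = "mat 1 - R"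
  have "0 \<le> ?D \<bullet> (M ** ?D)"
    unfolding inner_columns column_mul using M by (auto simp: psd_def intro!: sum_nonneg)
  also have "\<dots> = mat 1 \<bullet> M - mat 1 \<bullet> (M ** R) - R \<bullet> M + R \<bullet> (M ** R)"
    by (simp add: matrix_diff_ldistrib inner_diff_left inner_diff_right)
  also have "R \<bullet> (M ** R) = mat 1 \<bullet> M"
    using inner_matrix_mul_right[of M R R] R by (simp add: orthogonal_matrix_def inner_commute)
  also have "mat 1 \<bullet> (M ** R) = R \<bullet> M"
    using inner_matrix_mul_left[of M R "mat 1"] M by (simp add: psd_def inner_commute)
  finally show ?thesis by simp
qed

lemma psd_add: "psd A \<Longrightarrow> psd B \<Longrightarrow> psd (A + B)"
  by (simp add: psd_def transpose_add matrix_vector_mult_add_rdistrib inner_add_right)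

lemma scaleR_mat_vector: "(c *\<^sub>R mat 1) *v (x::real^'n) = c *\<^sub>R x"
  by (simp add: scaleR_matrix_vector_assoc[symmetric])

lemma psd_perturb_spd:
  assumes "psd P" "0 < \<epsilon>"
  shows "P + \<epsilon> *\<^sub>R mat 1 \<in> spd"
  using assms
  by (simp add: psd_def spd_def transpose_add transpose_scaleR matrix_vector_mult_add_rdistrib
      inner_add_right scaleR_mat_vector add_nonneg_pos)

text \<open>The product of \<open>P\<close> with the inverse of
  \<open>P + \<epsilon> *\<^sub>R mat 1\<close> is a contraction, because adding \<epsilon> times
  the identity to a semidefinite matrix only lengthens image vectors. The bound is uniform in
  \<epsilon>, so it survives for nearly singular perturbations.\<close>

lemma norm_psd_mul_inv_perturb:
  fixes P :: "real^'n^'n"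
  assumes P: "psd P" and \<epsilon>: "0 < \<epsilon>"
  shows "norm (P ** (matrix_inv (P + \<epsilon> *\<^sub>R mat 1) ** (X::real^'k^'n))) \<le> norm X"
proof -
  let ?Q = "P + \<epsilon> *\<^sub>R mat 1"
  have inv: "invertible ?Q" using psd_perturb_spd[OF assms] by (rule spd_invertible)
  have "norm ((P ** matrix_inv ?Q) *v x) \<le> norm x" for x
  proof -
    define y where "y = matrix_inv ?Q *v x"
    have "(norm (?Q *v y))\<^sup>2 = (norm (P *v y))\<^sup>2 + 2 * \<epsilon> * (y \<bullet> (P *v y)) + \<epsilon>\<^sup>2 * (norm y)\<^sup>2"
      unfolding power2_norm_eq_inner matrix_vector_mult_add_rdistrib scaleR_mat_vector
      by (simp add: inner_add_left inner_add_right inner_commute power2_eq_square algebra_simps)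
    moreover have "0 \<le> 2 * \<epsilon> * (y \<bullet> (P *v y)) + \<epsilon>\<^sup>2 * (norm y)\<^sup>2"
      using P \<epsilon> by (simp add: psd_def)
    ultimately have "(norm (P *v y))\<^sup>2 \<le> (norm (?Q *v y))\<^sup>2" by linarith
    then have "norm (P *v y) \<le> norm (?Q *v y)" by (rule power2_le_imp_le) simp
    then show ?thesis
      by (simp add: y_def matrix_inv_vector_cancel[OF inv] matrix_vector_mul_assoc[symmetric])
  qed
  then show ?thesis by (simp add: matrix_mul_assoc norm_mul_contraction)
qed

text \<open>The pair \<open>U\<close>, \<open>W\<close> encodes a near-optimal quadratic Kantorovich potential:
  \<open>x \<bullet> y = (U *v x) \<bullet> (W *v y)\<close> is at most half of \<open>(norm (U *v x))\<^sup>2 + (norm (W *v y))\<^sup>2\<close>.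
  The perturbation by \<open>\<epsilon>\<close> is needed because \<open>A\<close> and \<open>B\<close> may be singular.\<close>

lemma quadratic_potentials:
  fixes A B :: "real^'n^'n"
  assumes BA: "psd (transpose B ** A)" and \<eta>: "0 < \<eta>"
  obtains U W :: "real^'n^'n" where "transpose U ** W = mat 1"
    "(norm (U ** A))\<^sup>2 + (norm (W ** B))\<^sup>2 \<le> 2 * (A \<bullet> B + \<eta>)"
proof -
  obtain O1 where O1: "orthogonal_matrix O1" and P: "psd (A ** O1)"
    by (rule polar_decomposition)
  obtain O2 where O2: "orthogonal_matrix O2" and Q: "psd (B ** O2)"
    by (rule polar_decomposition)
  define P Q where "P = A ** O1" and "Q = B ** O2"
  have P: "psd P" and Q: "psd Q" using P Q by (simp_all add: P_def Q_def)
  \<comment> \<open>Bounds the error of the perturbation: \<open>P' ** Q'\<close> exceeds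
    \<open>P ** Q\<close> by \<epsilon> times a matrix whose product with any orthogonal matrix is
    at most \<open>C\<close>, provided \<open>\<epsilon> \<le> 1\<close>.\<close>
  define C where "C = mat 1 \<bullet> (P + Q + mat 1)"
  have PQ: "psd (P + Q)" using P Q by (rule psd_add)
  have I: "psd (mat 1 :: real^'n^'n)" using spd_mat_1 by (rule spd_imp_psd)
  have C0: "0 \<le> C"
    using psd_add[OF PQ I] inner_columns[of "mat 1" "P + Q + mat 1"]
    by (auto simp: C_def psd_def intro!: sum_nonneg)
       (metis (no_types, lifting) column_mul matrix_mul_rid)
  define \<epsilon> where "\<epsilon> = min 1 (\<eta> / (C + 1))"
  have \<epsilon>: "0 < \<epsilon>" "\<epsilon> \<le> 1" using C0 \<eta> by (auto simp: \<epsilon>_def)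
  have "\<epsilon> * C \<le> \<eta> / (C + 1) * C" using C0 by (intro mult_right_mono) (auto simp: \<epsilon>_def)
  also have "\<dots> \<le> \<eta>" using C0 \<eta> by (simp add: field_simps)
  finally have \<epsilon>C: "\<epsilon> * C \<le> \<eta>" .
  define P' Q' where "P' = P + \<epsilon> *\<^sub>R mat 1" and "Q' = Q + \<epsilon> *\<^sub>R mat 1"
  have P': "P' \<in> spd" and Q': "Q' \<in> spd"
    using psd_perturb_spd P Q \<epsilon> by (auto simp: P'_def Q'_def)
  note inv = spd_invertible[OF P'] spd_invertible[OF Q']
  \<comment> \<open>A product of two symmetric matrices need not be symmetric; a third rotation
    repairs this. Sharing the resulting factor \<open>R\<close> between \<open>U\<close> and
    \<open>W\<close> yields \<open>transpose U ** W = mat 1\<close> and bounds both norms by that of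
    \<open>R\<close>.\<close>
  obtain O3 where O3: "orthogonal_matrix O3" and M: "psd (P' ** Q' ** O3)"
    by (rule polar_decomposition)
  have "invertible O3" using O3 unfolding orthogonal_matrix_def invertible_def by blast
  then have "invertible (P' ** Q' ** O3)" using inv by (intro invertible_mult)
  with M have "P' ** Q' ** O3 \<in> spd" by (rule psd_invertible_imp_spd)
  then obtain R :: "real^'n^'n" where R: "P' ** Q' ** O3 = R ** transpose R"
    by (rule spd_factorization)
  define U W where "U = transpose R ** matrix_inv P'"
    and "W = transpose R ** (transpose O3 ** matrix_inv Q')"
  have symP: "transpose (matrix_inv P') = matrix_inv P'" and symQ: "transpose (matrix_inv Q') = matrix_inv Q'"
    by (intro spd_symmetric spd_matrix_inv P' Q')+
  have "transpose U ** W = matrix_inv P' ** (R ** transpose R) ** transpose O3 ** matrix_inv Q'"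
    by (simp add: U_def W_def matrix_transpose_mul symP matrix_mul_assoc)
  also have "\<dots> = (matrix_inv P' ** P') ** Q' ** (O3 ** transpose O3) ** matrix_inv Q'"
    by (simp add: R[symmetric] matrix_mul_assoc)
  also have "\<dots> = mat 1"
    using O3 by (simp add: matrix_inv_cancel inv orthogonal_matrix_def)
  finally have UW: "transpose U ** W = mat 1" .
  have "norm (U ** A) = norm (U ** A ** O1)" by (rule norm_orthogonal_mul_right[OF O1, symmetric])
  also have "U ** A ** O1 = transpose (P ** (matrix_inv P' ** R))"
    using P by (simp add: U_def P_def matrix_transpose_mul symP matrix_mul_assoc psd_def)
  also have "norm \<dots> \<le> norm R"
    using norm_psd_mul_inv_perturb[OF P \<epsilon>(1), of R] by (simp add: P'_def norm_eq_sqrt_inner)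
  finally have UA: "norm (U ** A) \<le> norm R" .
  have "norm (W ** B) = norm (W ** B ** O2)" by (rule norm_orthogonal_mul_right[OF O2, symmetric])
  also have "W ** B ** O2 = transpose (Q ** (matrix_inv Q' ** (O3 ** R)))"
    using Q by (simp add: W_def Q_def matrix_transpose_mul symQ matrix_mul_assoc psd_def)
  also have "norm \<dots> \<le> norm (O3 ** R)"
    using norm_psd_mul_inv_perturb[OF Q \<epsilon>(1), of "O3 ** R"] by (simp add: Q'_def norm_eq_sqrt_inner)
  finally have WB: "norm (W ** B) \<le> norm R" by (simp add: norm_orthogonal_mul_left[OF O3])
  have "(norm R)\<^sup>2 = mat 1 \<bullet> (P' ** Q' ** O3)"
    using inner_matrix_mul_right[of "mat 1" R R] by (simp add: power2_norm_eq_inner R)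
  also have "\<dots> = transpose O3 \<bullet> (P' ** Q')"
    using inner_matrix_mul_right[of "P' ** Q'" O3 "mat 1"] by (simp add: inner_commute)
  also have "P' ** Q' = P ** Q + \<epsilon> *\<^sub>R (P + Q + \<epsilon> *\<^sub>R mat 1)"
    by (simp add: P'_def Q'_def matrix_add_ldistrib matrix_add_rdistrib matrix_scaleR_left
        matrix_scaleR_right algebra_simps)
  also have "transpose O3 \<bullet> \<dots> = transpose O3 \<bullet> (P ** Q) + \<epsilon> * (transpose O3 \<bullet> (P + Q + \<epsilon> *\<^sub>R mat 1))"
    by (simp add: inner_add_right)
  \<comment> \<open>The three rotations combine into one orthogonal matrix tested against
    \<open>transpose A ** B\<close>. Semidefiniteness of the latter, the hypothesis on
    \<open>A\<close> and \<open>B\<close>, then bounds the product by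
    \<open>A \<bullet> B\<close>.\<close>
  also have "transpose O3 \<bullet> (P ** Q) = (O1 ** transpose O3 ** transpose O2) \<bullet> (transpose A ** B)"
  proof -
    have PP: "P = transpose O1 ** transpose A"
      using P by (simp add: P_def psd_def matrix_transpose_mul)
    have "transpose O3 \<bullet> (P ** Q) = transpose O3 \<bullet> (transpose O1 ** (transpose A ** B ** O2))"
      by (subst PP) (simp add: Q_def matrix_mul_assoc)
    also have "\<dots> = (O1 ** transpose O3) \<bullet> (transpose A ** B ** O2)"
      by (simp add: inner_matrix_mul_left)
    also have "\<dots> = (O1 ** transpose O3 ** transpose O2) \<bullet> (transpose A ** B)"
      by (simp add: inner_matrix_mul_right)
    finally show ?thesis .
  qed
  also have "\<dots> \<le> mat 1 \<bullet> (transpose A ** B)"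
  proof (rule inner_orthogonal_psd_le)
    have "transpose A ** B = transpose (transpose B ** A)" by (simp add: matrix_transpose_mul)
    then show "psd (transpose A ** B)" using BA by (simp add: psd_def)
  qed (use O1 O2 O3 in \<open>auto intro!: orthogonal_matrix_mul\<close>)
  also have "mat 1 \<bullet> (transpose A ** B) = A \<bullet> B"
    using inner_matrix_mul_left[of A "mat 1" B] by simp
  also have "transpose O3 \<bullet> (P + Q + \<epsilon> *\<^sub>R mat 1) \<le> C"
  proof -
    have "transpose O3 \<bullet> (P + Q) \<le> mat 1 \<bullet> (P + Q)"
      using PQ O3 by (intro inner_orthogonal_psd_le) auto
    moreover have "\<epsilon> * (transpose O3 \<bullet> mat 1) \<le> 1 * (mat 1 \<bullet> (mat 1 :: real^'n^'n))"
    proof -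
      have "transpose O3 \<bullet> mat 1 \<le> mat 1 \<bullet> (mat 1 :: real^'n^'n)"
        using I O3 by (intro inner_orthogonal_psd_le) auto
      then have "\<epsilon> * (transpose O3 \<bullet> mat 1) \<le> \<epsilon> * (mat 1 \<bullet> (mat 1 :: real^'n^'n))"
        using \<epsilon> by (intro mult_left_mono) auto
      also have "\<dots> \<le> 1 * (mat 1 \<bullet> (mat 1 :: real^'n^'n))"
        using \<epsilon> by (intro mult_right_mono) auto
      finally show ?thesis .
    qed
    ultimately show ?thesis by (simp add: C_def inner_add_right)
  qed
  finally have "(norm R)\<^sup>2 \<le> A \<bullet> B + \<epsilon> * C" using \<epsilon> by simp
  then have *: "(norm R)\<^sup>2 \<le> A \<bullet> B + \<eta>" using \<epsilon>C by simp
  have "(norm (U ** A))\<^sup>2 + (norm (W ** B))\<^sup>2 \<le> (norm R)\<^sup>2 + (norm R)\<^sup>2"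
    using UA WB by (intro add_mono power_mono) auto
  also have "\<dots> \<le> 2 * (A \<bullet> B + \<eta>)" using * by simp
  finally show ?thesis by (rule that[OF UW])
qed

section \<open>Couplings and the Wasserstein distance\<close>

lemma couplingsD:
  assumes "\<pi> \<in> couplings \<mu> \<nu>"
  shows "sets \<pi> = sets borel" "prob_space \<pi>" "distr \<pi> borel fst = \<mu>" "distr \<pi> borel snd = \<nu>"
  using assms by (auto simp: couplings_def)

lemma measurable_coupling:
  assumes "\<pi> \<in> couplings \<mu> \<nu>" "f \<in> borel_measurable borel"
  shows "f \<in> borel_measurable \<pi>"
  using assms measurable_cong_sets[OF couplingsD(1)[OF assms(1)] refl] by blast

lemma coupling_integrals:
  fixes \<mu> \<nu> :: "'a::euclidean_space measure" and f :: "'a \<Rightarrow> real"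
  assumes \<pi>: "\<pi> \<in> couplings \<mu> \<nu>" and f: "f \<in> borel_measurable borel"
  shows "integrable \<pi> (\<lambda>z. f (fst z)) \<longleftrightarrow> integrable \<mu> f"
    "integrable \<pi> (\<lambda>z. f (snd z)) \<longleftrightarrow> integrable \<nu> f"
    "(\<integral>z. f (fst z) \<partial>\<pi>) = (\<integral>x. f x \<partial>\<mu>)"
    "(\<integral>z. f (snd z) \<partial>\<pi>) = (\<integral>x. f x \<partial>\<nu>)"
proof -
  have m: "fst \<in> borel_measurable \<pi>" "snd \<in> borel_measurable \<pi>"
    by (intro measurable_coupling[OF \<pi>] borel_measurable_continuous_onI continuous_intros)+
  note D = couplingsD(3,4)[OF \<pi>]
  show "integrable \<pi> (\<lambda>z. f (fst z)) \<longleftrightarrow> integrable \<mu> f"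
    using integrable_distr_eq[OF m(1) f] D by simp
  show "integrable \<pi> (\<lambda>z. f (snd z)) \<longleftrightarrow> integrable \<nu> f"
    using integrable_distr_eq[OF m(2) f] D by simp
  show "(\<integral>z. f (fst z) \<partial>\<pi>) = (\<integral>x. f x \<partial>\<mu>)"
    using integral_distr[OF m(1) f] D by simp
  show "(\<integral>z. f (snd z) \<partial>\<pi>) = (\<integral>x. f x \<partial>\<nu>)"
    using integral_distr[OF m(2) f] D by simp
qed

lemma P2D:
  assumes "\<mu> \<in> P2"
  shows "sets \<mu> = sets borel" "prob_space \<mu>" "integrable \<mu> (\<lambda>x. (norm x)\<^sup>2)"
  using assms by (auto simp: P2_def)

lemma measurable_P2: "\<mu> \<in> P2 \<Longrightarrow> f \<in> borel_measurable borel \<Longrightarrow> f \<in> borel_measurable \<mu>"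
  using measurable_cong_sets[OF P2D(1) refl] by blast

lemma integrable_quadratic_bound:
  fixes f :: "'a::euclidean_space \<Rightarrow> real"
  assumes \<mu>: "\<mu> \<in> P2" and f: "f \<in> borel_measurable borel"
    and bound: "\<And>x. \<bar>f x\<bar> \<le> a + b * (norm x)\<^sup>2"
  shows "integrable \<mu> f"
proof (rule Bochner_Integration.integrable_bound)
  interpret prob_space \<mu> using \<mu> by (rule P2D)
  show "integrable \<mu> (\<lambda>x. a + b * (norm x)\<^sup>2)" using P2D(3)[OF \<mu>] by simp
  show "AE x in \<mu>. norm (f x) \<le> norm (a + b * (norm x)\<^sup>2)"
    using bound by (auto intro!: AE_I2 order_trans[OF bound])
qed (rule measurable_P2[OF \<mu> f])

lemma norm_diff_sq_le: "(norm (x - y))\<^sup>2 \<le> 2 * (norm x)\<^sup>2 + 2 * (norm (y::'a::euclidean_space))\<^sup>2"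
proof -
  have "(norm (x - y))\<^sup>2 \<le> (norm x + norm y)\<^sup>2"
    by (intro power_mono norm_triangle_ineq4) simp
  also have "\<dots> \<le> 2 * (norm x)\<^sup>2 + 2 * (norm y)\<^sup>2"
    using sum_squares_bound[of "norm x" "norm y"] by (simp add: power2_sum)
  finally show ?thesis .
qed

lemma integrable_coupling_bound:
  fixes f :: "'a::euclidean_space \<times> 'a \<Rightarrow> real"
  assumes \<pi>: "\<pi> \<in> couplings \<mu> \<nu>" and \<mu>: "\<mu> \<in> P2" and \<nu>: "\<nu> \<in> P2"
    and f: "f \<in> borel_measurable borel"
    and bound: "\<And>z. \<bar>f z\<bar> \<le> a + b * (norm (fst z))\<^sup>2 + c * (norm (snd z))\<^sup>2"
  shows "integrable \<pi> f"
proof (rule Bochner_Integration.integrable_bound)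
  interpret prob_space \<pi> using \<pi> by (rule couplingsD)
  have "integrable \<pi> (\<lambda>z. (norm (fst z))\<^sup>2)" "integrable \<pi> (\<lambda>z. (norm (snd z))\<^sup>2)"
    using coupling_integrals(1,2)[OF \<pi>, of "\<lambda>x. (norm x)\<^sup>2"] P2D(3)[OF \<mu>] P2D(3)[OF \<nu>] by simp_all
  then show "integrable \<pi> (\<lambda>z. a + b * (norm (fst z))\<^sup>2 + c * (norm (snd z))\<^sup>2)" by simp
  show "AE z in \<pi>. norm (f z) \<le> norm (a + b * (norm (fst z))\<^sup>2 + c * (norm (snd z))\<^sup>2)"
    using bound by (auto intro!: AE_I2 order_trans[OF bound])
qed (rule measurable_coupling[OF \<pi> f])

lemma integrable_cost:
  assumes "\<pi> \<in> couplings \<mu> \<nu>" "\<mu> \<in> P2" "\<nu> \<in> P2"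
  shows "integrable \<pi> (\<lambda>z. (norm (fst z - snd z))\<^sup>2)"
  by (rule integrable_coupling_bound[OF assms, of _ 0 2 2])
    (auto intro!: borel_measurable_continuous_onI continuous_intros norm_diff_sq_le)

text \<open>The product measure is a coupling. Without one, lower bounds for all couplings would say
  nothing about the infimum in \<open>W2\<close>.\<close>

lemma couplings_nonempty:
  fixes \<mu> \<nu> :: "'a::euclidean_space measure"
  assumes \<mu>: "\<mu> \<in> P2" and \<nu>: "\<nu> \<in> P2"
  shows "couplings \<mu> \<nu> \<noteq> {}"
proof -
  interpret \<mu>: prob_space \<mu> using \<mu> by (rule P2D)
  interpret \<nu>: prob_space \<nu> using \<nu> by (rule P2D)
  interpret pair_prob_space \<mu> \<nu> ..
  have s: "sets (\<mu> \<Otimes>\<^sub>M \<nu>) = sets borel"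
    using sets_pair_measure_cong[OF P2D(1)[OF \<mu>] P2D(1)[OF \<nu>]] by (simp only: borel_prod)
  have sp: "space \<mu> = UNIV" "space \<nu> = UNIV"
    using sets_eq_imp_space_eq[OF P2D(1)[OF \<mu>]] sets_eq_imp_space_eq[OF P2D(1)[OF \<nu>]] by auto
  have m: "fst \<in> measurable (\<mu> \<Otimes>\<^sub>M \<nu>) borel" "snd \<in> measurable (\<mu> \<Otimes>\<^sub>M \<nu>) borel"
    unfolding measurable_cong_sets[OF s refl]
    by (intro borel_measurable_continuous_onI continuous_intros)+
  have "distr (\<mu> \<Otimes>\<^sub>M \<nu>) borel fst = \<mu>"
  proof (rule measure_eqI)
    fix A assume A: "A \<in> sets (distr (\<mu> \<Otimes>\<^sub>M \<nu>) borel fst)"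
    have "fst -` A \<inter> space (\<mu> \<Otimes>\<^sub>M \<nu>) = A \<times> space \<nu>"
      unfolding space_pair_measure sp by auto
    then show "emeasure (distr (\<mu> \<Otimes>\<^sub>M \<nu>) borel fst) A = emeasure \<mu> A"
      using A P2D(1)[OF \<mu>] emeasure_distr[OF m(1), of A]
        \<nu>.emeasure_pair_measure_Times[of A \<mu> "space \<nu>"] by (simp add: \<nu>.emeasure_space_1)
  qed (use P2D(1)[OF \<mu>] in simp)
  moreover have "distr (\<mu> \<Otimes>\<^sub>M \<nu>) borel snd = \<nu>"
  proof (rule measure_eqI)
    fix A assume A: "A \<in> sets (distr (\<mu> \<Otimes>\<^sub>M \<nu>) borel snd)"
    have "snd -` A \<inter> space (\<mu> \<Otimes>\<^sub>M \<nu>) = space \<mu> \<times> A"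
      unfolding space_pair_measure sp by auto
    then show "emeasure (distr (\<mu> \<Otimes>\<^sub>M \<nu>) borel snd) A = emeasure \<nu> A"
      using A P2D(1)[OF \<nu>] emeasure_distr[OF m(2), of A]
        \<nu>.emeasure_pair_measure_Times[of "space \<mu>" \<mu> A] by (simp add: \<mu>.emeasure_space_1)
  qed (use P2D(1)[OF \<nu>] in simp)
  ultimately have "\<mu> \<Otimes>\<^sub>M \<nu> \<in> couplings \<mu> \<nu>"
    using s by (simp add: couplings_def prob_space_axioms)
  then show ?thesis by blast
qed

section \<open>The Wasserstein distance and what it controls\<close>

lemma W2_le:
  assumes "\<pi> \<in> couplings \<mu> \<nu>" "(\<integral>z. (norm (fst z - snd z))\<^sup>2 \<partial>\<pi>) \<le> r\<^sup>2" "0 \<le> r"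
  shows "W2 \<mu> \<nu> \<le> r"
proof -
  have "W2 \<mu> \<nu> \<le> sqrt (\<integral>z. (norm (fst z - snd z))\<^sup>2 \<partial>\<pi>)"
    unfolding W2_def using assms(1) by (intro cINF_lower bdd_belowI2[of _ 0]) auto
  also have "\<dots> \<le> sqrt (r\<^sup>2)" using assms(2) by (rule real_sqrt_le_mono)
  finally show ?thesis using assms(3) by simp
qed

lemma W2_ge:
  assumes "\<mu> \<in> P2" "\<nu> \<in> P2"
    and "\<And>\<pi>. \<pi> \<in> couplings \<mu> \<nu> \<Longrightarrow> r \<le> sqrt (\<integral>z. (norm (fst z - snd z))\<^sup>2 \<partial>\<pi>)"
  shows "r \<le> W2 \<mu> \<nu>"
  unfolding W2_def using assms(3) couplings_nonempty[OF assms(1,2)] by (intro cINF_greatest) auto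

lemma W2_nonneg: "\<mu> \<in> P2 \<Longrightarrow> \<nu> \<in> P2 \<Longrightarrow> 0 \<le> W2 \<mu> \<nu>"
  by (rule W2_ge) auto

lemma W2_less_coupling:
  assumes \<mu>: "\<mu> \<in> P2" and \<nu>: "\<nu> \<in> P2" and "W2 \<mu> \<nu> < r"
  obtains \<pi> where "\<pi> \<in> couplings \<mu> \<nu>" "(\<integral>z. (norm (fst z - snd z))\<^sup>2 \<partial>\<pi>) < r\<^sup>2"
proof -
  have r: "0 < r" using W2_nonneg[OF \<mu> \<nu>] assms(3) by simp
  obtain \<pi> where \<pi>: "\<pi> \<in> couplings \<mu> \<nu>" "sqrt (\<integral>z. (norm (fst z - snd z))\<^sup>2 \<partial>\<pi>) < r"
    using assms(3) couplings_nonempty[OF \<mu> \<nu>] unfolding W2_def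
    by (subst (asm) cINF_less_iff) (auto intro: bdd_belowI2[of _ 0])
  have "(\<integral>z. (norm (fst z - snd z))\<^sup>2 \<partial>\<pi>) < r\<^sup>2"
    using \<pi>(2) r by (metis real_sqrt_less_iff real_sqrt_unique less_imp_le)
  with \<pi>(1) that show ?thesis by blast
qed

text \<open>The distance enters squared, the increments of \<open>f\<close> to the first power. The
  inequality \<open>2 * d \<le> d\<^sup>2 / r + r\<close> mediates, with weights such that a
  coupling of cost below \<open>r\<^sup>2\<close> gives exactly \<open>L * r\<close>.\<close>

lemma W2_lipschitz:
  fixes f :: "'a::euclidean_space \<Rightarrow> real"
  assumes \<mu>: "\<mu> \<in> P2" and \<nu>: "\<nu> \<in> P2" and r: "W2 \<mu> \<nu> < r"
    and f: "f \<in> borel_measurable borel" "integrable \<mu> f" "integrable \<nu> f"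
    and L: "0 \<le> L" "\<And>x y. \<bar>f x - f y\<bar> \<le> L * norm (x - y)"
  shows "\<bar>(\<integral>x. f x \<partial>\<mu>) - (\<integral>x. f x \<partial>\<nu>)\<bar> \<le> L * r"
proof -
  have r0: "0 < r" using W2_nonneg[OF \<mu> \<nu>] r by simp
  obtain \<pi> where \<pi>: "\<pi> \<in> couplings \<mu> \<nu>" "(\<integral>z. (norm (fst z - snd z))\<^sup>2 \<partial>\<pi>) < r\<^sup>2"
    using W2_less_coupling[OF \<mu> \<nu> r] by blast
  interpret prob_space \<pi> using \<pi>(1) by (rule couplingsD)
  note ci = coupling_integrals[OF \<pi>(1) f(1)]
  note int = integrable_cost[OF \<pi>(1) \<mu> \<nu>]
  have fi: "integrable \<pi> (\<lambda>z. f (fst z))" "integrable \<pi> (\<lambda>z. f (snd z))"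
    using ci f by auto
  have pt: "\<bar>f (fst z) - f (snd z)\<bar> \<le> L * (((norm (fst z - snd z))\<^sup>2 / r + r) / 2)" for z
  proof -
    have "2 * norm (fst z - snd z) * r \<le> (norm (fst z - snd z))\<^sup>2 + r\<^sup>2"
      by (rule sum_squares_bound)
    then have "norm (fst z - snd z) \<le> ((norm (fst z - snd z))\<^sup>2 / r + r) / 2"
      using r0 by (simp add: field_simps power2_eq_square)
    with L show ?thesis by (meson mult_left_mono order_trans)
  qed
  have "\<bar>(\<integral>x. f x \<partial>\<mu>) - (\<integral>x. f x \<partial>\<nu>)\<bar> = \<bar>\<integral>z. f (fst z) - f (snd z) \<partial>\<pi>\<bar>"
    using fi by (simp add: ci(3,4))
  also have "\<dots> \<le> (\<integral>z. \<bar>f (fst z) - f (snd z)\<bar> \<partial>\<pi>)" by (rule integral_abs_bound)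
  also have "\<dots> \<le> (\<integral>z. L * (((norm (fst z - snd z))\<^sup>2 / r + r) / 2) \<partial>\<pi>)"
    using fi int pt by (intro integral_mono) auto
  also have "\<dots> = L * (((\<integral>z. (norm (fst z - snd z))\<^sup>2 \<partial>\<pi>) / r + r) / 2)"
    using int by (simp add: prob_space)
  also have "\<dots> \<le> L * ((r\<^sup>2 / r + r) / 2)"
    using \<pi>(2) r0 L by (intro mult_left_mono divide_right_mono add_right_mono) auto
  also have "\<dots> = L * r" using r0 by (simp add: power2_eq_square)
  finally show ?thesis .
qed

text \<open>Closed sets generate the Borel sets and are stable under intersection, and their
  indicators are limits of Lipschitz cut-offs with values between 0 and 1.\<close>

lemma measure_eqI_lipschitz:
  fixes M N :: "'a::euclidean_space measure"
  assumes M: "prob_space M" "sets M = sets borel" and N: "prob_space N" "sets N = sets borel"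
    and eq: "\<And>f L. continuous_on UNIV f \<Longrightarrow> 0 \<le> L \<Longrightarrow> (\<And>x y. \<bar>f x - f y\<bar> \<le> L * norm (x - y)) \<Longrightarrow>
      (\<And>x. 0 \<le> f x) \<Longrightarrow> (\<And>x. f x \<le> 1) \<Longrightarrow> (\<integral>x. f x \<partial>M) = (\<integral>x. f x \<partial>N)"
  shows "M = N"
proof -
  interpret M: prob_space M by fact
  interpret N: prob_space N by fact
  have closed_eq: "emeasure M C = emeasure N C" if C: "closed C" for C
  proof (cases "C = {}")
    case False
    \<comment> \<open>Cut-offs decreasing to the indicator of \<open>C\<close>. The empty set is
      separate because \<open>infdist\<close> to it is 0 by convention, which would make every
      cut-off equal to 1.\<close>
    define f where "f k x = max 0 (1 - real k * infdist x C)" for k x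
    have cont: "continuous_on UNIV (f k)" for k
      unfolding f_def by (intro continuous_intros)
    have lip: "\<bar>f k x - f k y\<bar> \<le> real k * norm (x - y)" for k x y
    proof -
      have "\<bar>f k x - f k y\<bar> \<le> \<bar>real k * infdist x C - real k * infdist y C\<bar>"
        unfolding f_def by linarith
      also have "\<dots> = real k * \<bar>infdist x C - infdist y C\<bar>"
        by (simp add: abs_mult flip: right_diff_distrib)
      also have "\<dots> \<le> real k * norm (x - y)"
        using infdist_triangle_abs[of x C y] by (intro mult_left_mono) (auto simp: dist_norm)
      finally show ?thesis .
    qed
    have bd: "0 \<le> f k x" "f k x \<le> 1" for k x
      by (auto simp: f_def infdist_nonneg)
    have lim: "(\<lambda>k. f k x) \<longlonglongrightarrow> indicator C x" for x
    proof (cases "x \<in> C")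
      case True
      then show ?thesis by (simp add: f_def)
    next
      case F: False
      then have p: "0 < infdist x C"
        using in_closed_iff_infdist_zero[OF C False] infdist_nonneg[of x C] by (simp add: less_le)
      obtain n :: nat where n: "1 / infdist x C < real n" using reals_Archimedean2 by blast
      have "eventually (\<lambda>k. f k x = 0) sequentially"
        using eventually_ge_at_top[of n]
      proof eventually_elim
        case (elim k)
        then have "1 / infdist x C < real k" using n by linarith
        then show ?case using p by (simp add: f_def field_simps)
      qed
      with F show ?thesis by (simp add: tendsto_eventually)
    qed
    have conv: "(\<lambda>k. \<integral>x. f k x \<partial>K) \<longlonglongrightarrow> measure K C"
      if K: "prob_space K" "sets K = sets borel" for K :: "'a measure"
    proof -
      interpret K: prob_space K by fact
      have mf: "f k \<in> borel_measurable K" for k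
        using borel_measurable_continuous_onI[OF cont[of k]] measurable_cong_sets[OF K(2) refl] by blast
      have CK: "C \<in> sets K" using C K(2) by simp
      have "(\<lambda>k. \<integral>x. f k x \<partial>K) \<longlonglongrightarrow> (\<integral>x. indicator C x \<partial>K)"
        using mf CK lim bd by (intro integral_dominated_convergence[where w="\<lambda>_. 1"]) auto
      then show ?thesis using CK by simp
    qed
    have "(\<integral>x. f k x \<partial>M) = (\<integral>x. f k x \<partial>N)" for k
      using lip bd cont by (intro eq[of _ "real k"]) auto
    with conv[OF M] conv[OF N] have "measure M C = measure N C"
      by (metis (no_types, lifting) LIMSEQ_unique ext)
    then show ?thesis by (simp add: M.emeasure_eq_measure N.emeasure_eq_measure)
  qed simp
  have sets: "sets (borel :: 'a measure) = sigma_sets UNIV (Collect closed)"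
    by (simp add: borel_eq_closed)
  show ?thesis
  proof (rule measure_eqI_generator_eq[where E = "Collect closed" and \<Omega> = UNIV and A = "\<lambda>_. UNIV"])
    show "Int_stable (Collect closed :: 'a set set)" by (auto simp: Int_stable_def)
  qed (use closed_eq M(2) N(2) sets in auto)
qed

lemma integrable_P2_bounded:
  assumes "\<mu> \<in> P2" "continuous_on UNIV f" "\<And>x. 0 \<le> f x" "\<And>x. f x \<le> (1::real)"
  shows "integrable \<mu> f"
  using assms by (intro integrable_quadratic_bound[of _ _ 1 0] borel_measurable_continuous_onI) auto

lemma W2_small_imp_eq:
  assumes \<mu>: "\<mu> \<in> P2" and \<nu>: "\<nu> \<in> P2" and small: "\<And>r. 0 < r \<Longrightarrow> W2 \<mu> \<nu> \<le> r"
  shows "\<mu> = \<nu>"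
proof (rule measure_eqI_lipschitz)
  fix f :: "'a \<Rightarrow> real" and L
  assume f: "continuous_on UNIV f" "0 \<le> L" "\<And>x y. \<bar>f x - f y\<bar> \<le> L * norm (x - y)"
    "\<And>x. 0 \<le> f x" "\<And>x. f x \<le> 1"
  have "\<bar>(\<integral>x. f x \<partial>\<mu>) - (\<integral>x. f x \<partial>\<nu>)\<bar> \<le> 0 + e" if "0 < e" for e
  proof -
    define r where "r = e / (L + 1)"
    have "0 < r" using that f(2) by (simp add: r_def)
    then have "W2 \<mu> \<nu> < r" using small[of "r / 2"] by simp
    then have "\<bar>(\<integral>x. f x \<partial>\<mu>) - (\<integral>x. f x \<partial>\<nu>)\<bar> \<le> L * r"
      using f by (intro W2_lipschitz[OF \<mu> \<nu>] borel_measurable_continuous_onI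
          integrable_P2_bounded \<mu> \<nu>) auto
    also have "\<dots> \<le> e" using that f(2) by (simp add: r_def field_simps)
    finally show ?thesis by simp
  qed
  then have "\<bar>(\<integral>x. f x \<partial>\<mu>) - (\<integral>x. f x \<partial>\<nu>)\<bar> \<le> 0"
    by (rule field_le_epsilon)
  then show "(\<integral>x. f x \<partial>\<mu>) = (\<integral>x. f x \<partial>\<nu>)" by simp
qed (use P2D[OF \<mu>] P2D[OF \<nu>] in auto)

text \<open>Products of coordinates are not Lipschitz. Their increment is expanded around
  \<open>x\<close> and the mixed terms are split with weight \<open>r\<close>, so that the bound
  vanishes with \<open>r\<close> and involves the second moment of \<open>\<mu>\<close> alone; it
  can thus be used with \<mu> fixed and \<nu> running through a sequence.\<close>

lemma W2_second_moment:
  fixes \<mu> \<nu> :: "(real^'n) measure"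
  assumes \<mu>: "\<mu> \<in> P2" and \<nu>: "\<nu> \<in> P2" and r: "W2 \<mu> \<nu> < r"
  shows "\<bar>(\<integral>x. x $ i * x $ j \<partial>\<mu>) - (\<integral>x. x $ i * x $ j \<partial>\<nu>)\<bar> \<le> r\<^sup>2 + r + r * (\<integral>x. (norm x)\<^sup>2 \<partial>\<mu>)"
    "(\<integral>x. (norm x)\<^sup>2 \<partial>\<nu>) \<le> 2 * (\<integral>x. (norm x)\<^sup>2 \<partial>\<mu>) + 2 * r\<^sup>2"
proof -
  have r0: "0 < r" using W2_nonneg[OF \<mu> \<nu>] r by simp
  obtain \<pi> where \<pi>: "\<pi> \<in> couplings \<mu> \<nu>" "(\<integral>z. (norm (fst z - snd z))\<^sup>2 \<partial>\<pi>) < r\<^sup>2"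
    using W2_less_coupling[OF \<mu> \<nu> r] by blast
  interpret prob_space \<pi> using \<pi>(1) by (rule couplingsD)
  note int = integrable_cost[OF \<pi>(1) \<mu> \<nu>]
  have mij: "(\<lambda>x::real^'n. x $ i * x $ j) \<in> borel_measurable borel"
    by (intro borel_measurable_continuous_onI continuous_intros)
  note ci = coupling_integrals[OF \<pi>(1) mij]
  have mn: "(\<lambda>x::real^'n. (norm x)\<^sup>2) \<in> borel_measurable borel" by simp
  note cn = coupling_integrals[OF \<pi>(1) mn]
  have bd: "\<bar>x $ i * x $ j\<bar> \<le> 0 + 1 * (norm x)\<^sup>2" for x :: "real^'n"
    by (simp add: abs_mult power2_eq_square component_le_norm_cart mult_mono)
  have fi: "integrable \<pi> (\<lambda>z. fst z $ i * fst z $ j)" "integrable \<pi> (\<lambda>z. snd z $ i * snd z $ j)"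
    unfolding ci by (rule integrable_quadratic_bound[OF _ mij bd]; fact)+
  have ni: "integrable \<pi> (\<lambda>z. (norm (fst z))\<^sup>2)" "integrable \<pi> (\<lambda>z. (norm (snd z))\<^sup>2)"
    unfolding cn using P2D(3)[OF \<mu>] P2D(3)[OF \<nu>] .
  have pt: "\<bar>x $ i * x $ j - y $ i * y $ j\<bar> \<le> (1 + 1 / r) * (norm (x - y))\<^sup>2 + r * (norm x)\<^sup>2"
    for x y :: "real^'n"
  proof -
    let ?d = "y - x"
    have "x $ i * x $ j - y $ i * y $ j = - (x $ i * ?d $ j + ?d $ i * x $ j + ?d $ i * ?d $ j)"
      by (simp add: algebra_simps)
    then have "\<bar>x $ i * x $ j - y $ i * y $ j\<bar> \<le> \<bar>x $ i * ?d $ j\<bar> + \<bar>?d $ i * x $ j\<bar> + \<bar>?d $ i * ?d $ j\<bar>"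
      by linarith
    also have "\<dots> \<le> norm x * norm ?d + norm ?d * norm x + norm ?d * norm ?d"
      unfolding abs_mult by (intro add_mono mult_mono component_le_norm_cart) auto
    also have "\<dots> = 2 * norm ?d * norm x + (norm ?d)\<^sup>2" by (simp add: power2_eq_square)
    also have "2 * norm ?d * norm x \<le> (norm ?d)\<^sup>2 / r + r * (norm x)\<^sup>2"
    proof -
      have "2 * norm ?d * (r * norm x) \<le> (norm ?d)\<^sup>2 + (r * norm x)\<^sup>2" by (rule sum_squares_bound)
      then show ?thesis using r0 by (simp add: field_simps power2_eq_square)
    qed
    finally show ?thesis by (simp add: norm_minus_commute algebra_simps)
  qed
  have "\<bar>(\<integral>x. x $ i * x $ j \<partial>\<mu>) - (\<integral>x. x $ i * x $ j \<partial>\<nu>)\<bar> =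
      \<bar>\<integral>z. fst z $ i * fst z $ j - snd z $ i * snd z $ j \<partial>\<pi>\<bar>"
    using fi by (simp add: ci(3,4))
  also have "\<dots> \<le> (\<integral>z. \<bar>fst z $ i * fst z $ j - snd z $ i * snd z $ j\<bar> \<partial>\<pi>)" by (rule integral_abs_bound)
  also have "\<dots> \<le> (\<integral>z. (1 + 1 / r) * (norm (fst z - snd z))\<^sup>2 + r * (norm (fst z))\<^sup>2 \<partial>\<pi>)"
    using fi int ni pt by (intro integral_mono) auto
  also have "\<dots> = (1 + 1 / r) * (\<integral>z. (norm (fst z - snd z))\<^sup>2 \<partial>\<pi>) + r * (\<integral>x. (norm x)\<^sup>2 \<partial>\<mu>)"
    using int ni by (simp add: cn)
  also have "\<dots> \<le> (1 + 1 / r) * r\<^sup>2 + r * (\<integral>x. (norm x)\<^sup>2 \<partial>\<mu>)"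
    using \<pi>(2) r0 by (intro add_right_mono mult_left_mono) auto
  also have "(1 + 1 / r) * r\<^sup>2 = r\<^sup>2 + r" using r0 by (simp add: field_simps power2_eq_square)
  finally show "\<bar>(\<integral>x. x $ i * x $ j \<partial>\<mu>) - (\<integral>x. x $ i * x $ j \<partial>\<nu>)\<bar> \<le> r\<^sup>2 + r + r * (\<integral>x. (norm x)\<^sup>2 \<partial>\<mu>)" .
  have "(\<integral>x. (norm x)\<^sup>2 \<partial>\<nu>) = (\<integral>z. (norm (snd z))\<^sup>2 \<partial>\<pi>)" by (simp add: cn)
  also have "\<dots> \<le> (\<integral>z. 2 * (norm (fst z))\<^sup>2 + 2 * (norm (fst z - snd z))\<^sup>2 \<partial>\<pi>)"
  proof (rule integral_mono)
    show "(norm (snd z))\<^sup>2 \<le> 2 * (norm (fst z))\<^sup>2 + 2 * (norm (fst z - snd z))\<^sup>2" for z :: "(real^'n) \<times> (real^'n)"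
      using norm_diff_sq_le[of "fst z" "fst z - snd z"] by simp
  qed (use ni int in auto)
  also have "\<dots> = 2 * (\<integral>x. (norm x)\<^sup>2 \<partial>\<mu>) + 2 * (\<integral>z. (norm (fst z - snd z))\<^sup>2 \<partial>\<pi>)"
    using ni int by (simp add: cn)
  finally show "(\<integral>x. (norm x)\<^sup>2 \<partial>\<nu>) \<le> 2 * (\<integral>x. (norm x)\<^sup>2 \<partial>\<mu>) + 2 * r\<^sup>2" using \<pi>(2) by simp
qed

section \<open>Push-forwards and the midpoint of a diagonal transport\<close>

lemma distr_in_P2:
  fixes T :: "'a::euclidean_space \<Rightarrow> 'b::euclidean_space"
  assumes \<mu>: "\<mu> \<in> P2" and T: "continuous_on UNIV T"
    and bound: "\<And>x. (norm (T x))\<^sup>2 \<le> a + b * (norm x)\<^sup>2"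
  shows "distr \<mu> borel T \<in> P2"
proof -
  interpret prob_space \<mu> using \<mu> by (rule P2D)
  have mb: "T \<in> borel_measurable borel" using T by (rule borel_measurable_continuous_onI)
  then have m: "T \<in> borel_measurable \<mu>" by (rule measurable_P2[OF \<mu>])
  have "integrable \<mu> (\<lambda>x. (norm (T x))\<^sup>2)"
    using mb bound by (intro integrable_quadratic_bound[OF \<mu>, of _ a b]) auto
  then have "integrable (distr \<mu> borel T) (\<lambda>x. (norm x)\<^sup>2)"
    using m by (simp add: integrable_distr_eq)
  then show ?thesis by (simp add: P2_def prob_space_distr m)
qed

lemma distr_pair_coupling:
  fixes M :: "'b measure" and f g :: "'b \<Rightarrow> 'a::euclidean_space"
  assumes "prob_space M" and [measurable]: "f \<in> borel_measurable M" "g \<in> borel_measurable M"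
  shows "distr M borel (\<lambda>x. (f x, g x)) \<in> couplings (distr M borel f) (distr M borel g)"
    and "(\<integral>z. (norm (fst z - snd z))\<^sup>2 \<partial>distr M borel (\<lambda>x. (f x, g x))) = (\<integral>x. (norm (f x - g x))\<^sup>2 \<partial>M)"
proof -
  interpret prob_space M by fact
  have m: "(\<lambda>x. (f x, g x)) \<in> borel_measurable M" by measurable
  have c: "fst \<in> borel_measurable (borel :: ('a \<times> 'a) measure)" "snd \<in> borel_measurable (borel :: ('a \<times> 'a) measure)"
    by (intro borel_measurable_continuous_onI continuous_intros)+
  show "distr M borel (\<lambda>x. (f x, g x)) \<in> couplings (distr M borel f) (distr M borel g)"
    unfolding couplings_def using distr_distr[OF c(1) m] distr_distr[OF c(2) m]
    by (simp add: prob_space_distr m comp_def)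
  have "(\<lambda>z. (norm (fst z - snd z))\<^sup>2) \<in> borel_measurable (borel :: ('a \<times> 'a) measure)"
    by (intro borel_measurable_continuous_onI continuous_intros)
  then show "(\<integral>z. (norm (fst z - snd z))\<^sup>2 \<partial>distr M borel (\<lambda>x. (f x, g x))) = (\<integral>x. (norm (f x - g x))\<^sup>2 \<partial>M)"
    by (simp add: integral_distr[OF m])
qed

text \<open>The next two identities are the Hopf--Lax inequalities for the quadratic potentials of the
  map scaling the coordinate by \<open>t\<close>; the remainder terms vanish at the midpoint.\<close>

lemma midpoint_identities:
  fixes t x y z :: real
  assumes "0 < t"
  shows "2 * (x - z)\<^sup>2 = (1 - t) * x\<^sup>2 + (2 - 4 / (1 + t)) * z\<^sup>2 + 4 / (1 + t) * ((1 + t) / 2 * x - z)\<^sup>2"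
    and "2 * (z - y)\<^sup>2 = (1 - 1 / t) * y\<^sup>2 - (2 - 4 / (1 + t)) * z\<^sup>2 + (1 + 1 / t) * (y - 2 * t / (1 + t) * z)\<^sup>2"
proof -
  define s where "s = 1 + t"
  have s: "0 < s" "t = s - 1" using assms by (simp_all add: s_def)
  show "2 * (x - z)\<^sup>2 = (1 - t) * x\<^sup>2 + (2 - 4 / (1 + t)) * z\<^sup>2 + 4 / (1 + t) * ((1 + t) / 2 * x - z)\<^sup>2"
    unfolding s_def[symmetric] using s(1) unfolding s(2)
    by (simp add: field_simps power2_eq_square)
  show "2 * (z - y)\<^sup>2 = (1 - 1 / t) * y\<^sup>2 - (2 - 4 / (1 + t)) * z\<^sup>2 + (1 + 1 / t) * (y - 2 * t / (1 + t) * z)\<^sup>2"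
    unfolding s_def[symmetric] using s(1) assms
    by (simp add: field_simps power2_eq_square) (simp add: s_def algebra_simps)
qed

lemma norm_vec_sq: "(norm (x::real^'n))\<^sup>2 = (\<Sum>i\<in>UNIV. (x $ i)\<^sup>2)"
  unfolding power2_norm_eq_inner inner_vec_def by (simp add: power2_eq_square)

text \<open>Integrate one identity against a near-optimal coupling of \<mu> and \<open>m\<close>,
  the other against one of \<open>m\<close> and \<nu>, and add. The potentials already account for
  \<open>?W\<^sup>2\<close>, so the remainder of the first identity has small integral, and this
  remainder controls the distance of \<open>m\<close> from the image of \<mu> under
  \<open>D s\<close>.\<close>

lemma W2_midpoint_unique:
  fixes \<mu> m :: "(real^'n) measure" and t :: "'n \<Rightarrow> real"
  defines "\<nu> \<equiv> distr \<mu> borel (\<lambda>x. \<chi> i. t i * x $ i)"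
  assumes \<mu>: "\<mu> \<in> P2" and m: "m \<in> P2" and t: "\<And>i. 0 < t i"
    and half: "W2 \<mu> m = W2 \<mu> \<nu> / 2" "W2 m \<nu> = W2 \<mu> \<nu> / 2"
  shows "m = distr \<mu> borel (\<lambda>x. \<chi> i. (1 + t i) / 2 * x $ i)"
proof -
  interpret \<mu>: prob_space \<mu> using \<mu> by (rule P2D)
  define D :: "('n \<Rightarrow> real) \<Rightarrow> real^'n \<Rightarrow> real^'n" where "D a x = (\<chi> i. a i * x $ i)" for a x
  define s where "s i = (1 + t i) / 2" for i
  define \<sigma> where "\<sigma> = distr \<mu> borel (D s)"
  have D_cont: "continuous_on UNIV (D a)" for a
    unfolding D_def by (intro continuous_intros)
  have D_norm: "(norm (D a x))\<^sup>2 \<le> 0 + (\<Sum>i\<in>UNIV. (a i)\<^sup>2) * (norm x)\<^sup>2" for a x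
  proof -
    have "(norm (D a x))\<^sup>2 = (\<Sum>i\<in>UNIV. (a i)\<^sup>2 * (x $ i)\<^sup>2)"
      by (simp add: norm_vec_sq D_def power_mult_distrib)
    also have "\<dots> \<le> (\<Sum>i\<in>UNIV. (a i)\<^sup>2 * (norm x)\<^sup>2)"
      by (intro sum_mono mult_left_mono)
        (auto simp: component_le_norm_cart intro: abs_le_square_iff[THEN iffD1])
    finally show ?thesis by (simp add: sum_distrib_right)
  qed
  have D_meas: "D a \<in> borel_measurable \<mu>" for a
    using D_cont by (intro measurable_P2[OF \<mu>] borel_measurable_continuous_onI)
  have \<nu>: "\<nu> \<in> P2" and \<sigma>: "\<sigma> \<in> P2"
    using distr_in_P2[OF \<mu> D_cont D_norm] by (auto simp: \<nu>_def \<sigma>_def D_def[abs_def])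
  define p where "p i = (\<integral>x. (x $ i)\<^sup>2 \<partial>\<mu>)" for i
  have sq_int: "integrable K (\<lambda>x. (x $ i)\<^sup>2)" if "K \<in> P2" for K :: "(real^'n) measure" and i
    by (rule integrable_quadratic_bound[OF that, of _ 0 1])
      (auto intro!: borel_measurable_continuous_onI continuous_intros
        simp: component_le_norm_cart intro: abs_le_square_iff[THEN iffD1])
  have sq_meas: "(\<lambda>x::real^'n. (x $ i)\<^sup>2) \<in> borel_measurable borel" for i
    by (intro borel_measurable_continuous_onI continuous_intros)
  have \<nu>_sq: "(\<integral>y. (y $ i)\<^sup>2 \<partial>\<nu>) = (t i)\<^sup>2 * p i" for i
    using integral_distr[OF D_meas[of t] sq_meas[of i]]
    by (simp add: \<nu>_def p_def D_def[abs_def] power_mult_distrib)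
  let ?W = "W2 \<mu> \<nu>"
  have W0: "0 \<le> ?W" by (rule W2_nonneg[OF \<mu> \<nu>])
  \<comment> \<open>The cost of coupling \<open>x\<close> with \<open>D t x\<close>, an upper bound
    for \<open>?W\<^sup>2\<close>.\<close>
  define K where "K = (\<Sum>i\<in>UNIV. (1 - t i)\<^sup>2 * p i)"
  have WK: "?W\<^sup>2 \<le> K"
  proof -
    have id: "(\<lambda>x. x) \<in> borel_measurable \<mu>" by (rule measurable_P2[OF \<mu>]) simp
    have "distr \<mu> borel (\<lambda>x. x) = \<mu>" using P2D(1)[OF \<mu>] by (simp add: distr_id2)
    then have c: "distr \<mu> borel (\<lambda>x. (x, D t x)) \<in> couplings \<mu> \<nu>"
      using distr_pair_coupling(1)[OF P2D(2)[OF \<mu>] id D_meas[of t]] by (simp add: \<nu>_def D_def[abs_def])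
    have "(norm (x - D t x))\<^sup>2 = (\<Sum>i\<in>UNIV. (1 - t i)\<^sup>2 * (x $ i)\<^sup>2)" for x
      by (simp add: norm_vec_sq D_def power_mult_distrib[symmetric] algebra_simps)
    then have "(\<integral>x. (norm (x - D t x))\<^sup>2 \<partial>\<mu>) = K"
      using sq_int[OF \<mu>] by (simp add: K_def p_def)
    moreover have "0 \<le> K"
      unfolding K_def p_def by (intro sum_nonneg mult_nonneg_nonneg Bochner_Integration.integral_nonneg) auto
    ultimately have "?W \<le> sqrt K"
      using distr_pair_coupling(2)[OF P2D(2)[OF \<mu>] id D_meas[of t]] by (intro W2_le[OF c]) simp_all
    then show ?thesis using W0 \<open>0 \<le> K\<close> using power_mono[of ?W "sqrt K" 2] by simp
  qed
  define S where "S = (\<Sum>i\<in>UNIV. s i)"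
  have s0: "0 < s i" for i using t[of i] by (simp add: s_def)
  have S: "0 < S" "s i \<le> S" for i
    unfolding S_def using s0 by (auto intro!: sum_pos) (meson UNIV_I finite less_imp_le member_le_sum)
  have key: "W2 \<sigma> m \<le> r" if r: "0 < r" for r
  proof -
    \<comment> \<open>Chosen so that the final bound
      \<open>S / 2 * (4 * \<epsilon> * (?W + 1))\<close> is at most \<open>r\<^sup>2\<close>;
      \<open>\<epsilon> \<le> 1\<close> lets \<open>?W + \<epsilon>\<close> be replaced by
      \<open>?W + 1\<close>.\<close>
    define \<epsilon> where "\<epsilon> = min 1 (r\<^sup>2 / (2 * S * (?W + 1)))"
    have \<epsilon>: "0 < \<epsilon>" "\<epsilon> \<le> 1" using r S(1) W0 by (auto simp: \<epsilon>_def)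
    obtain \<pi>1 where \<pi>1: "\<pi>1 \<in> couplings \<mu> m"
      and c1: "(\<integral>z. (norm (fst z - snd z))\<^sup>2 \<partial>\<pi>1) < (?W / 2 + \<epsilon>)\<^sup>2"
      using W2_less_coupling[OF \<mu> m, of "?W / 2 + \<epsilon>"] half \<epsilon> by auto
    obtain \<pi>2 where \<pi>2: "\<pi>2 \<in> couplings m \<nu>"
      and c2: "(\<integral>z. (norm (fst z - snd z))\<^sup>2 \<partial>\<pi>2) < (?W / 2 + \<epsilon>)\<^sup>2"
      using W2_less_coupling[OF m \<nu>, of "?W / 2 + \<epsilon>"] half \<epsilon> by auto
    define q where "q i = (\<integral>x. (x $ i)\<^sup>2 \<partial>m)" for i
    \<comment> \<open>The potential at the midpoint. It occurs with opposite signs in the two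
      halves, so the moments \<open>q\<close> of the unknown \<open>m\<close> cancel.\<close>
    define b where "b i = 2 - 4 / (1 + t i)" for i
    have i1: "integrable \<pi>1 (\<lambda>z. (fst z $ i)\<^sup>2)" "integrable \<pi>1 (\<lambda>z. (snd z $ i)\<^sup>2)"
      "(\<integral>z. (fst z $ i)\<^sup>2 \<partial>\<pi>1) = p i" "(\<integral>z. (snd z $ i)\<^sup>2 \<partial>\<pi>1) = q i" for i
      using coupling_integrals[OF \<pi>1 sq_meas[of i]] sq_int[OF \<mu>] sq_int[OF m] by (auto simp: p_def q_def)
    have i2: "integrable \<pi>2 (\<lambda>z. (fst z $ i)\<^sup>2)" "integrable \<pi>2 (\<lambda>z. (snd z $ i)\<^sup>2)"
      "(\<integral>z. (fst z $ i)\<^sup>2 \<partial>\<pi>2) = q i" "(\<integral>z. (snd z $ i)\<^sup>2 \<partial>\<pi>2) = (t i)\<^sup>2 * p i" for i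
      using coupling_integrals[OF \<pi>2 sq_meas[of i]] sq_int[OF \<nu>] sq_int[OF m] \<nu>_sq by (auto simp: q_def)
    define e where "e z = (\<Sum>i\<in>UNIV. 4 / (1 + t i) * (s i * fst z $ i - snd z $ i)\<^sup>2)"
      for z :: "(real^'n) \<times> (real^'n)"
    have id1: "2 * (norm (fst z - snd z))\<^sup>2 =
        (\<Sum>i\<in>UNIV. (1 - t i) * (fst z $ i)\<^sup>2 + b i * (snd z $ i)\<^sup>2) + e z" for z :: "(real^'n) \<times> (real^'n)"
      unfolding norm_vec_sq e_def sum.distrib[symmetric] sum_distrib_left b_def s_def
      by (intro sum.cong refl) (use midpoint_identities(1)[OF t] in simp)
    have e_eq: "e = (\<lambda>z. 2 * (norm (fst z - snd z))\<^sup>2 -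
        (\<Sum>i\<in>UNIV. (1 - t i) * (fst z $ i)\<^sup>2 + b i * (snd z $ i)\<^sup>2))"
    proof
      fix z
      show "e z = 2 * (norm (fst z - snd z))\<^sup>2 -
          (\<Sum>i\<in>UNIV. (1 - t i) * (fst z $ i)\<^sup>2 + b i * (snd z $ i)\<^sup>2)"
        using id1[of z] by linarith
    qed
    have e_int: "integrable \<pi>1 e"
      unfolding e_eq using integrable_cost[OF \<pi>1 \<mu> m] i1 by simp
    have E1: "2 * (\<integral>z. (norm (fst z - snd z))\<^sup>2 \<partial>\<pi>1) =
        (\<Sum>i\<in>UNIV. (1 - t i) * p i + b i * q i) + (\<integral>z. e z \<partial>\<pi>1)"
      unfolding e_eq using integrable_cost[OF \<pi>1 \<mu> m] i1 by simp
    have id2: "(\<Sum>i\<in>UNIV. (1 - 1 / t i) * (snd z $ i)\<^sup>2 - b i * (fst z $ i)\<^sup>2) \<le> 2 * (norm (fst z - snd z))\<^sup>2"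
      for z :: "(real^'n) \<times> (real^'n)"
      unfolding norm_vec_sq sum_distrib_left
    proof (rule sum_mono)
      fix i
      have "0 \<le> (1 + 1 / t i) * (snd z $ i - 2 * t i / (1 + t i) * fst z $ i)\<^sup>2"
        using t[of i] by (intro mult_nonneg_nonneg) auto
      then show "(1 - 1 / t i) * (snd z $ i)\<^sup>2 - b i * (fst z $ i)\<^sup>2 \<le> 2 * ((fst z - snd z) $ i)\<^sup>2"
        using midpoint_identities(2)[OF t[of i], of "fst z $ i" "snd z $ i"] by (simp add: b_def)
    qed
    have "(\<integral>z. (\<Sum>i\<in>UNIV. (1 - 1 / t i) * (snd z $ i)\<^sup>2 - b i * (fst z $ i)\<^sup>2) \<partial>\<pi>2) \<le>
        (\<integral>z. 2 * (norm (fst z - snd z))\<^sup>2 \<partial>\<pi>2)"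
      using integrable_cost[OF \<pi>2 m \<nu>] i2 id2 by (intro integral_mono) auto
    then have E2: "(\<Sum>i\<in>UNIV. (1 - 1 / t i) * ((t i)\<^sup>2 * p i) - b i * q i) \<le>
        2 * (\<integral>z. (norm (fst z - snd z))\<^sup>2 \<partial>\<pi>2)"
      using integrable_cost[OF \<pi>2 m \<nu>] i2 by simp
    have "(\<Sum>i\<in>UNIV. (1 - t i) * p i + b i * q i) + (\<Sum>i\<in>UNIV. (1 - 1 / t i) * ((t i)\<^sup>2 * p i) - b i * q i) = K"
      unfolding K_def sum.distrib[symmetric]
    proof (rule sum.cong[OF refl])
      fix i
      have "(1 - 1 / t i) * ((t i)\<^sup>2 * p i) = ((t i)\<^sup>2 - t i) * p i"
        using t[of i] by (simp add: field_simps power2_eq_square)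
      then show "(1 - t i) * p i + b i * q i + ((1 - 1 / t i) * ((t i)\<^sup>2 * p i) - b i * q i) = (1 - t i)\<^sup>2 * p i"
        by (simp add: algebra_simps power2_eq_square)
    qed
    with E1 E2 c1 c2 WK have "(\<integral>z. e z \<partial>\<pi>1) \<le> 4 * (?W / 2 + \<epsilon>)\<^sup>2 - ?W\<^sup>2" by linarith
    also have "\<dots> = 4 * \<epsilon> * (?W + \<epsilon>)" by (simp add: power2_eq_square algebra_simps)
    also have "\<dots> \<le> 4 * \<epsilon> * (?W + 1)" using \<epsilon> by simp
    finally have e_small: "(\<integral>z. e z \<partial>\<pi>1) \<le> 4 * \<epsilon> * (?W + 1)" .
    \<comment> \<open>The weight \<open>4 / (1 + t i)\<close> is \<open>2 / s i\<close>, and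
      \<open>S / s i\<close> is at least 1.\<close>
    have pt: "(norm (D s (fst z) - snd z))\<^sup>2 \<le> S / 2 * e z" for z
    proof -
      have "(s i * fst z $ i - snd z $ i)\<^sup>2 \<le> S / 2 * (4 / (1 + t i) * (s i * fst z $ i - snd z $ i)\<^sup>2)" for i
      proof -
        have "1 \<le> S / 2 * (4 / (1 + t i))" using S(2)[of i] t[of i] by (simp add: s_def field_simps)
        then have "1 * (s i * fst z $ i - snd z $ i)\<^sup>2 \<le> S / 2 * (4 / (1 + t i)) * (s i * fst z $ i - snd z $ i)\<^sup>2"
          by (rule mult_right_mono) simp
        then show ?thesis by (simp add: mult.assoc)
      qed
      then show ?thesis
        unfolding norm_vec_sq e_def D_def sum_distrib_left by (simp add: sum_mono)
    qed
    interpret \<pi>1: prob_space \<pi>1 using \<pi>1 by (rule couplingsD)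
    have mD: "(\<lambda>z. D s (fst z)) \<in> borel_measurable \<pi>1" and m2: "snd \<in> borel_measurable \<pi>1"
      and m1: "fst \<in> borel_measurable \<pi>1"
      by (intro measurable_coupling[OF \<pi>1] borel_measurable_continuous_onI continuous_intros
          continuous_on_compose2[OF D_cont]; simp)+
    have "distr \<pi>1 borel (\<lambda>z. D s (fst z)) = distr (distr \<pi>1 borel fst) borel (D s)"
      using D_cont m1 by (subst distr_distr) (auto simp: comp_def intro: borel_measurable_continuous_onI)
    then have "distr \<pi>1 borel (\<lambda>z. D s (fst z)) = \<sigma>"
      by (simp add: couplingsD(3)[OF \<pi>1] \<sigma>_def)
    with distr_pair_coupling(1)[OF couplingsD(2)[OF \<pi>1] mD m2]
    have c: "distr \<pi>1 borel (\<lambda>z. (D s (fst z), snd z)) \<in> couplings \<sigma> m"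
      by (simp add: couplingsD(4)[OF \<pi>1])
    have "(\<integral>z. (norm (D s (fst z) - snd z))\<^sup>2 \<partial>\<pi>1) \<le> (\<integral>z. S / 2 * e z \<partial>\<pi>1)"
    proof (rule integral_mono')
      show "integrable \<pi>1 (\<lambda>z. S / 2 * e z)" using e_int by simp
      show "0 \<le> S / 2 * e z" for z by (rule order_trans[OF zero_le_power2 pt])
    qed (rule pt)
    also have "\<dots> = S / 2 * (\<integral>z. e z \<partial>\<pi>1)" by simp
    also have "\<dots> \<le> S / 2 * (4 * \<epsilon> * (?W + 1))"
      using e_small S(1) by (intro mult_left_mono) auto
    also have "\<dots> = 2 * S * (?W + 1) * \<epsilon>" by simp
    also have "\<dots> \<le> 2 * S * (?W + 1) * (r\<^sup>2 / (2 * S * (?W + 1)))"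
      using S(1) W0 by (intro mult_left_mono) (auto simp: \<epsilon>_def)
    also have "\<dots> = r\<^sup>2" using S(1) W0 by simp
    finally show ?thesis
      using distr_pair_coupling(2)[OF couplingsD(2)[OF \<pi>1] mD m2] r by (intro W2_le[OF c]) simp_all
  qed
  have "\<sigma> = m" by (rule W2_small_imp_eq[OF \<sigma> m key])
  then show ?thesis by (simp add: \<sigma>_def D_def[abs_def] s_def)
qed

section \<open>Elliptic densities\<close>

lemma measurable_affine:
  fixes A :: "real^'n^'m"
  shows "(\<lambda>x. v + A *v x) \<in> borel_measurable borel"
  by (intro borel_measurable_continuous_onI continuous_intros matrix_vector_mult_linear_continuous_on)

lemma nn_integral_lborel_translate:
  fixes f :: "'a::euclidean_space \<Rightarrow> ennreal"
  assumes f: "f \<in> borel_measurable borel"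
  shows "(\<integral>\<^sup>+x. f (x + c) \<partial>lborel) = (\<integral>\<^sup>+x. f x \<partial>lborel)"
  using nn_integral_distr[of "(+) c" lborel borel f] f by (simp add: lborel_distr_plus add.commute)

lemma nn_integral_lborel_uminus:
  fixes f :: "'a::euclidean_space \<Rightarrow> ennreal"
  assumes f: "f \<in> borel_measurable borel"
  shows "(\<integral>\<^sup>+x. f (- x) \<partial>lborel) = (\<integral>\<^sup>+x. f x \<partial>lborel)"
proof -
  have "lborel = distr lborel borel (uminus :: 'a \<Rightarrow> 'a)"
    using lborel_affine[of "-1" "0::'a"] by (simp add: density_1)
  then show ?thesis using nn_integral_distr[of uminus lborel borel f] f by simp
qed

text \<open>The argument for uniqueness of Haar measure: the Jacobian factor is only shown to exist.\<close>

lemma nn_integral_matrix_swap: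
  fixes A :: "real^'n^'n"
  assumes A: "invertible A" and f[measurable]: "f \<in> borel_measurable borel"
    and g[measurable]: "g \<in> borel_measurable borel"
  shows "(\<integral>\<^sup>+x. f (A *v x) \<partial>lborel) * (\<integral>\<^sup>+y. g y \<partial>lborel) =
    (\<integral>\<^sup>+x. g (A *v x) \<partial>lborel) * (\<integral>\<^sup>+y. f y \<partial>lborel)"
proof -
  have [measurable]: "(\<lambda>x. A *v x) \<in> borel_measurable borel"
    using measurable_affine[of 0 A] by simp
  have "(\<integral>\<^sup>+x. f (A *v x) \<partial>lborel) * (\<integral>\<^sup>+y. g y \<partial>lborel) =
      (\<integral>\<^sup>+x. f (A *v x) * (\<integral>\<^sup>+y. g y \<partial>lborel) \<partial>lborel)"
    by (simp add: nn_integral_multc)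
  also have "\<dots> = (\<integral>\<^sup>+x. f (A *v x) * (\<integral>\<^sup>+y. g (y + A *v x) \<partial>lborel) \<partial>lborel)"
    by (simp add: nn_integral_lborel_translate)
  also have "\<dots> = (\<integral>\<^sup>+x. (\<integral>\<^sup>+y. f (A *v x) * g (y + A *v x) \<partial>lborel) \<partial>lborel)"
    by (simp add: nn_integral_cmult)
  also have "\<dots> = (\<integral>\<^sup>+y. (\<integral>\<^sup>+x. f (A *v x) * g (y + A *v x) \<partial>lborel) \<partial>lborel)"
    by (intro lborel_pair.Fubini') measurable
  also have "\<dots> = (\<integral>\<^sup>+y. (\<integral>\<^sup>+x. f (A *v x - y) * g (A *v x) \<partial>lborel) \<partial>lborel)"
  proof (rule nn_integral_cong)
    fix y :: "real^'n"
    have "(\<integral>\<^sup>+x. f (A *v x) * g (y + A *v x) \<partial>lborel) =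
        (\<integral>\<^sup>+x. f (A *v (x + - (matrix_inv A *v y))) * g (y + A *v (x + - (matrix_inv A *v y))) \<partial>lborel)"
      by (intro nn_integral_lborel_translate[symmetric]) measurable
    then show "(\<integral>\<^sup>+x. f (A *v x) * g (y + A *v x) \<partial>lborel) =
        (\<integral>\<^sup>+x. f (A *v x - y) * g (A *v x) \<partial>lborel)"
      by (simp add: matrix_vector_mult_diff_distrib matrix_inv_vector_cancel[OF A])
  qed
  also have "\<dots> = (\<integral>\<^sup>+x. (\<integral>\<^sup>+y. f (A *v x - y) * g (A *v x) \<partial>lborel) \<partial>lborel)"
    by (intro lborel_pair.Fubini') measurable
  also have "\<dots> = (\<integral>\<^sup>+x. (\<integral>\<^sup>+y. f (A *v x - y) \<partial>lborel) * g (A *v x) \<partial>lborel)"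
    by (simp add: nn_integral_multc)
  also have "\<dots> = (\<integral>\<^sup>+x. (\<integral>\<^sup>+y. f y \<partial>lborel) * g (A *v x) \<partial>lborel)"
  proof (rule nn_integral_cong)
    fix x :: "real^'n"
    have "(\<integral>\<^sup>+y. f (A *v x - y) \<partial>lborel) = (\<integral>\<^sup>+y. f (- (y + - (A *v x))) \<partial>lborel)"
      by simp
    also have "\<dots> = (\<integral>\<^sup>+y. f (- y) \<partial>lborel)"
      by (rule nn_integral_lborel_translate[of "\<lambda>y. f (- y)"]) measurable
    also have "\<dots> = (\<integral>\<^sup>+y. f y \<partial>lborel)" by (rule nn_integral_lborel_uminus) measurable
    finally show "(\<integral>\<^sup>+y. f (A *v x - y) \<partial>lborel) * g (A *v x) = (\<integral>\<^sup>+y. f y \<partial>lborel) * g (A *v x)"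
      by simp
  qed
  also have "\<dots> = (\<integral>\<^sup>+x. g (A *v x) \<partial>lborel) * (\<integral>\<^sup>+y. f y \<partial>lborel)"
    by (simp add: nn_integral_cmult mult.commute)
  finally show ?thesis .
qed

text \<open>In the swap identity, the indicator of the unit cube as \<open>g\<close> turns the
  volume of the preimage of the cube into the factor for every \<open>f\<close>. It is finite
  because this preimage is bounded.\<close>

lemma distr_lborel_matrix:
  fixes A :: "real^'n^'n"
  assumes A: "invertible A"
  obtains k where "0 < k" "\<And>v. distr lborel borel (\<lambda>x. v + A *v x) = density lborel (\<lambda>_. ennreal k)"
proof -
  have mA: "(\<lambda>x. A *v x) \<in> borel_measurable borel"
    using measurable_affine[of 0 A] by simp
  let ?C = "cbox 0 One :: (real^'n) set"
  let ?K = "\<integral>\<^sup>+x. indicator ?C (A *v x) \<partial>lborel"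
  have C1: "(\<integral>\<^sup>+y. indicator ?C y \<partial>lborel) = (1::ennreal)"
    by (simp add: emeasure_lborel_cbox_eq)
  have K: "(\<integral>\<^sup>+x. f (A *v x) \<partial>lborel) = ?K * (\<integral>\<^sup>+y. f y \<partial>lborel)"
    if f: "f \<in> borel_measurable borel" for f :: "real^'n \<Rightarrow> ennreal"
    using nn_integral_matrix_swap[OF A f, of "indicator ?C"] C1 by simp
  \<comment> \<open>The constant function 1 has infinite integral before and after the
    substitution.\<close>
  have K0: "?K \<noteq> 0"
  proof
    assume "?K = 0"
    with K[of "\<lambda>_. 1"] show False by simp
  qed
  have "?K = emeasure lborel ((\<lambda>x. A *v x) -` ?C)"
    using mA by (subst nn_integral_indicator[symmetric])
      (auto intro!: nn_integral_cong measurable_sets_borel simp: indicator_def)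
  also have "(\<lambda>x. A *v x) -` ?C = (\<lambda>x. matrix_inv A *v x) ` ?C"
    by (force simp: matrix_inv_vector_cancel[OF A] image_iff intro: matrix_inv_vector_cancel(2)[OF A, symmetric])
  also have "emeasure lborel \<dots> < \<infinity>"
    by (intro emeasure_bounded_finite compact_imp_bounded compact_continuous_image
        matrix_vector_mult_linear_continuous_on compact_cbox)
  finally have "?K \<noteq> \<infinity>" by simp
  with K0 obtain k where k: "?K = ennreal k" "0 < k"
    by (cases ?K) (auto simp: less_le)
  show ?thesis
  proof
    show "0 < k" by fact
    fix v
    show "distr lborel borel (\<lambda>x. v + A *v x) = density lborel (\<lambda>_. ennreal k)"
    proof (rule measure_eqI)
      fix S assume "S \<in> sets (distr lborel borel (\<lambda>x. v + A *v x))"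
      then have S[measurable]: "S \<in> sets borel" by simp
      have "emeasure (distr lborel borel (\<lambda>x. v + A *v x)) S = (\<integral>\<^sup>+x. indicator S (v + A *v x) \<partial>lborel)"
        using S measurable_affine[of v A]
        by (simp add: nn_integral_indicator[symmetric] nn_integral_distr del: nn_integral_indicator)
      also have "\<dots> = ?K * (\<integral>\<^sup>+x. indicator S (v + x) \<partial>lborel)"
        using S by (intro K) measurable
      also have "(\<integral>\<^sup>+x. indicator S (v + x) \<partial>lborel) = (\<integral>\<^sup>+x. indicator S x \<partial>lborel)"
        using nn_integral_lborel_translate[of "indicator S" v] S by (simp add: add.commute)
      finally show "emeasure (distr lborel borel (\<lambda>x. v + A *v x)) S = emeasure (density lborel (\<lambda>_. ennreal k)) S"
        using S by (simp add: k(1) emeasure_density_const)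
    qed simp
  qed
qed

text \<open>For diagonal maps the value of the Jacobian factor matters: it has to be 1 for the
  endpoint map and \<open>1 / \<kappa>\<close> for the midpoint map.\<close>

lemma distr_lborel_diagonal:
  fixes s :: "'n::finite \<Rightarrow> real"
  assumes s: "\<And>i. s i \<noteq> 0"
  shows "distr lborel borel (\<lambda>x::real^'n. \<chi> i. s i * x $ i) = density lborel (\<lambda>_. ennreal (1 / (\<Prod>i\<in>UNIV. \<bar>s i\<bar>)))"
proof -
  let ?T = "\<lambda>x::real^'n. \<chi> i. s i * x $ i"
  define c :: "real^'n \<Rightarrow> real" where "c j = ?T j \<bullet> j" for j
  have cax: "c (axis i 1) = s i" for i by (simp add: c_def inner_axis)
  have Bas: "(Basis :: (real^'n) set) = (\<lambda>i. axis i 1) ` UNIV" by (auto simp: Basis_vec_def)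
  have inj: "inj (\<lambda>i. axis i 1 :: real^'n)" by (auto simp: inj_def axis_eq_axis)
  have T: "?T = (\<lambda>x. 0 + (\<Sum>j\<in>Basis. (c j * (x \<bullet> j)) *\<^sub>R j))"
    unfolding Bas sum.reindex[OF inj] comp_def cax inner_axis
    by (simp add: fun_eq_iff vec_eq_iff axis_def if_distrib cong: if_cong)
  have P: "(\<Prod>j\<in>Basis. \<bar>c j\<bar>) = (\<Prod>i\<in>UNIV. \<bar>s i\<bar>)"
    by (simp add: Bas prod.reindex[OF inj] cax)
  let ?p = "\<Prod>i\<in>UNIV. \<bar>s i\<bar>"
  have p: "0 < ?p" using s by (intro prod_pos) auto
  have recip: "ennreal r * ennreal (1 / r) = 1" if "0 < r" for r
    using that by (simp flip: ennreal_mult)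
  have eq: "lborel = density (distr lborel borel ?T) (\<lambda>_. ennreal ?p)"
  proof -
    have "c j \<noteq> 0" if "j \<in> Basis" for j using that s by (auto simp: Bas cax)
    from lborel_affine_euclidean[of c 0, OF this] show ?thesis unfolding T P by simp
  qed
  have "density lborel (\<lambda>_. ennreal (1 / ?p)) =
      density (density (distr lborel borel ?T) (\<lambda>_. ennreal ?p)) (\<lambda>_. ennreal (1 / ?p))"
    using eq by simp
  also have "\<dots> = density (distr lborel borel ?T) (\<lambda>_. ennreal ?p * ennreal (1 / ?p))"
    by (rule density_density_eq) auto
  also have "ennreal ?p * ennreal (1 / ?p) = 1"
    using recip[OF p] .
  finally show ?thesis by (simp add: density_1)
qed

lemma measurable_sqnorm [measurable]:
  "(\<lambda>x::real^'n. sqnorm_wrt V (x - v)) \<in> borel_measurable borel"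
  by (intro borel_measurable_continuous_onI continuous_intros)

text \<open>The norm belonging to \<open>A ** V ** transpose A\<close> takes at
  \<open>A *v x\<close> the value of the norm belonging to \<open>V\<close> at \<open>x\<close>, so
  an affine map changes the profile \<open>h\<close> by the Jacobian factor only.\<close>

lemma distr_elliptic_density:
  fixes A V :: "real^'n^'n" and h :: "real \<Rightarrow> ennreal"
  assumes V: "V \<in> spd" and A: "invertible A" and [measurable]: "h \<in> borel_measurable borel"
    and k: "distr lborel borel (\<lambda>x. v + A *v x) = density lborel (\<lambda>_. ennreal k)"
  shows "distr (density lborel (\<lambda>x. h (sqnorm_wrt V x))) borel (\<lambda>x. v + A *v x) =
    density lborel (\<lambda>x. ennreal k * h (sqnorm_wrt (A ** V ** transpose A) (x - v)))"
proof -
  let ?T = "\<lambda>x. v + A *v x"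
  let ?g = "\<lambda>x. h (sqnorm_wrt (A ** V ** transpose A) (x - v))"
  have gT: "?g (?T x) = h (sqnorm_wrt V x)" for x
    by (simp add: sqnorm_congruence[OF V A] matrix_inv_vector_cancel[OF A])
  have "distr (density lborel (\<lambda>x. h (sqnorm_wrt V x))) borel ?T =
      distr (density lborel (\<lambda>x. ?g (?T x))) borel ?T"
    unfolding gT ..
  also have "\<dots> = density (distr lborel borel ?T) ?g"
    using measurable_affine[of v A] by (subst density_distr) auto
  also have "\<dots> = density lborel (\<lambda>x. ennreal k * ?g x)"
    unfolding k by (rule density_density_eq) auto
  finally show ?thesis .
qed

text \<open>The set where the functions differ is open, and a nonempty open set is not null.\<close>

lemma continuous_AE_eq:
  fixes f g :: "real^'n \<Rightarrow> ennreal"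
  assumes f: "continuous_on UNIV f" and g: "continuous_on UNIV g" and eq: "AE x in lborel. f x = g x"
  shows "f x = g x"
proof (rule ccontr)
  assume "f x \<noteq> g x"
  have op: "open {x. f x \<noteq> g x}" by (rule open_Collect_neq[OF f g])
  moreover have "{x. f x \<noteq> g x} \<noteq> {}" using \<open>f x \<noteq> g x\<close> by blast
  ultimately have "\<not> negligible {x. f x \<noteq> g x}" by (rule open_not_negligible)
  moreover have "{x. f x \<noteq> g x} \<in> null_sets lborel"
    using eq op AE_iff_null_sets[of "{x. f x \<noteq> g x}" lborel] by simp
  ultimately show False
    by (simp add: negligible_iff_null_sets null_sets_completionI)
qed

lemma elliptic_density_eqD:
  fixes V :: "real^'n^'n" and h k :: "real \<Rightarrow> ennreal"
  assumes V: "V \<in> spd" and h: "continuous_on UNIV h" and k: "continuous_on UNIV k"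
    and eq: "density lborel (\<lambda>x. h (sqnorm_wrt V x)) = density lborel (\<lambda>x. k (sqnorm_wrt V x))"
    and r: "0 \<le> r"
  shows "h r = k r"
proof -
  have c: "continuous_on UNIV (\<lambda>x. h (sqnorm_wrt V x))" "continuous_on UNIV (\<lambda>x. k (sqnorm_wrt V x))"
    by (intro continuous_on_compose2[OF h] continuous_on_compose2[OF k] continuous_intros; simp)+
  have "AE x in lborel. h (sqnorm_wrt V x) = k (sqnorm_wrt V x)"
    using borel_measurable_continuous_onI[OF c(1)] borel_measurable_continuous_onI[OF c(2)] eq
    by (intro sigma_finite_measure.density_unique[OF sigma_finite_lborel]) auto
  then have "h (sqnorm_wrt V x) = k (sqnorm_wrt V x)" for x
    using continuous_AE_eq[OF c] by blast
  with sqnorm_surj[OF V r] show ?thesis by metis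
qed

section \<open>First and second moments\<close>

lemma has_mean_affine:
  fixes A :: "real^'n^'n"
  assumes M: "prob_space M" "sets M = sets borel" and mean: "has_mean M 0"
  shows "has_mean (distr M borel (\<lambda>x. v + A *v x)) v"
proof -
  interpret prob_space M by fact
  have int: "integrable M (\<lambda>x. x)" and zero: "(\<integral>x. x \<partial>M) = 0" using mean by (auto simp: has_mean_def)
  have bl: "bounded_linear ((*v) A)" by (rule matrix_vector_mul_bounded_linear)
  have mT: "(\<lambda>x. v + A *v x) \<in> borel_measurable M"
    unfolding measurable_cong_sets[OF M(2) refl]
    by (intro borel_measurable_continuous_onI continuous_intros matrix_vector_mult_linear_continuous_on)
  have "(\<integral>x. A *v x \<partial>M) = 0" using integral_bounded_linear[OF bl int] zero by simp
  then show ?thesis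
    using integrable_bounded_linear[OF bl int]
    by (simp add: has_mean_def integrable_distr_eq[OF mT] integral_distr[OF mT] prob_space)
qed

lemma has_covariance_affine:
  fixes A :: "real^'n^'n"
  assumes M: "sets M = sets borel" and cov: "has_covariance M 0 V"
  shows "has_covariance (distr M borel (\<lambda>x. v + A *v x)) v (A ** V ** transpose A)"
proof -
  have mT: "(\<lambda>x. v + A *v x) \<in> borel_measurable M"
    unfolding measurable_cong_sets[OF M refl]
    by (intro borel_measurable_continuous_onI continuous_intros matrix_vector_mult_linear_continuous_on)
  have mij: "(\<lambda>x::real^'n. (x $ i - v $ i) * (x $ j - v $ j)) \<in> borel_measurable borel" for i j
    by (intro borel_measurable_continuous_onI continuous_intros)
  have I: "integrable M (\<lambda>x. x $ k * x $ l)" "(\<integral>x. x $ k * x $ l \<partial>M) = V $ k $ l" for k l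
    using cov by (auto simp: has_covariance_def)
  have eq: "((v + A *v x) $ i - v $ i) * ((v + A *v x) $ j - v $ j) =
      (\<Sum>k\<in>UNIV. \<Sum>l\<in>UNIV. A $ i $ k * A $ j $ l * (x $ k * x $ l))" for x i j
    by (simp add: matrix_vector_mult_def sum_product mult_ac)
  have "(A ** V ** transpose A) $ i $ j = (\<Sum>k\<in>UNIV. \<Sum>l\<in>UNIV. A $ i $ k * A $ j $ l * V $ k $ l)" for i j
  proof -
    have "(A ** V ** transpose A) $ i $ j = (\<Sum>l\<in>UNIV. \<Sum>k\<in>UNIV. A $ i $ k * A $ j $ l * V $ k $ l)"
      by (simp add: matrix_matrix_mult_def transpose_def sum_distrib_left sum_distrib_right mult_ac)
    also have "\<dots> = (\<Sum>k\<in>UNIV. \<Sum>l\<in>UNIV. A $ i $ k * A $ j $ l * V $ k $ l)"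
      by (rule sum.swap)
    finally show ?thesis .
  qed
  then show ?thesis
    unfolding has_covariance_def integrable_distr_eq[OF mT mij] integral_distr[OF mT mij] eq
    by (simp add: I)
qed

lemma second_moments:
  fixes M :: "(real^'n) measure"
  assumes M: "prob_space M" and mean: "has_mean M v" and cov: "has_covariance M v V"
  shows "integrable M (\<lambda>x. x $ i)" "(\<integral>x. x $ i \<partial>M) = v $ i"
    "integrable M (\<lambda>x. x $ i * x $ j)" "(\<integral>x. x $ i * x $ j \<partial>M) = V $ i $ j + v $ i * v $ j"
proof -
  interpret prob_space M by fact
  have int: "integrable M (\<lambda>x. x)" and v: "(\<integral>x. x \<partial>M) = v" using mean by (auto simp: has_mean_def)
  have i: "integrable M (\<lambda>x. x $ k)" "(\<integral>x. x $ k \<partial>M) = v $ k" for k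
    using integrable_bounded_linear[OF bounded_linear_vec_nth int, of k]
      integral_bounded_linear[OF bounded_linear_vec_nth int, of k] v by auto
  then show "integrable M (\<lambda>x. x $ i)" "(\<integral>x. x $ i \<partial>M) = v $ i" by auto
  have c: "integrable M (\<lambda>x. (x $ i - v $ i) * (x $ j - v $ j))"
    "(\<integral>x. (x $ i - v $ i) * (x $ j - v $ j) \<partial>M) = V $ i $ j"
    using cov by (auto simp: has_covariance_def)
  have eq: "(\<lambda>x. x $ i * x $ j) =
      (\<lambda>x. (x $ i - v $ i) * (x $ j - v $ j) + v $ i * x $ j + v $ j * x $ i - v $ i * v $ j)"
    by (simp add: fun_eq_iff algebra_simps)
  show "integrable M (\<lambda>x. x $ i * x $ j)" by (subst eq) (use c i in simp)
  show "(\<integral>x. x $ i * x $ j \<partial>M) = V $ i $ j + v $ i * v $ j" by (subst eq) (use c i in \<open>simp add: prob_space\<close>)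
qed

lemma covariance_in_P2:
  fixes M :: "(real^'n) measure"
  assumes M: "prob_space M" "sets M = sets borel" and "has_mean M v" "has_covariance M v V"
  shows "M \<in> P2"
proof -
  have "(norm x)\<^sup>2 = (\<Sum>i\<in>UNIV. x $ i * x $ i)" for x :: "real^'n"
    unfolding power2_norm_eq_inner inner_vec_def by simp
  then show ?thesis using second_moments(3)[OF M(1) assms(3,4)] M by (simp add: P2_def)
qed

context deformation
begin

text \<open>Monotonicity of \<open>exp_phi\<close> makes \<open>(f1 - f2) * (\<tau>1 - \<tau>2)\<close> nonnegative, where \<open>\<tau>i\<close> is the
  argument of \<open>exp_phi\<close> in \<open>fi\<close>; as \<open>\<tau>1 - \<tau>2\<close> is affine in \<open>sqnorm_wrt\<close>, its integral is
  determined by mass and covariance, hence zero.\<close>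

lemma elliptic_density_unique:
  fixes V :: "real^'n^'n"
  defines "f l c \<equiv> \<lambda>v x. exp_phi \<phi> (l - c * sqnorm_wrt V (x - v))"
  assumes V: "V \<in> spd" and l1: "ereal l1 < L_phi \<phi>" "0 < c1" and l2: "ereal l2 < L_phi \<phi>" "0 < c2"
    and d1: "prob_density_mean_cov (f l1 c1 v) v V" and d2: "prob_density_mean_cov (f l2 c2 v) v V"
  shows "density lborel (f l1 c1 v) = density lborel (f l2 c2 v)"
proof -
  let ?Q = "\<lambda>x. sqnorm_wrt V (x - v)"
  let ?W = "matrix_inv V"
  have Q_eq: "?Q x = (\<Sum>i\<in>UNIV. \<Sum>j\<in>UNIV. ?W $ i $ j * ((x $ i - v $ i) * (x $ j - v $ j)))" for x
    by (simp add: sqnorm_wrt_def inner_vec_def matrix_vector_mult_def sum_distrib_left mult_ac)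
  \<comment> \<open>The expectation of \<open>?Q\<close> under any measure with mean
    \<open>v\<close> and covariance \<open>V\<close>, hence the same for both densities.\<close>
  define q where "q = (\<Sum>i\<in>UNIV. \<Sum>j\<in>UNIV. ?W $ i $ j * V $ i $ j)"
  have fin: "f l c v x < \<infinity>" if "ereal l < L_phi \<phi>" "0 < c" for l c x
  proof -
    have "l - c * ?Q x \<le> l" using sqnorm_nonneg[OF V, of "x - v"] that by simp
    then have "ereal (l - c * ?Q x) < L_phi \<phi>" using that(1) by (meson ereal_less_eq(3) le_less_trans)
    then show ?thesis unfolding f_def by (rule exp_phi_finite)
  qed
  have mom: "integrable lborel (\<lambda>x. enn2real (f l c v x))" "(\<integral>x. enn2real (f l c v x) \<partial>lborel) = 1"
    "integrable lborel (\<lambda>x. enn2real (f l c v x) * ?Q x)" "(\<integral>x. enn2real (f l c v x) * ?Q x \<partial>lborel) = q"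
    if l: "ereal l < L_phi \<phi>" "0 < c" and d: "prob_density_mean_cov (f l c v) v V" for l c
  proof -
    let ?F = "\<lambda>x. enn2real (f l c v x)" and ?M = "density lborel (f l c v)"
    interpret prob_space ?M using d by (simp add: prob_density_mean_cov_def)
    have mf: "f l c v \<in> borel_measurable lborel" using d by (simp add: prob_density_mean_cov_def)
    then have mF: "?F \<in> borel_measurable lborel" by measurable
    have "f l c v x = ennreal (?F x)" for x using fin[OF l, of x] by (simp add: less_top)
    then have dF: "?M = density lborel (\<lambda>x. ennreal (?F x))" by (metis ext)
    have I: "integrable ?M (\<lambda>x. (x $ i - v $ i) * (x $ j - v $ j))"
      "(\<integral>x. (x $ i - v $ i) * (x $ j - v $ j) \<partial>?M) = V $ i $ j" for i j
      using d by (auto simp: prob_density_mean_cov_def has_covariance_def)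
    have one: "integrable ?M (\<lambda>_. 1::real)" "(\<integral>x. 1 \<partial>?M) = (1::real)" using prob_space by simp_all
    have Q: "integrable ?M ?Q" "(\<integral>x. ?Q x \<partial>?M) = q"
      unfolding Q_eq q_def using I by simp_all
    have mQ: "?Q \<in> borel_measurable lborel" by simp
    show "integrable lborel ?F"
      using one mF unfolding dF by (simp add: integrable_density)
    have "(\<integral>x. ?F x *\<^sub>R 1 \<partial>lborel) = (\<integral>x. (1::real) \<partial>density lborel (\<lambda>x. ennreal (?F x)))"
      using mF by (intro integral_density[symmetric]) auto
    then show "(\<integral>x. ?F x \<partial>lborel) = 1"
      unfolding dF[symmetric] one(2) by simp
    show "integrable lborel (\<lambda>x. ?F x * ?Q x)" "(\<integral>x. ?F x * ?Q x \<partial>lborel) = q"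
      using Q mF mQ unfolding dF
      by (simp_all add: integrable_density integral_density)
  qed
  note m1 = mom[OF l1 d1] and m2 = mom[OF l2 d2]
  let ?F1 = "\<lambda>x. enn2real (f l1 c1 v x)" and ?F2 = "\<lambda>x. enn2real (f l2 c2 v x)"
  let ?\<tau>1 = "\<lambda>x. l1 - c1 * ?Q x" and ?\<tau>2 = "\<lambda>x. l2 - c2 * ?Q x"
  let ?g = "\<lambda>x. (?F1 x - ?F2 x) * (?\<tau>1 x - ?\<tau>2 x)"
  have g_eq: "?g = (\<lambda>x. (l1 - l2) * ?F1 x - (l1 - l2) * ?F2 x - (c1 - c2) * (?F1 x * ?Q x) + (c1 - c2) * (?F2 x * ?Q x))"
    by (simp add: fun_eq_iff algebra_simps)
  have g_int: "integrable lborel ?g" unfolding g_eq using m1 m2 by simp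
  have g_zero: "(\<integral>x. ?g x \<partial>lborel) = 0" unfolding g_eq using m1 m2 by simp
  have mono: "enn2real (exp_phi \<phi> \<sigma>) \<le> enn2real (exp_phi \<phi> \<tau>)"
    if "\<sigma> \<le> \<tau>" "exp_phi \<phi> \<tau> < \<infinity>" for \<sigma> \<tau>
    using mono_exp_phi[OF that(1)] that(2) by (intro enn2real_mono) auto
  have g_nonneg: "0 \<le> ?g x" for x
  proof (cases "?\<tau>1 x \<le> ?\<tau>2 x")
    case True
    then have "?F1 x \<le> ?F2 x" using mono[OF True] fin[OF l2, of x] by (simp add: f_def)
    with True show ?thesis by (intro mult_nonpos_nonpos) auto
  next
    case False
    then have "?F2 x \<le> ?F1 x" using mono[of "?\<tau>2 x" "?\<tau>1 x"] fin[OF l1, of x] by (simp add: f_def)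
    with False show ?thesis by (intro mult_nonneg_nonneg) auto
  qed
  have "AE x in lborel. ?g x = 0"
    using g_zero integral_nonneg_eq_0_iff_AE[OF g_int] g_nonneg by simp
  then have "AE x in lborel. f l1 c1 v x = f l2 c2 v x"
  proof (rule AE_mp, intro AE_I2 impI)
    fix x assume "?g x = 0"
    \<comment> \<open>If it is the second factor of \<open>?g\<close> that vanishes, the arguments
      of \<open>exp_phi\<close> agree, and so do its values.\<close>
    then have "?F1 x = ?F2 x" by (auto simp: f_def)
    then show "f l1 c1 v x = f l2 c2 v x"
      using fin[OF l1, of x] fin[OF l2, of x] by (metis ennreal_enn2real infinity_ennreal_def)
  qed
  then show ?thesis using d1 d2 by (intro density_cong) (auto simp: prob_density_mean_cov_def)
qed

end

section \<open>Affine images of a standardized law\<close>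

locale white =
  fixes Z :: "(real^'n) measure"
  assumes prob: "prob_space Z" and sets_Z: "sets Z = sets borel"
    and mean: "has_mean Z 0" and cov: "has_covariance Z 0 (mat 1)"
begin

text \<open>\<open>A\<close> may be singular, so degenerate limits are of this form too.\<close>

definition law :: "real^'n \<Rightarrow> real^'n^'n \<Rightarrow> (real^'n) measure" where
  "law v A = distr Z borel (\<lambda>z. v + A *v z)"

lemma affine_measurable: "(\<lambda>z. v + A *v z) \<in> borel_measurable Z"
  unfolding measurable_cong_sets[OF sets_Z refl] by (rule measurable_affine)

lemma sets_law: "sets (law v A) = sets borel"
  by (simp add: law_def)

lemma prob_law: "prob_space (law v A)"
  unfolding law_def by (rule prob_space.prob_space_distr[OF prob affine_measurable])

lemma mean_law: "has_mean (law v A) v"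
  unfolding law_def using prob sets_Z mean by (rule has_mean_affine)

lemma cov_law: "has_covariance (law v A) v (A ** transpose A)"
  using has_covariance_affine[OF sets_Z cov, of v A] by (simp add: law_def)

lemma law_P2: "law v A \<in> P2"
  by (rule covariance_in_P2[OF prob_law sets_law mean_law cov_law])

text \<open>Identity covariance makes sending \<open>A\<close> to the random vector
  \<open>A *v z\<close> an isometry from the Frobenius norm into L2; this is why matrix norms appear
  in the distance formula.\<close>

lemma inner_moment:
  fixes A B :: "real^'n^'n"
  shows "integrable Z (\<lambda>z. (A *v z) \<bullet> (B *v z))" "(\<integral>z. (A *v z) \<bullet> (B *v z) \<partial>Z) = A \<bullet> B"
proof -
  have I: "integrable Z (\<lambda>x. x $ k * x $ l)" "(\<integral>x. x $ k * x $ l \<partial>Z) = (if k = l then 1 else 0)" for k l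
    using cov by (auto simp: has_covariance_def mat_def)
  have eq: "(A *v z) \<bullet> (B *v z) = (\<Sum>i\<in>UNIV. \<Sum>k\<in>UNIV. \<Sum>l\<in>UNIV. A $ i $ k * B $ i $ l * (z $ k * z $ l))" for z
    by (simp add: inner_vec_def matrix_vector_mult_def sum_product mult_ac)
  show "integrable Z (\<lambda>z. (A *v z) \<bullet> (B *v z))" unfolding eq using I by simp
  show "(\<integral>z. (A *v z) \<bullet> (B *v z) \<partial>Z) = A \<bullet> B"
    unfolding eq by (simp add: I inner_matrix if_distrib cong: if_cong)
qed

lemma norm_moment:
  fixes A :: "real^'n^'n"
  shows "integrable Z (\<lambda>z. (norm (A *v z))\<^sup>2)" "(\<integral>z. (norm (A *v z))\<^sup>2 \<partial>Z) = (norm A)\<^sup>2"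
  unfolding power2_norm_eq_inner by (rule inner_moment)+

lemma linear_moment:
  fixes A :: "real^'n^'n"
  shows "integrable Z (\<lambda>z. w \<bullet> (A *v z))" "(\<integral>z. w \<bullet> (A *v z) \<partial>Z) = 0"
proof -
  have bl: "bounded_linear (\<lambda>z. w \<bullet> (A *v z))"
    by (intro bounded_linear_compose[OF bounded_linear_inner_right matrix_vector_mul_bounded_linear])
  have int: "integrable Z (\<lambda>x. x)" and zero: "(\<integral>x. x \<partial>Z) = 0" using mean by (auto simp: has_mean_def)
  show "integrable Z (\<lambda>z. w \<bullet> (A *v z))" by (rule integrable_bounded_linear[OF bl int])
  show "(\<integral>z. w \<bullet> (A *v z) \<partial>Z) = 0" using integral_bounded_linear[OF bl int] zero by simp
qed

text \<open>Couple the two laws through the same sample \<open>z\<close>.\<close>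

lemma W2_law_le: "W2 (law v A) (law w B) \<le> sqrt ((norm (v - w))\<^sup>2 + (norm (A - B))\<^sup>2)"
proof -
  interpret prob_space Z by (rule prob)
  have c: "distr Z borel (\<lambda>z. (v + A *v z, w + B *v z)) \<in> couplings (law v A) (law w B)"
    unfolding law_def by (rule distr_pair_coupling(1)[OF prob affine_measurable affine_measurable])
  have eq: "(norm ((v + A *v z) - (w + B *v z)))\<^sup>2 =
      (norm (v - w))\<^sup>2 + 2 * ((v - w) \<bullet> ((A - B) *v z)) + (norm ((A - B) *v z))\<^sup>2" for z
  proof -
    have "(v + A *v z) - (w + B *v z) = (v - w) + (A - B) *v z"
      by (simp add: matrix_vector_mult_diff_rdistrib)
    moreover have "(norm (a + b))\<^sup>2 = (norm a)\<^sup>2 + 2 * (a \<bullet> b) + (norm b)\<^sup>2" for a b :: "real^'n"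
      unfolding power2_norm_eq_inner by (simp add: inner_add_left inner_add_right inner_commute)
    ultimately show ?thesis by (simp only:)
  qed
  have "(\<integral>z. (norm ((v + A *v z) - (w + B *v z)))\<^sup>2 \<partial>Z) = (norm (v - w))\<^sup>2 + (norm (A - B))\<^sup>2"
    unfolding eq using norm_moment[of "A - B"] linear_moment[of "v - w" "A - B"] by (simp add: prob_space)
  then have "(\<integral>z. (norm (fst z - snd z))\<^sup>2 \<partial>distr Z borel (\<lambda>z. (v + A *v z, w + B *v z))) =
      (norm (v - w))\<^sup>2 + (norm (A - B))\<^sup>2"
    by (subst distr_pair_coupling(2)[OF prob affine_measurable affine_measurable])
  then show ?thesis by (intro W2_le[OF c]) auto
qed

text \<open>The lower bound is Kantorovich duality: every coupling costs at least the sum of the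
  integrals of \<open>F\<close> and \<open>G\<close>, which depend on the marginals only and fall
  short of \<open>?D\<close> by at most \<open>e\<close>.\<close>

lemma W2_law:
  assumes BA: "psd (transpose B ** A)"
  shows "W2 (law v A) (law w B) = sqrt ((norm (v - w))\<^sup>2 + (norm (A - B))\<^sup>2)"
proof (rule antisym[OF W2_law_le])
  interpret prob_space Z by (rule prob)
  let ?D = "(norm (v - w))\<^sup>2 + (norm (A - B))\<^sup>2"
  show "sqrt ?D \<le> W2 (law v A) (law w B)"
  proof (rule W2_ge[OF law_P2 law_P2])
    fix \<pi> assume \<pi>: "\<pi> \<in> couplings (law v A) (law w B)"
    let ?c = "\<integral>z. (norm (fst z - snd z))\<^sup>2 \<partial>\<pi>"
    have "?D \<le> ?c + e" if e: "0 < e" for e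
    proof -
      obtain U W :: "real^'n^'n" where UW: "transpose U ** W = mat 1"
        and le: "(norm (U ** A))\<^sup>2 + (norm (W ** B))\<^sup>2 \<le> 2 * (A \<bullet> B + e / 2)"
        using quadratic_potentials[OF BA, of "e / 2"] e by auto
      \<comment> \<open>Expand the squared norm of \<open>x - y\<close> around \<open>v\<close> and
        \<open>w\<close>. Linear and square terms split between \<open>F\<close> and
        \<open>G\<close>; the mixed term is bounded by the squares with \<open>U\<close> and
        \<open>W\<close>.\<close>
      define F where "F x = (norm (v - w))\<^sup>2 + 2 * ((v - w) \<bullet> (x - v)) + (norm (x - v))\<^sup>2 - (norm (U *v (x - v)))\<^sup>2" for x
      define G where "G y = (norm (y - w))\<^sup>2 - 2 * ((v - w) \<bullet> (y - w)) - (norm (W *v (y - w)))\<^sup>2" for y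
      have mF: "F \<in> borel_measurable borel" and mG: "G \<in> borel_measurable borel"
        unfolding F_def G_def
        by (intro borel_measurable_continuous_onI continuous_intros
            bounded_linear.continuous_on[OF matrix_vector_mul_bounded_linear])+
      have FZ: "F (v + A *v z) = (norm (v - w))\<^sup>2 + 2 * ((v - w) \<bullet> (A *v z)) + (norm (A *v z))\<^sup>2 - (norm ((U ** A) *v z))\<^sup>2" for z
        by (simp add: F_def matrix_vector_mul_assoc)
      have GZ: "G (w + B *v z) = (norm (B *v z))\<^sup>2 - 2 * ((v - w) \<bullet> (B *v z)) - (norm ((W ** B) *v z))\<^sup>2" for z
        by (simp add: G_def matrix_vector_mul_assoc)
      have F: "integrable (law v A) F" "(\<integral>x. F x \<partial>law v A) = (norm (v - w))\<^sup>2 + (norm A)\<^sup>2 - (norm (U ** A))\<^sup>2"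
        unfolding law_def integrable_distr_eq[OF affine_measurable mF] integral_distr[OF affine_measurable mF] FZ
        using norm_moment[of A] norm_moment[of "U ** A"] linear_moment[of "v - w" A] by (simp_all add: prob_space)
      have G: "integrable (law w B) G" "(\<integral>x. G x \<partial>law w B) = (norm B)\<^sup>2 - (norm (W ** B))\<^sup>2"
        unfolding law_def integrable_distr_eq[OF affine_measurable mG] integral_distr[OF affine_measurable mG] GZ
        using norm_moment[of B] norm_moment[of "W ** B"] linear_moment[of "v - w" B] by simp_all
      note cF = coupling_integrals[OF \<pi> mF] and cG = coupling_integrals[OF \<pi> mG]
      have pt: "F x + G y \<le> (norm (x - y))\<^sup>2" for x y
      proof -
        define X Y where "X = x - v" and "Y = y - w"
        have "(U *v X) \<bullet> (W *v Y) = X \<bullet> Y"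
          using dot_matrix_transpose[of X "transpose U" "W *v Y"] UW by (simp add: matrix_vector_mul_assoc)
        moreover have "0 \<le> (norm (U *v X - W *v Y))\<^sup>2" by simp
        then have "2 * ((U *v X) \<bullet> (W *v Y)) \<le> (norm (U *v X))\<^sup>2 + (norm (W *v Y))\<^sup>2"
          unfolding power2_norm_eq_inner by (simp add: inner_diff_left inner_diff_right inner_commute)
        moreover have "(norm (x - y))\<^sup>2 = (norm (v - w))\<^sup>2 + 2 * ((v - w) \<bullet> X) - 2 * ((v - w) \<bullet> Y) +
            (norm X)\<^sup>2 + (norm Y)\<^sup>2 - 2 * (X \<bullet> Y)"
        proof -
          have "x - y = (v - w) + X - Y" by (simp add: X_def Y_def)
          then show ?thesis unfolding power2_norm_eq_inner
            by (simp add: inner_add_left inner_add_right inner_diff_left inner_diff_right inner_commute)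
        qed
        ultimately show ?thesis unfolding F_def G_def X_def[symmetric] Y_def[symmetric] by linarith
      qed
      have "(norm (v - w))\<^sup>2 + (norm A)\<^sup>2 - (norm (U ** A))\<^sup>2 + ((norm B)\<^sup>2 - (norm (W ** B))\<^sup>2) =
          (\<integral>z. F (fst z) + G (snd z) \<partial>\<pi>)"
        using cF cG F G by simp
      also have "\<dots> \<le> ?c"
        using cF cG F G pt integrable_cost[OF \<pi> law_P2 law_P2] by (intro integral_mono) auto
      finally have "(norm (v - w))\<^sup>2 + (norm A)\<^sup>2 + (norm B)\<^sup>2 - 2 * (A \<bullet> B) \<le> ?c + e" using le by simp
      also have "(norm (v - w))\<^sup>2 + (norm A)\<^sup>2 + (norm B)\<^sup>2 - 2 * (A \<bullet> B) = ?D"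
        unfolding power2_norm_eq_inner by (simp add: inner_diff_left inner_diff_right inner_commute)
      finally show ?thesis .
    qed
    then have "?D \<le> ?c" by (rule field_le_epsilon)
    then show "sqrt ?D \<le> sqrt ?c" by simp
  qed
qed

text \<open>The product is a nonnegative combination of \<open>transpose A ** A\<close>,
  \<open>transpose B ** B\<close> and \<open>transpose B ** A\<close>, symmetry of the last one
  merging the two mixed terms. Hence the distance formula holds between any two points of the
  segment, which gives constant speed.\<close>

lemma psd_geodesic_points:
  fixes A B :: "real^'n^'n"
  assumes BA: "psd (transpose B ** A)" and s: "0 \<le> s" "s \<le> 1" and t: "0 \<le> t" "t \<le> 1"
  shows "psd (transpose ((1 - t) *\<^sub>R A + t *\<^sub>R B) ** ((1 - s) *\<^sub>R A + s *\<^sub>R B))"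
proof -
  have AB: "transpose A ** B = transpose B ** A"
    using BA by (simp add: psd_def matrix_transpose_mul)
  have eq: "transpose ((1 - t) *\<^sub>R A + t *\<^sub>R B) ** ((1 - s) *\<^sub>R A + s *\<^sub>R B) =
      ((1 - t) * (1 - s)) *\<^sub>R (transpose A ** A) + (t * s) *\<^sub>R (transpose B ** B) +
      ((1 - t) * s + t * (1 - s)) *\<^sub>R (transpose B ** A)"
    by (simp add: transpose_add transpose_scaleR matrix_add_ldistrib matrix_add_rdistrib
        matrix_scaleR_left matrix_scaleR_right AB scaleR_left_distrib scaleR_right_distrib
        mult.commute add_ac)
  have gram: "psd (transpose C ** C)" for C :: "real^'n^'n"
  proof -
    have "x \<bullet> ((transpose C ** C) *v x) = (C *v x) \<bullet> (C *v x)" for x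
      using dot_matrix_transpose[of x "transpose C" "C *v x"] by (simp add: matrix_vector_mul_assoc)
    then show ?thesis by (simp add: psd_def matrix_transpose_mul)
  qed
  have scale: "psd (c *\<^sub>R C)" if "0 \<le> c" "psd C" for c and C :: "real^'n^'n"
    using that by (simp add: psd_def transpose_scaleR scaleR_matrix_vector_assoc[symmetric])
  show ?thesis
    unfolding eq using s t by (intro psd_add scale gram BA mult_nonneg_nonneg add_nonneg_nonneg) auto
qed

lemma W2_geodesic_law:
  fixes A B :: "real^'n^'n"
  assumes BA: "psd (transpose B ** A)"
  shows "W2_geodesic (\<lambda>t. law ((1 - t) *\<^sub>R v + t *\<^sub>R w) ((1 - t) *\<^sub>R A + t *\<^sub>R B))"
  unfolding W2_geodesic_def
proof (intro conjI ballI law_P2)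
  fix s t :: real assume s: "s \<in> {0..1}" and t: "t \<in> {0..1}"
  let ?g = "\<lambda>t. law ((1 - t) *\<^sub>R v + t *\<^sub>R w) ((1 - t) *\<^sub>R A + t *\<^sub>R B)"
  have d: "W2 (?g s) (?g t) = \<bar>s - t\<bar> * sqrt ((norm (v - w))\<^sup>2 + (norm (A - B))\<^sup>2)"
    if s: "0 \<le> s" "s \<le> 1" and t: "0 \<le> t" "t \<le> 1" for s t
  proof -
    have "((1 - s) *\<^sub>R v + s *\<^sub>R w) - ((1 - t) *\<^sub>R v + t *\<^sub>R w) = (t - s) *\<^sub>R (v - w)"
      "((1 - s) *\<^sub>R A + s *\<^sub>R B) - ((1 - t) *\<^sub>R A + t *\<^sub>R B) = (t - s) *\<^sub>R (A - B)"
      by (simp_all add: algebra_simps)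
    then have "W2 (?g s) (?g t) = sqrt ((norm ((t - s) *\<^sub>R (v - w)))\<^sup>2 + (norm ((t - s) *\<^sub>R (A - B)))\<^sup>2)"
      using W2_law[OF psd_geodesic_points[OF BA s t]] by simp
    also have "\<dots> = sqrt ((t - s)\<^sup>2 * ((norm (v - w))\<^sup>2 + (norm (A - B))\<^sup>2))"
      by (simp add: power_mult_distrib distrib_left)
    also have "\<dots> = \<bar>s - t\<bar> * sqrt ((norm (v - w))\<^sup>2 + (norm (A - B))\<^sup>2)"
      by (simp add: real_sqrt_mult abs_minus_commute)
    finally show ?thesis .
  qed
  show "W2 (?g s) (?g t) = \<bar>s - t\<bar> * W2 (?g 0) (?g 1)"
    using d[of s t] d[of 0 1] s t by simp
qed

end

section \<open>Members of the closure\<close>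

text \<open>Writing the inverse through determinants makes inversion continuous entry by
  entry.\<close>

lemma matrix_inv_cramer:
  fixes A :: "real^'n^'n"
  assumes A: "invertible A"
  shows "matrix_inv A *v b = (\<chi> k. det (\<chi> i j. if j = k then b $ i else A $ i $ j) / det A)"
  using cramer[of A "matrix_inv A *v b" b] A
  by (simp add: invertible_det_nz matrix_inv_vector_cancel(1)[OF A])

lemma tendsto_det:
  fixes A :: "'a \<Rightarrow> real^'n^'n"
  assumes "\<And>i j. ((\<lambda>x. A x $ i $ j) \<longlongrightarrow> B $ i $ j) F"
  shows "((\<lambda>x. det (A x)) \<longlongrightarrow> det B) F"
  unfolding det_def by (intro tendsto_intros assms)

lemma tendsto_sqnorm:
  fixes V :: "real^'n^'n"
  assumes V: "\<And>n. W n \<in> spd" "V \<in> spd" and lim: "W \<longlonglongrightarrow> V" "x \<longlonglongrightarrow> y"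
  shows "(\<lambda>n. sqnorm_wrt (W n) (x n)) \<longlonglongrightarrow> sqnorm_wrt V y"
proof -
  note inv = spd_invertible[OF V(1)] spd_invertible[OF V(2)]
  have d: "det V \<noteq> 0" using inv by (simp add: invertible_det_nz)
  have c: "(\<lambda>n. W n $ i $ j) \<longlonglongrightarrow> V $ i $ j" for i j by (intro tendsto_vec_nth lim)
  have "(\<lambda>n. matrix_inv (W n) *v x n) \<longlonglongrightarrow> matrix_inv V *v y"
    unfolding matrix_inv_cramer[OF inv(1)] matrix_inv_cramer[OF inv(2)]
  proof (rule vec_tendstoI, simp, intro tendsto_divide tendsto_det c d)
    fix i k j
    show "(\<lambda>n. (\<chi> i j. if j = k then x n $ i else W n $ i $ j) $ i $ j) \<longlonglongrightarrow>
        (\<chi> i j. if j = k then y $ i else V $ i $ j) $ i $ j"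
      using c[of i j] tendsto_vec_nth[OF lim(2), of i] by simp
  qed
  then show ?thesis unfolding sqnorm_wrt_def by (intro tendsto_inner lim)
qed

lemma subset_W2_closure:
  fixes \<mu> :: "(real^'n) measure"
  assumes A: "A \<subseteq> P2" and \<mu>: "\<mu> \<in> A"
  shows "\<mu> \<in> W2_closure A"
proof -
  have \<mu>2: "\<mu> \<in> P2" using A \<mu> by blast
  have id: "(\<lambda>x. x) \<in> borel_measurable \<mu>" by (rule measurable_P2[OF \<mu>2]) simp
  have "distr \<mu> borel (\<lambda>x. x) = \<mu>" using P2D(1)[OF \<mu>2] by (simp add: distr_id2)
  then have c: "distr \<mu> borel (\<lambda>x. (x, x)) \<in> couplings \<mu> \<mu>"
    using distr_pair_coupling(1)[OF P2D(2)[OF \<mu>2] id id] by simp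
  have "W2 \<mu> \<mu> \<le> 0"
    using distr_pair_coupling(2)[OF P2D(2)[OF \<mu>2] id id] by (intro W2_le[OF c]) simp_all
  then show ?thesis unfolding W2_closure_def using \<mu> \<mu>2 by (auto intro!: bexI[of _ \<mu>])
qed

section \<open>The family with its normalizing functions, and its closure at nonsingular
  covariance\<close>

locale normalized = deformation \<phi> for \<phi> :: "real \<Rightarrow> real" +
  fixes lam c :: "real^'n^'n \<Rightarrow> real"
  assumes normalizing: "normalizing_functions \<phi> lam c"
begin

abbreviation N :: "real^'n \<Rightarrow> real^'n^'n \<Rightarrow> (real^'n) measure" where
  "N \<equiv> N_phi \<phi> lam c"

definition profile :: "real^'n^'n \<Rightarrow> real \<Rightarrow> ennreal" where
  "profile V r = exp_phi \<phi> (lam V - c V * r)"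

lemma N_eq: "N v V = density lborel (\<lambda>x. profile V (sqnorm_wrt V (x - v)))"
  by (simp add: N_phi_def n_phi_def[abs_def] profile_def)

lemma N_density:
  "V \<in> spd \<Longrightarrow> prob_density_mean_cov (\<lambda>x. profile V (sqnorm_wrt V (x - v))) v V"
  using normalizing by (simp add: normalizing_functions_def n_phi_def[abs_def] profile_def)

lemma lam_c:
  assumes "V \<in> spd"
  shows "l_phi \<phi> < ereal (lam V)" "ereal (lam V) < L_phi \<phi>" "0 < c V"
  using normalizing assms by (auto simp: normalizing_functions_def)

lemma N_props:
  assumes "V \<in> spd"
  shows "prob_space (N v V)" "sets (N v V) = sets borel" "has_mean (N v V) v" "has_covariance (N v V) v V"
  using N_density[OF assms, of v] by (auto simp: prob_density_mean_cov_def N_eq)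

lemma N_P2: "V \<in> spd \<Longrightarrow> N v V \<in> P2"
  using covariance_in_P2 N_props by metis

lemma N_space_P2: "N_space \<phi> lam c \<subseteq> P2"
  by (auto simp: N_space_def N_P2)

lemma continuous_profile: "continuous_on UNIV (profile V)"
  unfolding profile_def[abs_def]
  by (intro continuous_on_compose2[OF continuous_on_exp_phi] continuous_intros) simp

lemma measurable_profile [measurable]: "profile V \<in> borel_measurable borel"
  using continuous_profile by (rule borel_measurable_continuous_onI)

lemma profile_finite:
  assumes "V \<in> spd" "0 \<le> r"
  shows "profile V r < \<infinity>"
proof -
  have "lam V - c V * r \<le> lam V" using lam_c(3)[OF assms(1)] assms(2) by simp
  then have "ereal (lam V - c V * r) < L_phi \<phi>"
    using lam_c(2)[OF assms(1)] by (meson ereal_less_eq(3) le_less_trans)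
  then show ?thesis unfolding profile_def by (rule exp_phi_finite)
qed

text \<open>If the Jacobian factor can be absorbed into the argument of \<open>exp_phi\<close>, the
  image has an elliptic density of the right type with known moments, and uniqueness replaces
  \<open>l\<close> and \<open>b\<close> by the parameters of the family. This serves maps of
  determinant 1 for every \<phi>, and all invertible maps for powers.\<close>

lemma distr_N_eq:
  fixes A V :: "real^'n^'n"
  assumes V: "V \<in> spd" and A: "invertible A"
    and k: "distr lborel borel (\<lambda>x. v + A *v x) = density lborel (\<lambda>_. ennreal k)"
    and l: "ereal l < L_phi \<phi>" "0 < b"
    and eq: "\<And>r. ennreal k * profile V r = exp_phi \<phi> (l - b * r)"
  shows "distr (N 0 V) borel (\<lambda>x. v + A *v x) = N v (A ** V ** transpose A)"
proof -
  let ?U = "A ** V ** transpose A"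
  have U: "?U \<in> spd" using V A by (rule spd_congruence)
  have "N 0 V = density lborel (\<lambda>x. profile V (sqnorm_wrt V x))" by (simp add: N_eq)
  then have d: "distr (N 0 V) borel (\<lambda>x. v + A *v x) =
      density lborel (\<lambda>x. exp_phi \<phi> (l - b * sqnorm_wrt ?U (x - v)))"
    using distr_elliptic_density[OF V A measurable_profile k] eq by simp
  have "prob_space (distr (N 0 V) borel (\<lambda>x. v + A *v x))"
    using N_props(1,2)[OF V, of 0] measurable_affine[of v A]
    by (intro prob_space.prob_space_distr) (auto simp: measurable_cong_sets[OF N_props(2)[OF V] refl])
  then have "prob_density_mean_cov (\<lambda>x. exp_phi \<phi> (l - b * sqnorm_wrt ?U (x - v))) v ?U"
    using has_mean_affine[OF N_props(1-3)[OF V], of v A] has_covariance_affine[OF N_props(2,4)[OF V], of v A]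
    unfolding prob_density_mean_cov_def d by simp
  then have "density lborel (\<lambda>x. exp_phi \<phi> (l - b * sqnorm_wrt ?U (x - v))) =
      density lborel (\<lambda>x. exp_phi \<phi> (lam ?U - c ?U * sqnorm_wrt ?U (x - v)))"
    using N_density[OF U, of v] unfolding profile_def
    by (intro elliptic_density_unique[OF U l lam_c(2,3)[OF U]])
  then show ?thesis using d by (simp add: N_eq profile_def)
qed

text \<open>Densities converge pointwise, and Fatou's lemma gives one inequality; equality comes
  from using it for \<open>f\<close> and for \<open>1 - f\<close>.\<close>

lemma N_convergence:
  fixes v :: "real^'n" and V :: "real^'n^'n" and f :: "real^'n \<Rightarrow> real"
  assumes V: "\<And>n. Vn n \<in> spd" "V \<in> spd" and lim: "vn \<longlonglongrightarrow> v" "Vn \<longlonglongrightarrow> V"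
    and f: "continuous_on UNIV f" "\<And>x. 0 \<le> f x" "\<And>x. f x \<le> 1"
    and conv: "(\<lambda>n. \<integral>x. f x \<partial>N (vn n) (Vn n)) \<longlonglongrightarrow> a"
  shows "(\<integral>x. f x \<partial>N v V) \<le> a"
proof -
  have mf: "f \<in> borel_measurable borel" using f(1) by (rule borel_measurable_continuous_onI)
  have nn: "(\<integral>\<^sup>+x. profile W (sqnorm_wrt W (x - w)) * ennreal (f x) \<partial>lborel) = ennreal (\<integral>x. f x \<partial>N w W)"
    if W: "W \<in> spd" for w W
  proof -
    have "(\<integral>\<^sup>+x. profile W (sqnorm_wrt W (x - w)) * ennreal (f x) \<partial>lborel) = (\<integral>\<^sup>+x. ennreal (f x) \<partial>N w W)"
      unfolding N_eq using mf by (subst nn_integral_density) auto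
    also have "\<dots> = ennreal (\<integral>x. f x \<partial>N w W)"
      using integrable_P2_bounded[OF N_P2[OF W] f] f by (intro nn_integral_eq_integral) auto
    finally show ?thesis .
  qed
  have pt: "(\<lambda>n. profile (Vn n) (sqnorm_wrt (Vn n) (x - vn n)) * ennreal (f x)) \<longlonglongrightarrow>
      profile V (sqnorm_wrt V (x - v)) * ennreal (f x)" for x
  proof -
    have l: "(\<lambda>n. lam (Vn n)) \<longlonglongrightarrow> lam V" and cc: "(\<lambda>n. c (Vn n)) \<longlonglongrightarrow> c V"
      using normalizing V lim(2) unfolding normalizing_functions_def
      by (auto intro!: continuous_on_tendsto_compose[of spd lam] continuous_on_tendsto_compose[of spd c])
    have "(\<lambda>n. sqnorm_wrt (Vn n) (x - vn n)) \<longlonglongrightarrow> sqnorm_wrt V (x - v)"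
      by (intro tendsto_sqnorm V lim tendsto_intros)
    then have "(\<lambda>n. lam (Vn n) - c (Vn n) * sqnorm_wrt (Vn n) (x - vn n)) \<longlonglongrightarrow> lam V - c V * sqnorm_wrt V (x - v)"
      by (intro tendsto_intros l cc)
    then have "(\<lambda>n. profile (Vn n) (sqnorm_wrt (Vn n) (x - vn n))) \<longlonglongrightarrow> profile V (sqnorm_wrt V (x - v))"
      unfolding profile_def by (intro continuous_on_tendsto_compose[OF continuous_on_exp_phi]) auto
    then show ?thesis using profile_finite[OF V(2) sqnorm_nonneg[OF V(2), of "x - v"]]
      by (intro tendsto_mult_ennreal tendsto_const) auto
  qed
  have "ennreal (\<integral>x. f x \<partial>N v V) = (\<integral>\<^sup>+x. liminf (\<lambda>n. profile (Vn n) (sqnorm_wrt (Vn n) (x - vn n)) * ennreal (f x)) \<partial>lborel)"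
    unfolding nn[OF V(2), symmetric] using lim_imp_Liminf[OF sequentially_bot pt] by simp
  also have "\<dots> \<le> liminf (\<lambda>n. \<integral>\<^sup>+x. profile (Vn n) (sqnorm_wrt (Vn n) (x - vn n)) * ennreal (f x) \<partial>lborel)"
    using mf by (intro nn_integral_liminf) auto
  also have "\<dots> = liminf (\<lambda>n. ennreal (\<integral>x. f x \<partial>N (vn n) (Vn n)))"
    by (simp add: nn V)
  also have "\<dots> = ennreal a"
    by (intro lim_imp_Liminf sequentially_bot tendsto_ennrealI conv)
  finally show ?thesis
    using LIMSEQ_le_const[OF conv, of 0] f(2)
    by (subst (asm) ennreal_le_iff) (auto intro!: exI[of _ 0] Bochner_Integration.integral_nonneg)
qed

text \<open>Means and second moments pass to the limit in \<open>W2\<close>, so the parameters of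
  approximating members converge to \<open>v\<close> and \<open>V\<close>. As \<open>V\<close> is
  nonsingular, the limit stays where the densities depend continuously on them.\<close>

lemma closure_member_eq_N:
  fixes m :: "(real^'n) measure"
  assumes m: "m \<in> W2_closure (N_space \<phi> lam c)" and mean: "has_mean m v" and cov: "has_covariance m v V"
    and V: "V \<in> spd"
  shows "m = N v V"
proof -
  have m2: "m \<in> P2" using m by (simp add: W2_closure_def)
  interpret m: prob_space m using m2 by (rule P2D)
  define r :: "nat \<Rightarrow> real" where "r n = inverse (real (Suc n))" for n
  have r: "0 < r n" "r \<longlonglongrightarrow> 0" for n
    using LIMSEQ_inverse_real_of_nat by (simp_all add: r_def[abs_def])
  have "\<exists>w W. W \<in> spd \<and> W2 m (N w W) < r n" for n
    using m r(1)[of n] unfolding W2_closure_def N_space_def by blast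
  then obtain vn Vn where Vn: "\<And>n. Vn n \<in> spd" and W2n: "\<And>n. W2 m (N (vn n) (Vn n)) < r n" by metis
  note mom = second_moments[OF m.prob_space_axioms mean cov]
  note momn = second_moments[OF N_props(1,3,4)[OF Vn]]
  have v_lim: "vn \<longlonglongrightarrow> v"
  proof (rule vec_tendstoI)
    fix i
    have "\<bar>v $ i - vn n $ i\<bar> \<le> r n" for n
      using W2_lipschitz[OF m2 N_P2[OF Vn] W2n, of "\<lambda>x. x $ i" n 1] mom(1,2)[of i] momn(1,2)[of _ _ i]
        component_le_norm_cart[of _ i] by (simp flip: vector_minus_component)
    then have "(\<lambda>n. v $ i - vn n $ i) \<longlonglongrightarrow> 0"
      by (intro Lim_null_comparison[OF _ r(2)] always_eventually allI) (simp only: real_norm_def)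
    then show "(\<lambda>n. vn n $ i) \<longlonglongrightarrow> v $ i"
      using tendsto_diff[OF tendsto_const[of "v $ i"], of "\<lambda>n. v $ i - vn n $ i" 0] by simp
  qed
  let ?C = "\<integral>x. (norm x)\<^sup>2 \<partial>m"
  have V_lim: "Vn \<longlonglongrightarrow> V"
  proof (intro vec_tendstoI)
    fix i j
    have b: "\<bar>(V $ i $ j + v $ i * v $ j) - (Vn n $ i $ j + vn n $ i * vn n $ j)\<bar> \<le> (r n)\<^sup>2 + r n + r n * ?C" for n
      using W2_second_moment(1)[OF m2 N_P2[OF Vn] W2n, of i j] by (simp add: mom(4) momn(4))
    have "(\<lambda>n. (r n)\<^sup>2 + r n + r n * ?C) \<longlonglongrightarrow> 0\<^sup>2 + 0 + 0 * ?C"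
      by (intro tendsto_intros r)
    then have "(\<lambda>n. (r n)\<^sup>2 + r n + r n * ?C) \<longlonglongrightarrow> 0" by simp
    then have "(\<lambda>n. (V $ i $ j + v $ i * v $ j) - (Vn n $ i $ j + vn n $ i * vn n $ j)) \<longlonglongrightarrow> 0"
      by (rule Lim_null_comparison[rotated]) (intro always_eventually allI, unfold real_norm_def, rule b)
    moreover have "(\<lambda>n. vn n $ i * vn n $ j) \<longlonglongrightarrow> v $ i * v $ j"
      by (intro tendsto_intros v_lim)
    ultimately have "(\<lambda>n. V $ i $ j + v $ i * v $ j - ((V $ i $ j + v $ i * v $ j) - (Vn n $ i $ j + vn n $ i * vn n $ j)) - vn n $ i * vn n $ j)
        \<longlonglongrightarrow> V $ i $ j + v $ i * v $ j - 0 - v $ i * v $ j"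
      by (intro tendsto_intros v_lim)
    then show "(\<lambda>n. Vn n $ i $ j) \<longlonglongrightarrow> V $ i $ j" by simp
  qed
  show ?thesis
  proof (rule measure_eqI_lipschitz)
    fix f :: "real^'n \<Rightarrow> real" and L
    assume f: "continuous_on UNIV f" "0 \<le> L" "\<And>x y. \<bar>f x - f y\<bar> \<le> L * norm (x - y)"
      "\<And>x. 0 \<le> f x" "\<And>x. f x \<le> 1"
    have le: "(\<integral>x. f x \<partial>N v V) \<le> (\<integral>x. f x \<partial>m)"
      if f: "continuous_on UNIV f" "\<And>x y. \<bar>f x - f y\<bar> \<le> L * norm (x - y)"
      "\<And>x. 0 \<le> f x" "\<And>x. f x \<le> 1" for f :: "real^'n \<Rightarrow> real"
    proof (rule N_convergence[OF Vn V v_lim V_lim f(1,3,4)])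
      have "\<bar>(\<integral>x. f x \<partial>m) - (\<integral>x. f x \<partial>N (vn n) (Vn n))\<bar> \<le> L * r n" for n
        using f \<open>0 \<le> L\<close> by (intro W2_lipschitz[OF m2 N_P2[OF Vn] W2n]
            borel_measurable_continuous_onI integrable_P2_bounded m2 N_P2 Vn) auto
      moreover have "(\<lambda>n. L * r n) \<longlonglongrightarrow> 0" using tendsto_mult_left[OF r(2), of L] by simp
      ultimately have "(\<lambda>n. (\<integral>x. f x \<partial>m) - (\<integral>x. f x \<partial>N (vn n) (Vn n))) \<longlonglongrightarrow> 0"
        by (intro Lim_null_comparison[OF _ \<open>(\<lambda>n. L * r n) \<longlonglongrightarrow> 0\<close>] always_eventually allI)
          (simp only: real_norm_def)
      from tendsto_diff[OF tendsto_const[of "\<integral>x. f x \<partial>m"] this]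
      show "(\<lambda>n. \<integral>x. f x \<partial>N (vn n) (Vn n)) \<longlonglongrightarrow> (\<integral>x. f x \<partial>m)" by simp
    qed
    interpret N: prob_space "N v V" by (rule N_props(1)[OF V])
    have "(\<integral>x. 1 - f x \<partial>N v V) \<le> (\<integral>x. 1 - f x \<partial>m)"
      using f by (intro le continuous_intros) (auto simp: abs_minus_commute)
    moreover have "integrable m f" "integrable (N v V) f"
      using f by (auto intro!: integrable_P2_bounded m2 N_P2 V)
    ultimately have "(\<integral>x. f x \<partial>m) \<le> (\<integral>x. f x \<partial>N v V)"
      by (simp add: m.prob_space N.prob_space)
    with le[OF f(1,3,4,5)] show "(\<integral>x. f x \<partial>m) = (\<integral>x. f x \<partial>N v V)" by simp
  qed (use P2D[OF m2] N_props[OF V] in auto)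
qed

end

section \<open>Convexity forces homogeneity\<close>

text \<open>This is where dimension at least two enters.\<close>

lemma diagonal_with_average_det:
  assumes card: "CARD('n::finite) \<ge> 2" and \<kappa>: "1 \<le> \<kappa>"
  obtains t :: "'n::finite \<Rightarrow> real" where "\<And>i. 0 < t i" "(\<Prod>i\<in>UNIV. t i) = 1" "(\<Prod>i\<in>UNIV. (1 + t i) / 2) = \<kappa>"
proof -
  obtain i j :: 'n where ij: "i \<noteq> j"
    using card card_le_Suc0_iff_eq[of "UNIV :: 'n set"] by (auto simp: numeral_2_eq_2)
  \<comment> \<open>The larger root of \<open>(1 + k)\<^sup>2 = 4 * \<kappa> * k\<close>, real
    because \<open>1 \<le> \<kappa>\<close>. The entries \<open>k\<close> and \<open>1 / k\<close>
    have product 1, and the product of their averages with 1 is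
    \<open>(1 + k)\<^sup>2 / (4 * k)\<close>.\<close>
  define k where "k = 2 * \<kappa> - 1 + 2 * sqrt (\<kappa>\<^sup>2 - \<kappa>)"
  have "0 \<le> \<kappa>\<^sup>2 - \<kappa>" using \<kappa> by (simp add: power2_eq_square)
  then have sq: "(sqrt (\<kappa>\<^sup>2 - \<kappa>))\<^sup>2 = \<kappa>\<^sup>2 - \<kappa>" and q0: "0 \<le> sqrt (\<kappa>\<^sup>2 - \<kappa>)" by simp_all
  have k0: "0 < k" unfolding k_def using \<kappa> q0 by linarith
  have k: "(1 + k) * (1 + k) = 4 * \<kappa> * k"
  proof -
    define w where "w = sqrt (\<kappa>\<^sup>2 - \<kappa>)"
    have "w * w = \<kappa> * \<kappa> - \<kappa>" using sq by (simp add: w_def power2_eq_square)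
    then show ?thesis unfolding k_def w_def[symmetric] by (simp add: algebra_simps)
  qed
  define t where "t l = (if l = i then k else if l = j then 1 / k else 1)" for l
  have split: "(\<Prod>l\<in>UNIV. f (t l)) = f k * f (1 / k)" if "f 1 = 1" for f :: "real \<Rightarrow> real"
  proof -
    have "(\<Prod>l\<in>UNIV. f (t l)) = (\<Prod>l\<in>{i, j}. f (t l))"
      using that by (intro prod.mono_neutral_right) (auto simp: t_def)
    then show ?thesis using ij by (simp add: t_def)
  qed
  show ?thesis
  proof
    show "0 < t l" for l using k0 by (simp add: t_def)
    show "(\<Prod>l\<in>UNIV. t l) = 1" using split[of "\<lambda>x. x"] k0 by simp
    have "(1 + k) / 2 * ((1 + 1 / k) / 2) = \<kappa>" using k k0 by (simp add: field_simps)
    then show "(\<Prod>l\<in>UNIV. (1 + t l) / 2) = \<kappa>" using split[of "\<lambda>x. (1 + x) / 2"] by simp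
  qed
qed

section \<open>Diagonal matrices\<close>

definition diag :: "('n::finite \<Rightarrow> real) \<Rightarrow> real^'n^'n" where
  "diag s = (\<chi> i j. if i = j then s i else 0)"

lemma diag_mult_vec: "diag s *v x = (\<chi> i. s i * x $ i)"
  by (simp add: diag_def matrix_vector_mult_def vec_eq_iff
      if_distrib[where f="\<lambda>a. a * b" for b] cong: if_cong)

lemma transpose_diag [simp]: "transpose (diag s) = diag s"
  by (auto simp: diag_def transpose_def vec_eq_iff)

lemma diag_mul_diag: "diag s ** diag t = diag (\<lambda>i. s i * t i)"
  by (simp add: diag_def matrix_matrix_mult_def vec_eq_iff
      if_distrib[where f="\<lambda>a. a * b" for b] cong: if_cong)

lemma diag_1: "diag (\<lambda>i. 1) = mat 1"
  by (simp add: diag_def mat_def vec_eq_iff)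

lemma invertible_diag: "(\<And>i. s i \<noteq> 0) \<Longrightarrow> invertible (diag s)"
  unfolding invertible_def
  by (rule exI[of _ "diag (\<lambda>i. 1 / s i)"]) (simp add: diag_mul_diag diag_1)

lemma spd_diag:
  assumes "\<And>i. 0 < s i"
  shows "diag s \<in> spd"
proof -
  have "0 < x \<bullet> (diag s *v x)" if x: "x \<noteq> 0" for x
  proof -
    obtain k where "x $ k \<noteq> 0" using x by (metis vec_eq_iff zero_index)
    then have "0 < (\<Sum>i\<in>UNIV. s i * (x $ i)\<^sup>2)"
      using assms by (intro sum_pos2[of _ k]) (auto simp: less_imp_le)
    then show ?thesis by (simp add: diag_mult_vec inner_vec_def power2_eq_square mult_ac)
  qed
  then show ?thesis by (simp add: spd_def)
qed

section \<open>The functional equation extracted from convexity\<close>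

context normalized
begin

text \<open>The left side is the density of the midpoint as an affine image, the right side its
  density as a member of the closure. \<open>V\<close> varies with \<kappa>, the right side does
  not.\<close>

lemma profile_scaling:
  assumes card: "CARD('n) \<ge> 2" and conv: "W2_convex (W2_closure (N_space \<phi> lam c))"
    and \<kappa>: "1 \<le> \<kappa>"
  obtains V where "V \<in> spd" "\<And>r. 0 \<le> r \<Longrightarrow> ennreal (1 / \<kappa>) * profile V r = profile (mat 1) r"
proof -
  let ?\<N> = "N_space \<phi> lam c"
  obtain t :: "'n \<Rightarrow> real" where t: "\<And>i. 0 < t i" "(\<Prod>i\<in>UNIV. t i) = 1" "(\<Prod>i\<in>UNIV. (1 + t i) / 2) = \<kappa>"
    using diagonal_with_average_det[OF card \<kappa>] by blast
  define s where "s i = (1 + t i) / 2" for i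
  have s: "0 < s i" for i using t(1)[of i] by (simp add: s_def)
  define V where "V = diag (\<lambda>i. 1 / (s i * s i))"
  have V: "V \<in> spd" using s unfolding V_def by (intro spd_diag) simp
  have SVS: "diag s ** V ** transpose (diag s) = mat 1"
    using s by (simp add: V_def diag_mul_diag less_imp_neq[symmetric] flip: diag_1)
  let ?\<mu> = "N 0 V" and ?U = "diag t ** V ** transpose (diag t)"
  have invt: "invertible (diag t)" and invs: "invertible (diag s)"
    using t(1) s by (auto intro!: invertible_diag simp: less_imp_neq[symmetric])
  have U: "?U \<in> spd" using V invt by (rule spd_congruence)
  have "distr lborel borel (\<lambda>x. 0 + diag t *v x) = density lborel (\<lambda>_. ennreal 1)"
    using distr_lborel_diagonal[of t] t(1,2) by (simp add: diag_mult_vec less_imp_neq[symmetric] less_imp_le)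
  then have \<nu>: "distr ?\<mu> borel (\<lambda>x. 0 + diag t *v x) = N 0 ?U"
    by (rule distr_N_eq[OF V invt _ lam_c(2,3)[OF V]]) (simp add: profile_def)
  have mem: "?\<mu> \<in> W2_closure ?\<N>" "N 0 ?U \<in> W2_closure ?\<N>"
  proof -
    have "?\<mu> \<in> ?\<N>" "N 0 ?U \<in> ?\<N>" unfolding N_space_def using V U by blast+
    then show "?\<mu> \<in> W2_closure ?\<N>" "N 0 ?U \<in> W2_closure ?\<N>"
      by (auto intro: subset_W2_closure[OF N_space_P2])
  qed
  obtain \<gamma> where \<gamma>: "W2_geodesic \<gamma>" "\<gamma> 0 = ?\<mu>" "\<gamma> 1 = N 0 ?U" "\<forall>u\<in>{0..1}. \<gamma> u \<in> W2_closure ?\<N>"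
    using conv mem unfolding W2_convex_def by blast
  define m where "m = \<gamma> (1 / 2)"
  have m: "m \<in> W2_closure ?\<N>" using \<gamma>(4) by (simp add: m_def)
  then have m2: "m \<in> P2" by (simp add: W2_closure_def)
  have geo: "W2 (\<gamma> a) (\<gamma> b) = \<bar>a - b\<bar> * W2 (\<gamma> 0) (\<gamma> 1)" if "a \<in> {0..1}" "b \<in> {0..1}" for a b
    using \<gamma>(1) that unfolding W2_geodesic_def by blast
  have nu: "N 0 ?U = distr ?\<mu> borel (\<lambda>x. \<chi> i. t i * x $ i)" using \<nu> by (simp add: diag_mult_vec)
  have half: "W2 ?\<mu> m = W2 ?\<mu> (distr ?\<mu> borel (\<lambda>x. \<chi> i. t i * x $ i)) / 2"
    "W2 m (distr ?\<mu> borel (\<lambda>x. \<chi> i. t i * x $ i)) = W2 ?\<mu> (distr ?\<mu> borel (\<lambda>x. \<chi> i. t i * x $ i)) / 2"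
    using geo[of 0 "1 / 2"] geo[of "1 / 2" 1] \<gamma>(2,3) nu by (simp_all add: m_def)
  have "m = distr ?\<mu> borel (\<lambda>x. \<chi> i. (1 + t i) / 2 * x $ i)"
    by (rule W2_midpoint_unique[OF N_P2[OF V] m2 t(1) half])
  then have m_eq: "m = distr ?\<mu> borel (\<lambda>x. 0 + diag s *v x)" by (simp add: diag_mult_vec s_def)
  have "has_mean m 0" "has_covariance m 0 (mat 1)"
    using has_mean_affine[OF N_props(1-3)[OF V], of 0 "diag s"]
      has_covariance_affine[OF N_props(2,4)[OF V], of 0 "diag s"] unfolding m_eq SVS by simp_all
  then have mN: "m = N 0 (mat 1)" by (rule closure_member_eq_N[OF m _ _ spd_mat_1])
  have "(\<Prod>i\<in>UNIV. \<bar>s i\<bar>) = \<kappa>" using t(3) s by (simp add: s_def[symmetric] less_imp_le)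
  then have k: "distr lborel borel (\<lambda>x. 0 + diag s *v x) = density lborel (\<lambda>_. ennreal (1 / \<kappa>))"
    using distr_lborel_diagonal[of s] s by (simp add: diag_mult_vec less_imp_neq[symmetric])
  have "m = density lborel (\<lambda>x. ennreal (1 / \<kappa>) * profile V (sqnorm_wrt (mat 1) x))"
    using distr_elliptic_density[OF V invs measurable_profile k] unfolding m_eq SVS by (simp add: N_eq)
  then have eq: "density lborel (\<lambda>x::real^'n. ennreal (1 / \<kappa>) * profile V (sqnorm_wrt (mat 1) x)) =
      density lborel (\<lambda>x. profile (mat 1) (sqnorm_wrt (mat 1) x))"
    using mN by (simp add: N_eq)
  show ?thesis
  proof (rule that[OF V])
    fix r :: real assume "0 \<le> r"
    then show "ennreal (1 / \<kappa>) * profile V r = profile (mat 1) r"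
      using elliptic_density_eqD[OF spd_mat_1 _ continuous_profile eq]
      by (simp add: ennreal_continuous_on_cmult continuous_profile)
  qed
qed

lemma local_homogeneity:
  assumes card: "CARD('n) \<ge> 2" and conv: "W2_convex (W2_closure (N_space \<phi> lam c))"
  obtains y0 where "0 < y0"
    "\<And>\<kappa>. 1 \<le> \<kappa> \<Longrightarrow> \<exists>m. \<forall>y\<in>{0<..<y0}. \<phi> (\<kappa> * y) = m * \<phi> y"
proof -
  let ?I = "mat 1 :: real^'n^'n"
  note I = lam_c[OF spd_mat_1]
  \<comment> \<open>The maximum of the profile at identity covariance, taken at
    \<open>r = 0\<close>. All values between 0 and \<open>y0\<close> are attained, whatever \<kappa>
    is.\<close>
  obtain y0 where y0: "0 < y0" "ln_phi \<phi> y0 = lam ?I" using ln_phi_surj[OF I(1,2)] by blast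
  have "\<exists>m. \<forall>y\<in>{0<..<y0}. \<phi> (\<kappa> * y) = m * \<phi> y" if \<kappa>: "1 \<le> \<kappa>" for \<kappa>
  proof -
    obtain V where V: "V \<in> spd" and sc: "\<And>r. 0 \<le> r \<Longrightarrow> ennreal (1 / \<kappa>) * profile V r = profile ?I r"
      using profile_scaling[OF card conv \<kappa>] by blast
    define b where "b = c V / c ?I"
    define a where "a = lam V - b * lam ?I"
    have b: "0 < b" using I(3) lam_c(3)[OF V] by (simp add: b_def)
    have ln: "ln_phi \<phi> (\<kappa> * y) = a + b * ln_phi \<phi> y" if y: "0 < y" "y < y0" for y
    proof -
      \<comment> \<open>The squared radius at which the profile at identity covariance takes the
        value \<open>y\<close>.\<close>
      define r where "r = (lam ?I - ln_phi \<phi> y) / c ?I"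
      have "ln_phi \<phi> y < lam ?I" using ln_phi_less[OF y] y0 by simp
      then have r: "0 \<le> r" using I(3) by (simp add: r_def)
      have "profile ?I r = exp_phi \<phi> (ln_phi \<phi> y)" using I(3) by (simp add: profile_def r_def)
      then have "ennreal (1 / \<kappa>) * profile V r = ennreal y" using sc[OF r] y by (simp add: exp_phi_ln)
      then have "ennreal \<kappa> * (ennreal (1 / \<kappa>) * profile V r) = ennreal \<kappa> * ennreal y" by simp
      moreover have "ennreal \<kappa> * (ennreal (1 / \<kappa>) * profile V r) = profile V r"
        using \<kappa> by (simp add: mult.assoc[symmetric] ennreal_mult[symmetric])
      ultimately have "profile V r = ennreal (\<kappa> * y)" using \<kappa> y by (simp add: ennreal_mult)
      then have "lam V - c V * r = ln_phi \<phi> (\<kappa> * y)"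
        using \<kappa> y exp_phi_eq_ennreal_iff[of "\<kappa> * y"] by (simp add: profile_def)
      then show ?thesis using I(3) by (simp add: a_def b_def r_def field_simps)
    qed
    have "\<phi> (\<kappa> * y) = \<kappa> / b * \<phi> y" if y: "y \<in> {0<..<y0}" for y
    proof -
      have \<kappa>y: "0 < \<kappa> * y" using \<kappa> y by simp
      have "((\<lambda>y. ln_phi \<phi> (\<kappa> * y)) has_real_derivative (1 / \<phi> (\<kappa> * y)) * \<kappa>) (at y)"
        by (rule DERIV_chain2[where f = "ln_phi \<phi>" and g = "\<lambda>y. \<kappa> * y", OF DERIV_ln_phi[OF \<kappa>y]]) (auto intro!: derivative_eq_intros)
      moreover have "((\<lambda>y. a + b * ln_phi \<phi> y) has_real_derivative b * (1 / \<phi> y)) (at y)"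
        using y by (auto intro!: derivative_eq_intros DERIV_ln_phi)
      then have "((\<lambda>y. ln_phi \<phi> (\<kappa> * y)) has_real_derivative b * (1 / \<phi> y)) (at y)"
        by (rule has_field_derivative_transform_within_open[OF _ open_greaterThanLessThan y]) (simp add: ln)
      ultimately have "(1 / \<phi> (\<kappa> * y)) * \<kappa> = b * (1 / \<phi> y)" by (rule DERIV_unique)
      then show ?thesis using pos[OF \<kappa>y] pos[of y] y b by (simp add: field_simps)
    qed
    then show ?thesis by blast
  qed
  with y0(1) that show ?thesis by blast
qed

end

section \<open>Cauchy's equation and the passage to powers\<close>

lemma monotone_additive_linear:
  fixes F :: "real \<Rightarrow> real"
  assumes add: "\<And>u v. 0 \<le> u \<Longrightarrow> 0 \<le> v \<Longrightarrow> F (u + v) = F u + F v"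
    and mono: "\<And>u v. 0 \<le> u \<Longrightarrow> u \<le> v \<Longrightarrow> F u \<le> F v"
    and u: "0 \<le> u"
  shows "F u = u * F 1"
proof (rule ccontr)
  assume ne: "F u \<noteq> u * F 1"
  have F0: "F 0 = 0" using add[of 0 0] by simp
  have nat: "F (real n * v) = real n * F v" if "0 \<le> v" for n v
  proof (induction n)
    case (Suc n)
    have "F (real (Suc n) * v) = F (real n * v + v)" by (simp add: algebra_simps)
    with Suc that show ?case by (simp add: add algebra_simps)
  qed (simp add: F0)
  have F1: "0 \<le> F 1" using mono[of 0 1] F0 by simp
  \<comment> \<open>Enclosing \<open>n * u\<close> between consecutive integers bounds
    \<open>n\<close> times the error by \<open>F 1\<close>, independently of \<open>n\<close>, so
    the error must vanish.\<close>
  have bound: "real n * \<bar>F u - u * F 1\<bar> \<le> F 1" for n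
  proof -
    define k where "k = nat \<lfloor>real n * u\<rfloor>"
    have k: "real k \<le> real n * u" "real n * u \<le> real (Suc k)"
      using u unfolding k_def by (auto simp: of_nat_nat) linarith
    have "real k * F 1 \<le> real n * F u" "real n * F u \<le> real (Suc k) * F 1"
      using mono[OF _ k(1)] mono[OF _ k(2)] nat[of 1 k] nat[of 1 "Suc k"] nat[OF u, of n] u by simp_all
    moreover have "real k * F 1 \<le> real n * u * F 1" "real n * u * F 1 \<le> real (Suc k) * F 1"
      using k F1 by (auto intro: mult_right_mono)
    ultimately have "\<bar>real n * F u - real n * u * F 1\<bar> \<le> F 1" by (simp add: algebra_simps)
    moreover have "real n * \<bar>F u - u * F 1\<bar> = \<bar>real n * F u - real n * u * F 1\<bar>"
      by (simp add: abs_mult mult.assoc flip: right_diff_distrib)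
    ultimately show ?thesis by simp
  qed
  have "0 < \<bar>F u - u * F 1\<bar>" using ne by simp
  then obtain n :: nat where "F 1 < real n * \<bar>F u - u * F 1\<bar>"
    using reals_Archimedean3 by blast
  with bound[of n] show False by simp
qed

text \<open>The multiplier \<open>M\<close> is multiplicative and inherits monotonicity from \<phi>;
  in logarithmic coordinates it solves Cauchy's equation on the half-line, so it is a power.\<close>

lemma homogeneous_imp_power:
  fixes \<phi> :: "real \<Rightarrow> real"
  assumes pos: "\<And>s. 0 < s \<Longrightarrow> 0 < \<phi> s" and mono: "strict_mono_on {0<..} \<phi>" and y0: "0 < y0"
    and hom: "\<And>\<kappa>. 1 \<le> \<kappa> \<Longrightarrow> \<exists>m. \<forall>y\<in>{0<..<y0}. \<phi> (\<kappa> * y) = m * \<phi> y"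
  obtains \<alpha> q where "0 < \<alpha>" "\<And>s. 0 < s \<Longrightarrow> \<alpha> * \<phi> s = s powr q"
proof -
  define z where "z = y0 / 2"
  have z: "0 < z" "z < y0" using y0 by (simp_all add: z_def)
  define M where "M \<kappa> = \<phi> (\<kappa> * z) / \<phi> z" for \<kappa>
  have M: "\<phi> (\<kappa> * y) = M \<kappa> * \<phi> y" if "1 \<le> \<kappa>" "0 < y" "y < y0" for \<kappa> y
  proof -
    obtain m where m: "\<forall>y\<in>{0<..<y0}. \<phi> (\<kappa> * y) = m * \<phi> y" using hom \<open>1 \<le> \<kappa>\<close> by blast
    then have "M \<kappa> = m" using z pos[of z] by (simp add: M_def)
    with m that show ?thesis by simp
  qed
  have M_pos: "0 < M \<kappa>" if "1 \<le> \<kappa>" for \<kappa> using pos z that by (simp add: M_def)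
  define F where "F u = ln (M (exp u))" for u
  have F_add: "F (u + v) = F u + F v" if "0 \<le> u" "0 \<le> v" for u v
  proof -
    have e: "1 \<le> exp u" "1 \<le> exp v" "1 \<le> exp u * exp v" using that by (auto simp flip: exp_add)
    \<comment> \<open>A base point below \<open>z\<close>, so that the multiplier relation may be
      applied at \<open>y\<close> and at \<open>z = exp v * y\<close>, both below
      \<open>y0\<close>.\<close>
    define y where "y = z / exp v"
    have "y \<le> z" using mult_left_mono[OF e(2), of z] z by (simp add: y_def divide_le_eq)
    then have y: "0 < y" "y < y0" "exp v * y = z" using z by (simp_all add: y_def)
    have "M (exp u * exp v) * \<phi> y = \<phi> (exp u * exp v * y)" using M[OF e(3) y(1,2)] by simp
    also have "\<dots> = \<phi> (exp u * z)" by (simp add: mult.assoc y(3))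
    also have "\<dots> = M (exp u) * \<phi> (exp v * y)" using M[OF e(1) z] by (simp add: y(3))
    also have "\<dots> = M (exp u) * M (exp v) * \<phi> y" using M[OF e(2) y(1,2)] by simp
    finally have "M (exp u * exp v) = M (exp u) * M (exp v)" using pos[OF y(1)] by simp
    then show ?thesis
      using M_pos[OF e(1)] M_pos[OF e(2)] by (simp add: F_def exp_add ln_mult)
  qed
  have F_mono: "F u \<le> F v" if "0 \<le> u" "u \<le> v" for u v
  proof -
    have "\<phi> (exp u * z) \<le> \<phi> (exp v * z)"
      using that z by (intro strict_mono_on_leD[OF mono]) auto
    then have "M (exp u) \<le> M (exp v)" using pos[OF z(1)] by (simp add: M_def divide_right_mono)
    then show ?thesis using M_pos[of "exp u"] that by (simp add: F_def)
  qed
  define q where "q = F 1"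
  have M_eq: "M \<kappa> = \<kappa> powr q" if \<kappa>: "1 \<le> \<kappa>" for \<kappa>
  proof -
    have "F (ln \<kappa>) = ln \<kappa> * q"
      unfolding q_def by (rule monotone_additive_linear[OF F_add F_mono]) (use \<kappa> in auto)
    then have "ln (M \<kappa>) = q * ln \<kappa>" using \<kappa> by (simp add: F_def)
    then show ?thesis using M_pos[OF \<kappa>] \<kappa> by (metis exp_ln powr_def less_le_trans zero_less_one less_irrefl)
  qed
  define \<alpha> where "\<alpha> = z powr q / \<phi> z"
  show ?thesis
  proof
    show "0 < \<alpha>" using z pos[OF z(1)] by (simp add: \<alpha>_def)
    fix s :: real assume s: "0 < s"
    show "\<alpha> * \<phi> s = s powr q"
    \<comment> \<open>Only factors of at least 1 are available: from \<open>z\<close> up to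
      \<open>s\<close> in one case, from \<open>s\<close> up to \<open>z\<close> in the
      other.\<close>
    proof (cases "z \<le> s")
      case True
      then have "\<phi> s = (s / z) powr q * \<phi> z" using M[of "s / z" z] M_eq[of "s / z"] z by simp
      then show ?thesis using pos[OF z(1)] z s by (simp add: \<alpha>_def powr_divide)
    next
      case False
      then have "\<phi> z = (z / s) powr q * \<phi> s" using M[of "z / s" s] M_eq[of "z / s"] z s by simp
      then show ?thesis using pos[OF z(1)] pos[OF s] z s by (simp add: \<alpha>_def powr_divide field_simps)
    qed
  qed
qed

text \<open>Strict growth gives \<open>0 < q\<close>. For a \<delta> below \<open>a\<close>
  witnessing \<open>delta_upper\<close>, an exponent \<open>q \<ge> 1 + \<delta>\<close> would keep
  the diverging quotient below \<alpha> on all \<open>s \<ge> 1\<close>.\<close>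

lemma O_class_power_exponent:
  assumes \<phi>: "\<phi> \<in> O_class a" and \<alpha>: "0 < \<alpha>" "\<And>s. 0 < s \<Longrightarrow> \<alpha> * \<phi> s = s powr q"
  shows "0 < q" "q < 1 + a"
proof -
  have "\<phi> 1 < \<phi> 2" using \<phi> by (auto simp: O_class_def strict_mono_on_def)
  then have "\<alpha> * \<phi> 1 < \<alpha> * \<phi> 2" using \<alpha>(1) by simp
  then have "(2::real) powr 0 < 2 powr q" using \<alpha>(2)[of 1] \<alpha>(2)[of 2] by simp
  then show "0 < q" by (simp del: powr_zero_eq_one)
  have "delta_upper \<phi> < ereal a" using \<phi> by (simp add: O_class_def)
  then obtain \<delta> where \<delta>: "\<delta> < a" and lim: "filterlim (\<lambda>s. s powr (1 + \<delta>) / \<phi> s) at_top at_top"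
    unfolding delta_upper_def Inf_less_iff by auto
  have "0 < 1 + \<delta> - q"
  proof (rule ccontr)
    assume neg: "\<not> 0 < 1 + \<delta> - q"
    have "eventually (\<lambda>s. \<alpha> < s powr (1 + \<delta>) / \<phi> s) at_top"
      using lim by (simp add: filterlim_at_top_dense)
    then have "eventually (\<lambda>s. \<alpha> < s powr (1 + \<delta>) / \<phi> s \<and> (1::real) \<le> s) at_top"
      using eventually_ge_at_top[of 1] by (rule eventually_conj)
    then obtain s :: real where s: "\<alpha> < s powr (1 + \<delta>) / \<phi> s" "1 \<le> s"
      unfolding eventually_at_top_linorder by blast
    have "\<phi> s = s powr q / \<alpha>" using \<alpha>(1) \<alpha>(2)[of s] s(2) by (simp add: field_simps)
    then have "s powr (1 + \<delta>) / \<phi> s = \<alpha> * s powr (1 + \<delta> - q)" using s(2) by (simp add: powr_diff)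
    also have "\<dots> \<le> \<alpha> * s powr 0" using neg s(2) \<alpha>(1) by (intro mult_left_mono powr_mono) auto
    finally show False using s by simp
  qed
  then show "q < 1 + a" using \<delta> by simp
qed

section \<open>Convexity for powers\<close>

lemma (in white) law_second_moment: "(\<integral>x. (norm x)\<^sup>2 \<partial>law v A) = (norm v)\<^sup>2 + (norm A)\<^sup>2"
proof -
  interpret prob_space Z by (rule prob)
  have eq: "(norm (v + A *v z))\<^sup>2 = (norm v)\<^sup>2 + 2 * (v \<bullet> (A *v z)) + (norm (A *v z))\<^sup>2" for z
    unfolding power2_norm_eq_inner by (simp add: inner_add_left inner_add_right inner_commute)
  have "(\<integral>x. (norm x)\<^sup>2 \<partial>law v A) = (\<integral>z. (norm (v + A *v z))\<^sup>2 \<partial>Z)"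
    unfolding law_def by (rule integral_distr[OF affine_measurable]) simp
  also have "\<dots> = (norm v)\<^sup>2 + (norm A)\<^sup>2"
    unfolding eq using norm_moment[of A] linear_moment[of v A] by (simp add: prob_space)
  finally show ?thesis .
qed

text \<open>Second moments bound \<open>v\<close> and \<open>A\<close> along the sequence, so a
  subsequence of parameters converges, and with it the laws. The matrices themselves need not
  converge, since different ones may give the same law.\<close>

lemma (in white) law_subsequence_limit:
  assumes \<mu>: "\<mu> \<in> P2" and r: "r \<longlonglongrightarrow> 0" and W2n: "\<And>n. W2 \<mu> (law (vn n) (An n)) < r n"
  obtains v A where "\<mu> = law v A"
proof -
  let ?C = "\<integral>x. (norm x)\<^sup>2 \<partial>\<mu>"
  obtain K where K: "\<And>n. norm (r n) \<le> K"
    using Bseq_def convergent_imp_Bseq[of r] r unfolding convergent_def by (metis (no_types))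
  have sq: "(norm (vn n, An n))\<^sup>2 \<le> 2 * ?C + 2 * K\<^sup>2" for n
  proof -
    have "(norm (vn n))\<^sup>2 + (norm (An n))\<^sup>2 \<le> 2 * ?C + 2 * (r n)\<^sup>2"
      using W2_second_moment(2)[OF \<mu> law_P2 W2n] by (simp add: law_second_moment)
    also have "(r n)\<^sup>2 \<le> K\<^sup>2" using power_mono[OF K[of n], of 2] by simp
    finally show ?thesis by (simp add: norm_Pair)
  qed
  have "norm (vn n, An n) \<le> sqrt (2 * ?C + 2 * K\<^sup>2)" for n
    using real_sqrt_le_mono[OF sq[of n]] by simp
  then have "bounded (range (\<lambda>n. (vn n, An n)))"
    by (auto intro!: boundedI)
  then obtain l s where s: "strict_mono s" and l: "((\<lambda>n. (vn n, An n)) \<circ> s) \<longlonglongrightarrow> l"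
    using bounded_imp_convergent_subsequence by blast
  obtain v A where "l = (v, A)" by (cases l)
  with l have lim: "(\<lambda>n. vn (s n)) \<longlonglongrightarrow> v" "(\<lambda>n. An (s n)) \<longlonglongrightarrow> A"
    using tendsto_fst[OF l] tendsto_snd[OF l] by (simp_all add: comp_def)
  have rs: "(\<lambda>n. r (s n)) \<longlonglongrightarrow> 0"
    using LIMSEQ_subseq_LIMSEQ[OF r s] by (simp add: comp_def)
  have r0: "0 < r n" for n using W2_nonneg[OF \<mu> law_P2] W2n[of n] by (rule le_less_trans)
  \<comment> \<open>The positive summand \<open>r (s n)\<close> makes the bound on the distance
    strict, as the Lipschitz estimate asks.\<close>
  define \<delta> where "\<delta> n = sqrt ((norm (vn (s n) - v))\<^sup>2 + (norm (An (s n) - A))\<^sup>2) + r (s n)" for n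
  have "\<delta> \<longlonglongrightarrow> sqrt ((norm (v - v))\<^sup>2 + (norm (A - A))\<^sup>2) + 0"
    unfolding \<delta>_def by (intro tendsto_intros lim rs)
  then have \<delta>: "\<delta> \<longlonglongrightarrow> 0" by simp
  have W2\<delta>: "W2 (law (vn (s n)) (An (s n))) (law v A) < \<delta> n" for n
    using W2_law_le[of "vn (s n)" "An (s n)" v A] r0[of "s n"] by (simp add: \<delta>_def)
  have "\<mu> = law v A"
  proof (rule measure_eqI_lipschitz)
    fix f :: "real^'n \<Rightarrow> real" and L
    assume f: "continuous_on UNIV f" "0 \<le> L" "\<And>x y. \<bar>f x - f y\<bar> \<le> L * norm (x - y)"
      "\<And>x. 0 \<le> f x" "\<And>x. f x \<le> 1"
    have b: "\<bar>(\<integral>x. f x \<partial>\<mu>) - (\<integral>x. f x \<partial>law v A)\<bar> \<le> L * r (s n) + L * \<delta> n" for n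
    proof -
      have "\<bar>(\<integral>x. f x \<partial>\<mu>) - (\<integral>x. f x \<partial>law (vn (s n)) (An (s n)))\<bar> \<le> L * r (s n)"
        using f by (intro W2_lipschitz[OF \<mu> law_P2 W2n] borel_measurable_continuous_onI
            integrable_P2_bounded \<mu> law_P2) auto
      moreover have "\<bar>(\<integral>x. f x \<partial>law (vn (s n)) (An (s n))) - (\<integral>x. f x \<partial>law v A)\<bar> \<le> L * \<delta> n"
        using f by (intro W2_lipschitz[OF law_P2 law_P2 W2\<delta>] borel_measurable_continuous_onI
            integrable_P2_bounded law_P2) auto
      ultimately show ?thesis by linarith
    qed
    have "(\<lambda>n. L * r (s n) + L * \<delta> n) \<longlonglongrightarrow> L * 0 + L * 0"
      by (intro tendsto_intros rs \<delta>)
    then have "\<bar>(\<integral>x. f x \<partial>\<mu>) - (\<integral>x. f x \<partial>law v A)\<bar> \<le> L * 0 + L * 0"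
      by (rule LIMSEQ_le_const) (use b in blast)
    then show "(\<integral>x. f x \<partial>\<mu>) = (\<integral>x. f x \<partial>law v A)" by simp
  qed (use P2D[OF \<mu>] prob_law sets_law in auto)
  then show ?thesis by (rule that)
qed

text \<open>Rotate \<open>A\<close> to a semidefinite matrix, add a small multiple of the identity,
  and rotate back.\<close>

lemma invertible_approximation:
  fixes A :: "real^'n^'n"
  assumes "0 < \<epsilon>"
  obtains B where "invertible B" "norm (A - B) < \<epsilon>"
proof -
  obtain R :: "real^'n^'n" where R: "orthogonal_matrix R" and P: "psd (A ** R)"
    by (rule polar_decomposition)
  define \<eta> where "\<eta> = \<epsilon> / (norm (mat 1 :: real^'n^'n) + 1)"
  have \<eta>: "0 < \<eta>" using assms by (simp add: \<eta>_def add_nonneg_pos)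
  define B where "B = (A ** R + \<eta> *\<^sub>R mat 1) ** transpose R"
  have "invertible (transpose R)" using R unfolding orthogonal_matrix_def invertible_def by blast
  then have inv: "invertible B"
    unfolding B_def by (intro invertible_mult spd_invertible[OF psd_perturb_spd[OF P \<eta>]])
  have "B = A + \<eta> *\<^sub>R transpose R"
    by (simp add: B_def matrix_add_rdistrib matrix_scaleR_left matrix_mul_orthogonal_cancel[OF R])
  then have "norm (A - B) = \<eta> * norm (transpose R)" using \<eta> by simp
  also have "norm (transpose R) = norm (mat 1 :: real^'n^'n)"
    using norm_orthogonal_mul_left[of "transpose R" "mat 1 :: real^'n^'n"] R by simp
  also have "\<eta> * norm (mat 1 :: real^'n^'n) < \<epsilon>"
    using assms by (simp add: \<eta>_def field_simps add_pos_nonneg)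
  finally show ?thesis using inv that by blast
qed

section \<open>The closure for a power and its geodesics\<close>

locale power_normalized = normalized \<phi> lam c
  for \<phi> :: "real \<Rightarrow> real" and lam c :: "real^'n^'n \<Rightarrow> real" +
  fixes \<alpha> q :: real
  assumes \<alpha>: "0 < \<alpha>" and power: "\<And>s. 0 < s \<Longrightarrow> \<alpha> * \<phi> s = s powr q"
begin

sublocale white "N 0 (mat 1)"
  using N_props[OF spd_mat_1] by (rule white.intro)

text \<open>Homogeneity of the power absorbs the Jacobian factor \<open>k\<close> into the argument.
  Uniqueness also asks for \<open>l\<close> below \<open>L_phi \<phi>\<close>, which follows once
  \<open>l\<close> is recognized as \<open>ln_phi \<phi> (k * y)\<close>.\<close>

lemma law_eq_N:
  assumes A: "invertible A"
  shows "law v A = N v (A ** transpose A)"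
proof -
  let ?I = "mat 1 :: real^'n^'n"
  note I = lam_c[OF spd_mat_1]
  obtain k where k: "0 < k" "distr lborel borel (\<lambda>x. v + A *v x) = density lborel (\<lambda>_. ennreal k)"
    using distr_lborel_matrix[OF A] by metis
  define l b where "l = ln_phi \<phi> k + k powr (1 - q) * lam ?I" and "b = k powr (1 - q) * c ?I"
  obtain y where y: "0 < y" "ln_phi \<phi> y = lam ?I" using ln_phi_surj[OF I(1,2)] by blast
  have "exp_phi \<phi> l = ennreal k * ennreal y"
    using exp_phi_power_scale[OF \<alpha> power k(1), of "lam ?I"] exp_phi_ln[OF y(1)] y(2) by (simp add: l_def)
  then have "exp_phi \<phi> l = ennreal (k * y)" using k(1) y(1) by (simp add: ennreal_mult)
  then have "l = ln_phi \<phi> (k * y)" using exp_phi_eq_ennreal_iff[of "k * y"] k(1) y(1) by simp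
  then have "ereal l < L_phi \<phi>" using ln_less_L_phi[of "k * y"] k(1) y(1) by simp
  moreover have "0 < b" using k(1) I(3) by (simp add: b_def)
  moreover have "ennreal k * profile ?I r = exp_phi \<phi> (l - b * r)" for r
    using exp_phi_power_scale[OF \<alpha> power k(1), of "lam ?I - c ?I * r"]
    by (simp add: profile_def l_def b_def algebra_simps)
  ultimately show ?thesis
    using distr_N_eq[OF spd_mat_1 A k(2)] by (simp add: law_def)
qed

text \<open>The image of the reference measure under \<open>R\<close> is the member with covariance
  \<open>R ** transpose R = mat 1\<close>, that is, the reference measure itself.\<close>

lemma law_mul_orthogonal:
  assumes R: "orthogonal_matrix R"
  shows "law v (A ** R) = law v A"
proof -
  have "invertible R" using R unfolding orthogonal_matrix_def invertible_def by blast
  then have "law 0 R = N 0 (mat 1)" using R by (simp add: law_eq_N orthogonal_matrix_def)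
  then have "law v A = distr (law 0 R) borel (\<lambda>z. v + A *v z)" by (simp add: law_def)
  also have "\<dots> = distr (N 0 (mat 1)) borel ((\<lambda>z. v + A *v z) \<circ> (\<lambda>z. 0 + R *v z))"
    unfolding law_def by (rule distr_distr[OF measurable_affine affine_measurable])
  also have "(\<lambda>z. v + A *v z) \<circ> (\<lambda>z. 0 + R *v z) = (\<lambda>z. v + (A ** R) *v z)"
    by (simp add: fun_eq_iff matrix_vector_mul_assoc)
  finally show ?thesis by (simp add: law_def)
qed

text \<open>One direction factors the covariances of approximating members and extracts a convergent
  subsequence of factors; the other is density of the invertible matrices.\<close>

lemma closure_iff_law: "\<mu> \<in> W2_closure (N_space \<phi> lam c) \<longleftrightarrow> (\<exists>v A. \<mu> = law v A)"
proof
  assume \<mu>: "\<mu> \<in> W2_closure (N_space \<phi> lam c)"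
  define r :: "nat \<Rightarrow> real" where "r n = inverse (real (Suc n))" for n
  have r: "0 < r n" "r \<longlonglongrightarrow> 0" for n
    using LIMSEQ_inverse_real_of_nat by (simp_all add: r_def[abs_def])
  have "\<exists>v A. W2 \<mu> (law v A) < r n" for n
  proof -
    obtain v V where V: "V \<in> spd" "W2 \<mu> (N v V) < r n"
      using \<mu> r(1)[of n] unfolding W2_closure_def N_space_def by blast
    obtain A :: "real^'n^'n" where "invertible A" "V = A ** transpose A"
      using spd_factorization[OF V(1)] by blast
    with V(2) show ?thesis by (metis law_eq_N)
  qed
  then obtain vn An where "\<And>n. W2 \<mu> (law (vn n) (An n)) < r n" by metis
  then show "\<exists>v A. \<mu> = law v A"
    using law_subsequence_limit[OF _ r(2), of \<mu> vn An] \<mu> unfolding W2_closure_def by blast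
next
  assume "\<exists>v A. \<mu> = law v A"
  then obtain v A where \<mu>: "\<mu> = law v A" by blast
  have "\<exists>\<nu>\<in>N_space \<phi> lam c. W2 \<mu> \<nu> < \<epsilon>" if \<epsilon>: "0 < \<epsilon>" for \<epsilon>
  proof -
    obtain B where B: "invertible B" "norm (A - B) < \<epsilon>"
      using invertible_approximation[OF \<epsilon>] by blast
    have "W2 \<mu> (law v B) \<le> norm (A - B)" using W2_law_le[of v A v B] by (simp add: \<mu>)
    moreover have "law v B \<in> N_space \<phi> lam c"
      using spd_congruence[OF spd_mat_1 B(1)] unfolding law_eq_N[OF B(1)] N_space_def by auto
    ultimately show ?thesis using B(2) by force
  qed
  then show "\<mu> \<in> W2_closure (N_space \<phi> lam c)"
    by (simp add: W2_closure_def \<mu> law_P2)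
qed

lemma W2_convex_closure: "W2_convex (W2_closure (N_space \<phi> lam c))"
  unfolding W2_convex_def
proof (intro ballI)
  fix \<mu> \<nu> assume "\<mu> \<in> W2_closure (N_space \<phi> lam c)" "\<nu> \<in> W2_closure (N_space \<phi> lam c)"
  then obtain v A w B where \<mu>: "\<mu> = law v A" and \<nu>: "\<nu> = law w B"
    by (auto simp: closure_iff_law)
  obtain R where R: "orthogonal_matrix R" and P: "psd (transpose A ** B ** R)"
    by (rule polar_decomposition)
  have "transpose (B ** R) ** A = transpose (transpose A ** B ** R)"
    by (simp add: matrix_transpose_mul matrix_mul_assoc)
  then have BA: "psd (transpose (B ** R) ** A)" using P by (simp add: psd_def)
  let ?g = "\<lambda>t. law ((1 - t) *\<^sub>R v + t *\<^sub>R w) ((1 - t) *\<^sub>R A + t *\<^sub>R (B ** R))"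
  have "W2_geodesic ?g" by (rule W2_geodesic_law[OF BA])
  moreover have "?g 0 = \<mu>" "?g 1 = \<nu>" by (simp_all add: \<mu> \<nu> law_mul_orthogonal[OF R])
  moreover have "?g t \<in> W2_closure (N_space \<phi> lam c)" for t unfolding closure_iff_law by blast
  ultimately show "\<exists>\<gamma>. W2_geodesic \<gamma> \<and> \<gamma> 0 = \<mu> \<and> \<gamma> 1 = \<nu> \<and> (\<forall>t\<in>{0..1}. \<gamma> t \<in> W2_closure (N_space \<phi> lam c))"
    by blast
qed

end

theorem proposition4p4:
  fixes \<phi> :: "real \<Rightarrow> real"
    and lam c :: "real^'n^'n \<Rightarrow> real"
  assumes "CARD('n) \<ge> 2"
    and "\<phi> \<in> O_class (2 / (real CARD('n) + 2))"
    and "normalizing_functions \<phi> lam c"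
  shows "W2_convex (W2_closure (N_space \<phi> lam c)) \<longleftrightarrow>
         (\<exists>\<alpha>>0. \<exists>q\<in>{0<..<(real CARD('n) + 4) / (real CARD('n) + 2)}.
            \<forall>s>0. \<alpha> * \<phi> s = s powr q)"
proof
  interpret deformation \<phi> using assms(2) by (rule O_class_deformation)
  interpret normalized \<phi> lam c by unfold_locales (rule assms(3))
  {
    assume conv: "W2_convex (W2_closure (N_space \<phi> lam c))"
    obtain y0 where "0 < y0" "\<And>\<kappa>. 1 \<le> \<kappa> \<Longrightarrow> \<exists>m. \<forall>y\<in>{0<..<y0}. \<phi> (\<kappa> * y) = m * \<phi> y"
      using local_homogeneity[OF assms(1) conv] by blast
    moreover have "strict_mono_on {0<..} \<phi>" using assms(2) by (simp add: O_class_def)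
    ultimately obtain \<alpha> q where \<alpha>: "0 < \<alpha>" and power: "\<And>s. 0 < s \<Longrightarrow> \<alpha> * \<phi> s = s powr q"
      using homogeneous_imp_power[of \<phi> y0] pos by metis
    \<comment> \<open>The upper end of the range of \<open>q\<close> is \<open>1 + a\<close> for the
      class parameter \<open>a = 2 / (d + 2)\<close>.\<close>
    have "1 + 2 / (real CARD('n) + 2) = (real CARD('n) + 4) / (real CARD('n) + 2)"
      by (simp add: field_simps)
    then have "q \<in> {0<..<(real CARD('n) + 4) / (real CARD('n) + 2)}"
      using O_class_power_exponent[OF assms(2) \<alpha> power] by simp
    with \<alpha> power show "\<exists>\<alpha>>0. \<exists>q\<in>{0<..<(real CARD('n) + 4) / (real CARD('n) + 2)}. \<forall>s>0. \<alpha> * \<phi> s = s powr q"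
      by blast
  next
    assume "\<exists>\<alpha>>0. \<exists>q\<in>{0<..<(real CARD('n) + 4) / (real CARD('n) + 2)}. \<forall>s>0. \<alpha> * \<phi> s = s powr q"
    then obtain \<alpha> q where "0 < \<alpha>" "\<And>s. 0 < s \<Longrightarrow> \<alpha> * \<phi> s = s powr q" by blast
    then interpret power_normalized \<phi> lam c \<alpha> q by unfold_locales
    show "W2_convex (W2_closure (N_space \<phi> lam c))" by (rule W2_convex_closure)
  }
qed

end
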